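(* Let $\mathbb K$ be a field of characteristic zero. The algebras $U(W_+)$, $U(W)$, and $U(Vir)/(c-\kappa)$, for any $\kappa\in\mathbb K$, have just infinite Gelfand–Kirillov dimension. In particular, if $I$ is a nonzero two-sided ideal of $U(W_+)$, then $U(W_+)/I$ has polynomial growth.
   Context: Let $\mathbb K$ be a field of characteristic zero. The Witt algebra $W$ is the Lie algebra over $\mathbb K$ with basis $\{e_n : n\in\mathbb Z\}$ and bracket $[e_i,e_j]=(j-i)e_{i+j}$. The positive Witt algebra $W_+$ is the Lie subalgebra of $W$ spanned by $\{e_n : n\ge 1\}$. The Virasoro algebra $Vir$ is the Lie algebra with basis $\{e_n : n\in\mathbb Z\}\cup\{c\}$ and bracket $[e_i,e_j]=(j-i)e_{i+j}+\frac{i^3-i}{12}\delta_{i+j,0}\,c$, with $c$ central. $U(\cdot)$ denotes the universal enveloping algebra, and $(c-\kappa)$ the two-sided ideal generated by $c-\kappa$. The Gelfand–Kirillov dimension (GK-dimension) of a $\mathbb K$-algebra $A$ is $\sup_V \limsup_{n\to\infty}\frac{\log\dim V^n}{\log n}$, the supremum being over finite-dimensional subspaces $V$ of $A$ containing $1$. "Polynomial growth" means finite GK-dimension. An algebra $A$ has just infinite GK-dimension if its GK-dimension is infinite and, for every nonzero two-sided ideal $I$ of $A$, the quotient $A/I$ has polynomial growth. *)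

theory Defs
  imports
    "HOL-Library.Poly_Mapping"
    "HOL-Library.Extended_Real"
    "HOL-Library.Liminf_Limsup"
    "HOL-Algebra.QuotRing"
    "Jordan_Normal_Form.VS_Connect"
begin

section \<open>Associative algebras and their quotients\<close>

text \<open>
  Scalars are the elements of a type \<open>'k::field\<close>, passed to the locales of HOL-Algebra and
  VectorSpace as \<^term>\<open>class_ring :: 'k::field ring\<close>.  The library locale \<open>algebra\<close> demands
  a commutative multiplication, hence the following variant; it reuses the record type of modules.
\<close>

locale assoc_algebra = vectorspace K A + ring A for K and A (structure) +
  assumes smult_mult_left:
      "\<lbrakk>a \<in> carrier K; x \<in> carrier A; y \<in> carrier A\<rbrakk> \<Longrightarrow> (a \<odot> x) \<otimes> y = a \<odot> (x \<otimes> y)"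
    and smult_mult_right:
      "\<lbrakk>a \<in> carrier K; x \<in> carrier A; y \<in> carrier A\<rbrakk> \<Longrightarrow> x \<otimes> (a \<odot> y) = a \<odot> (x \<otimes> y)"

text \<open>
  The quotient of an algebra by a two-sided ideal: the library's quotient ring, with the induced
  scalar multiplication \<open>a \<odot> (I +> x) = I +> (a \<odot> x)\<close>.
\<close>

definition quot_algebra :: "('k, 'a) module \<Rightarrow> 'a set \<Rightarrow> ('k, 'a set) module" where
  "quot_algebra A I =
    \<lparr>carrier = carrier (A Quot I), mult = mult (A Quot I), one = one (A Quot I),
     zero = zero (A Quot I), add = add (A Quot I),
     smult = (\<lambda>a X. \<Union>x\<in>X. I +>\<^bsub>A\<^esub> (a \<odot>\<^bsub>A\<^esub> x))\<rparr>"


section \<open>Gelfand--Kirillov dimension\<close>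

primrec subspace_power :: "('k::field, 'a) module \<Rightarrow> 'a set \<Rightarrow> nat \<Rightarrow> 'a set" where
  "subspace_power A V 0 = module.span class_ring A {\<one>\<^bsub>A\<^esub>}"
| "subspace_power A V (Suc n) =
     module.span class_ring A {x \<otimes>\<^bsub>A\<^esub> y | x y. x \<in> subspace_power A V n \<and> y \<in> V}"

definition gk_dim :: "('k::field, 'a) module \<Rightarrow> ereal" where
  "gk_dim A =
    (SUP V \<in> {V. VectorSpace.subspace class_ring V A
                \<and> vectorspace.fin_dim class_ring (A\<lparr>carrier := V\<rparr>) \<and> \<one>\<^bsub>A\<^esub> \<in> V}.
       limsup (\<lambda>n. ereal
         (ln (real (vectorspace.dim class_ring (A\<lparr>carrier := subspace_power A V n\<rparr>))) / ln (real n))))"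

text \<open>
  The only algebra having some \<open>V\<^sup>n\<close> of dimension \<open>0\<close> is the zero algebra.  Since \<open>ln 0 = 0\<close>
  here, its GK-dimension is \<open>0\<close>; in particular the zero algebra has polynomial growth.
\<close>

definition polynomial_growth :: "('k::field, 'a) module \<Rightarrow> bool" where
  "polynomial_growth A \<longleftrightarrow> gk_dim A < \<infinity>"

definition just_infinite_gk_dim :: "('k::field, 'a) module \<Rightarrow> bool" where
  "just_infinite_gk_dim A \<longleftrightarrow>
    gk_dim A = \<infinity> \<and>
    (\<forall>I. ideal I A \<and> I \<noteq> {\<zero>\<^bsub>A\<^esub>} \<longrightarrow> polynomial_growth (quot_algebra A I))"


section \<open>Free associative algebras\<close>

datatype 'x free_monoid = Free_Monoid (letters: "'x list")

instantiation free_monoid :: (type) monoid_add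
begin
definition zero_free_monoid :: "'a free_monoid" where
  "0 = Free_Monoid []"
definition plus_free_monoid :: "'a free_monoid \<Rightarrow> 'a free_monoid \<Rightarrow> 'a free_monoid" where
  "u + v = Free_Monoid (letters u @ letters v)"
instance
  by standard (auto simp: zero_free_monoid_def plus_free_monoid_def)
end

abbreviation scale :: "'k::field \<Rightarrow> ('b \<Rightarrow>\<^sub>0 'k) \<Rightarrow> ('b \<Rightarrow>\<^sub>0 'k)" where
  "scale a \<equiv> Poly_Mapping.map ((*) a)"

text \<open>
  The product of \<^typ>\<open>'x free_monoid \<Rightarrow>\<^sub>0 'k\<close> is the convolution product of the monoid algebra,
  that is, concatenation of words extended bilinearly.
\<close>

definition free_algebra :: "'x set \<Rightarrow> ('k::field, 'x free_monoid \<Rightarrow>\<^sub>0 'k) module" where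
  "free_algebra X =
    \<lparr>carrier = {p. \<forall>w \<in> Poly_Mapping.keys p. set (letters w) \<subseteq> X},
     mult = (*), one = 1, zero = 0, add = (+), smult = scale\<rparr>"

definition free_gen :: "'x \<Rightarrow> ('x free_monoid \<Rightarrow>\<^sub>0 'k::field)" where
  "free_gen x = Poly_Mapping.single (Free_Monoid [x]) 1"


section \<open>Lie algebras and universal enveloping algebras\<close>

text \<open>The fields \<open>mult\<close> and \<open>one\<close> inherited from the record of modules play no role.\<close>

record ('k, 'l) lie_algebra = "('k, 'l) module" +
  lie_bracket :: "'l \<Rightarrow> 'l \<Rightarrow> 'l"

locale lie_algebra = vectorspace K L for K and L :: "('k, 'l, 'm) lie_algebra_scheme" (structure) +
  assumes bracket_closed:
      "\<lbrakk>x \<in> carrier L; y \<in> carrier L\<rbrakk> \<Longrightarrow> lie_bracket L x y \<in> carrier L"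
    and bracket_add_left:
      "\<lbrakk>x \<in> carrier L; y \<in> carrier L; z \<in> carrier L\<rbrakk>
        \<Longrightarrow> lie_bracket L (x \<oplus> y) z = lie_bracket L x z \<oplus> lie_bracket L y z"
    and bracket_add_right:
      "\<lbrakk>x \<in> carrier L; y \<in> carrier L; z \<in> carrier L\<rbrakk>
        \<Longrightarrow> lie_bracket L x (y \<oplus> z) = lie_bracket L x y \<oplus> lie_bracket L x z"
    and bracket_smult_left:
      "\<lbrakk>a \<in> carrier K; x \<in> carrier L; y \<in> carrier L\<rbrakk>
        \<Longrightarrow> lie_bracket L (a \<odot> x) y = a \<odot> lie_bracket L x y"
    and bracket_smult_right:
      "\<lbrakk>a \<in> carrier K; x \<in> carrier L; y \<in> carrier L\<rbrakk>
        \<Longrightarrow> lie_bracket L x (a \<odot> y) = a \<odot> lie_bracket L x y"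
    and bracket_self: "x \<in> carrier L \<Longrightarrow> lie_bracket L x x = \<zero>"
    and jacobi:
      "\<lbrakk>x \<in> carrier L; y \<in> carrier L; z \<in> carrier L\<rbrakk>
        \<Longrightarrow> lie_bracket L x (lie_bracket L y z) \<oplus> lie_bracket L y (lie_bracket L z x)
              \<oplus> lie_bracket L z (lie_bracket L x y) = \<zero>"

text \<open>
  The tensor algebra of \<open>L\<close> is the free algebra on the set \<open>L\<close> modulo the relations making
  \<open>free_gen\<close> linear (the first two families); the third family imposes
  \<open>xy - yx = [x, y]\<close>.
\<close>

definition uea_relations :: "('k::field, 'l) lie_algebra \<Rightarrow> ('l free_monoid \<Rightarrow>\<^sub>0 'k) set" where
  "uea_relations L =
    {free_gen (x \<oplus>\<^bsub>L\<^esub> y) - free_gen x - free_gen y | x y. x \<in> carrier L \<and> y \<in> carrier L} \<union>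
    {free_gen (a \<odot>\<^bsub>L\<^esub> x) - scale a (free_gen x) | a x. x \<in> carrier L} \<union>
    {free_gen x * free_gen y - free_gen y * free_gen x - free_gen (lie_bracket L x y)
       | x y. x \<in> carrier L \<and> y \<in> carrier L}"

definition uea_ideal :: "('k::field, 'l) lie_algebra \<Rightarrow> ('l free_monoid \<Rightarrow>\<^sub>0 'k) set" where
  "uea_ideal L = genideal (free_algebra (carrier L)) (uea_relations L)"

definition uea ::
    "('k::field, 'l) lie_algebra \<Rightarrow> ('k, ('l free_monoid \<Rightarrow>\<^sub>0 'k) set) module" where
  "uea L = quot_algebra (free_algebra (carrier L)) (uea_ideal L)"

definition uea_embed :: "('k::field, 'l) lie_algebra \<Rightarrow> 'l \<Rightarrow> ('l free_monoid \<Rightarrow>\<^sub>0 'k) set" where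
  "uea_embed L x = uea_ideal L +>\<^bsub>free_algebra (carrier L)\<^esub> free_gen x"


section \<open>The Witt and Virasoro algebras\<close>

text \<open>
  The Lie algebra with basis \<open>'b\<close> and bracket \<open>[i, j] = \<beta> i j\<close> on basis elements, extended
  bilinearly.
\<close>

definition bilinear_extension ::
    "('b \<Rightarrow> 'b \<Rightarrow> ('b \<Rightarrow>\<^sub>0 'k::field)) \<Rightarrow> ('b \<Rightarrow>\<^sub>0 'k) \<Rightarrow> ('b \<Rightarrow>\<^sub>0 'k) \<Rightarrow> ('b \<Rightarrow>\<^sub>0 'k)" where
  "bilinear_extension \<beta> x y =
    (\<Sum>i\<in>Poly_Mapping.keys x. \<Sum>j\<in>Poly_Mapping.keys y.
       scale (Poly_Mapping.lookup x i * Poly_Mapping.lookup y j) (\<beta> i j))"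

definition lie_algebra_on_basis ::
    "('b \<Rightarrow> 'b \<Rightarrow> ('b \<Rightarrow>\<^sub>0 'k::field)) \<Rightarrow> ('k, 'b \<Rightarrow>\<^sub>0 'k) lie_algebra" where
  "lie_algebra_on_basis \<beta> =
    \<lparr>carrier = UNIV, mult = undefined, one = undefined, zero = 0, add = (+), smult = scale,
     lie_bracket = bilinear_extension \<beta>\<rparr>"

definition witt_bracket :: "int \<Rightarrow> int \<Rightarrow> (int \<Rightarrow>\<^sub>0 'k::field_char_0)" where
  "witt_bracket i j = Poly_Mapping.single (i + j) (of_int (j - i))"

definition witt :: "('k::field_char_0, int \<Rightarrow>\<^sub>0 'k) lie_algebra" where
  "witt = lie_algebra_on_basis witt_bracket"

definition witt_plus :: "('k::field_char_0, int \<Rightarrow>\<^sub>0 'k) lie_algebra" where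
  "witt_plus = witt\<lparr>carrier := module.span class_ring witt {Poly_Mapping.single n 1 | n. n \<ge> 1}\<rparr>"

datatype virasoro_basis = Vir_e int | Vir_c

fun virasoro_bracket ::
    "virasoro_basis \<Rightarrow> virasoro_basis \<Rightarrow> (virasoro_basis \<Rightarrow>\<^sub>0 'k::field_char_0)" where
  "virasoro_bracket (Vir_e i) (Vir_e j) =
     Poly_Mapping.single (Vir_e (i + j)) (of_int (j - i)) +
     Poly_Mapping.single Vir_c (if i + j = 0 then of_int (i ^ 3 - i) / 12 else 0)"
| "virasoro_bracket Vir_c _ = 0"
| "virasoro_bracket _ Vir_c = 0"

definition virasoro :: "('k::field_char_0, virasoro_basis \<Rightarrow>\<^sub>0 'k) lie_algebra" where
  "virasoro = lie_algebra_on_basis virasoro_bracket"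

definition virasoro_c :: "virasoro_basis \<Rightarrow>\<^sub>0 'k::field_char_0" where
  "virasoro_c = Poly_Mapping.single Vir_c 1"

definition uea_virasoro_level ::
    "'k::field_char_0 \<Rightarrow>
     ('k, ((virasoro_basis \<Rightarrow>\<^sub>0 'k) free_monoid \<Rightarrow>\<^sub>0 'k) set set) module" where
  "uea_virasoro_level \<kappa> =
    quot_algebra (uea virasoro)
      (genideal (uea virasoro)
        {uea_embed virasoro virasoro_c \<ominus>\<^bsub>uea virasoro\<^esub>
           (\<kappa> \<odot>\<^bsub>uea virasoro\<^esub> \<one>\<^bsub>uea virasoro\<^esub>)})"

section \<open>The constructions are well-defined\<close>

lemma lookup_scale [simp]: "Poly_Mapping.lookup (scale a p) k = a * Poly_Mapping.lookup p k"
  by (simp add: Poly_Mapping.map.rep_eq when_def)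

lemma scale_add_left: "scale (a + b) p = scale a p + scale b p"
  by (rule poly_mapping_eqI) (simp add: lookup_add algebra_simps)

lemma scale_add_right: "scale a (p + q) = scale a p + scale a q"
  by (rule poly_mapping_eqI) (simp add: lookup_add algebra_simps)

lemma scale_scale: "scale a (scale b p) = scale (a * b) p"
  by (rule poly_mapping_eqI) (simp add: mult.assoc)

lemma scale_one [simp]: "scale 1 p = p"
  by (rule poly_mapping_eqI) simp

lemma scale_zero_left [simp]: "scale 0 p = 0"
  by (rule poly_mapping_eqI) simp

lemma scale_zero_right [simp]: "scale a 0 = 0"
  by (rule poly_mapping_eqI) simp

lemma scale_single [simp]: "scale a (Poly_Mapping.single k b) = Poly_Mapping.single k (a * b)"
  by (rule poly_mapping_eqI) (simp add: lookup_single when_def)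

lemma scale_minus: "scale (- a) p = - scale a p"
  by (rule poly_mapping_eqI) simp

lemma scale_sum: "scale a (sum f S) = (\<Sum>i\<in>S. scale a (f i))"
  by (rule poly_mapping_eqI) (simp add: lookup_sum sum_distrib_left)

lemma keys_scale_subset: "Poly_Mapping.keys (scale a p) \<subseteq> Poly_Mapping.keys p"
  by (auto simp: in_keys_iff)

lemma poly_mapping_induct_basis [case_names zero single add]:
  fixes p :: "'b \<Rightarrow>\<^sub>0 'k::field"
  assumes "P 0" and single: "\<And>k a. P (Poly_Mapping.single k a)"
    and add: "\<And>p q. P p \<Longrightarrow> P q \<Longrightarrow> P (p + q)"
  shows "P p"
proof (induction p rule: update_induct)
  case const
  then show ?case by fact
next
  case (update f a b)
  have "Poly_Mapping.update a b f = f + Poly_Mapping.single a b"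
    using update(1)
    by (intro poly_mapping_eqI) (auto simp: lookup_add lookup_update lookup_single when_def in_keys_iff)
  with update(3) show ?case by (simp add: add single)
qed

lemma scale_mult_left: "scale a p * q = scale a (p * (q :: 'b::monoid_add \<Rightarrow>\<^sub>0 'k::field))"
  by (simp add: mult_map_scale_conv_mult mult.assoc)

lemma scale_mult_right: "p * scale a q = scale a (p * (q :: 'b::monoid_add \<Rightarrow>\<^sub>0 'k::field))"
proof -
  have "p * Poly_Mapping.single 0 a = Poly_Mapping.single 0 a * p"
    by (induction p rule: poly_mapping_induct_basis)
      (simp_all add: mult_single algebra_simps)
  then show ?thesis
    by (simp add: mult_map_scale_conv_mult flip: mult.assoc)
qed

lemma vectorspace_poly_mapping:
  fixes V :: "('k::field, 'b \<Rightarrow>\<^sub>0 'k, 'm) module_scheme"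
  assumes "zero V = 0" "add V = (+)" "smult V = scale" "0 \<in> carrier V"
    and "\<And>p q. p \<in> carrier V \<Longrightarrow> q \<in> carrier V \<Longrightarrow> p + q \<in> carrier V"
    and "\<And>a p. p \<in> carrier V \<Longrightarrow> scale a p \<in> carrier V"
  shows "vectorspace class_ring V"
proof -
  have uminus: "- p \<in> carrier V" if "p \<in> carrier V" for p
    using assms(6)[OF that, of "- 1"] by (simp add: scale_minus)
  have "abelian_group V"
  proof (rule abelian_groupI)
    fix x assume "x \<in> carrier V"
    then show "\<exists>y\<in>carrier V. y \<oplus>\<^bsub>V\<^esub> x = \<zero>\<^bsub>V\<^esub>"
      by (intro bexI[of _ "- x"]) (auto simp: assms uminus)
  qed (auto simp: assms(1-3) assms(4-5) add.assoc add.commute)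
  then have "module class_ring V"
    by (intro moduleI class_cring.cring_axioms)
      (simp_all add: assms(1-3) assms(6) scale_add_left scale_add_right scale_scale)
  then show ?thesis
    by (simp add: vectorspace_def class_field)
qed

lemma assoc_algebra_free_algebra:
  "assoc_algebra class_ring (free_algebra X :: ('k::field, 'x free_monoid \<Rightarrow>\<^sub>0 'k) module)"
  (is "assoc_algebra _ ?A")
proof -
  have vs: "vectorspace class_ring ?A"
  proof (rule vectorspace_poly_mapping)
    show "p + q \<in> carrier ?A" if "p \<in> carrier ?A" "q \<in> carrier ?A" for p q
      using that keys_add[of p q] by (auto simp: free_algebra_def)
    show "scale a p \<in> carrier ?A" if "p \<in> carrier ?A" for a p
      using that keys_scale_subset[of a p] by (auto simp: free_algebra_def)
  qed (auto simp: free_algebra_def)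
  have mult: "p * q \<in> carrier ?A" if "p \<in> carrier ?A" "q \<in> carrier ?A" for p q
    using that keys_mult[of p q] by (fastforce simp: free_algebra_def plus_free_monoid_def)
  have one: "1 \<in> carrier ?A"
    by (simp add: free_algebra_def zero_free_monoid_def flip: single_one)
  interpret vectorspace class_ring ?A by (rule vs)
  have "ring ?A"
  proof (rule ringI)
    show "abelian_group ?A" by (rule abelian_group_axioms)
    show "Group.monoid ?A"
    proof (rule monoidI)
      show "x \<otimes>\<^bsub>?A\<^esub> y \<in> carrier ?A" if "x \<in> carrier ?A" "y \<in> carrier ?A" for x y
        using mult[OF that] by (simp add: free_algebra_def)
      show "\<one>\<^bsub>?A\<^esub> \<in> carrier ?A"
        using one by (simp add: free_algebra_def)
    qed (simp_all add: free_algebra_def mult.assoc)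
  qed (simp_all add: free_algebra_def distrib_left distrib_right)
  with vs show ?thesis
    by (intro assoc_algebra.intro assoc_algebra_axioms.intro)
      (simp_all add: free_algebra_def scale_mult_left scale_mult_right)
qed



lemma assoc_algebra_quot_algebra:
  assumes "assoc_algebra K A" "ideal I A"
  shows "assoc_algebra K (quot_algebra A I)"
    and "a \<in> carrier K \<Longrightarrow> x \<in> carrier A \<Longrightarrow>
           a \<odot>\<^bsub>quot_algebra A I\<^esub> (I +>\<^bsub>A\<^esub> x) = I +>\<^bsub>A\<^esub> (a \<odot>\<^bsub>A\<^esub> x)"
proof -
  interpret assoc_algebra K A by fact
  interpret I: ideal I A by fact
  have smult_in: "a \<odot>\<^bsub>A\<^esub> h \<in> I" if a: "a \<in> carrier K" and h: "h \<in> I" for a h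
  proof -
    have "a \<odot>\<^bsub>A\<^esub> h = (a \<odot>\<^bsub>A\<^esub> \<one>\<^bsub>A\<^esub>) \<otimes>\<^bsub>A\<^esub> h"
      using a I.a_Hcarr[OF h] by (simp add: smult_mult_left)
    also have "\<dots> \<in> I"
      using a h by (intro I.I_l_closed) simp_all
    finally show ?thesis .
  qed
  have smult: "a \<odot>\<^bsub>quot_algebra A I\<^esub> (I +>\<^bsub>A\<^esub> x) = I +>\<^bsub>A\<^esub> (a \<odot>\<^bsub>A\<^esub> x)"
    if a: "a \<in> carrier K" and x: "x \<in> carrier A" for a x
  proof -
    have "I +>\<^bsub>A\<^esub> (a \<odot>\<^bsub>A\<^esub> y) = I +>\<^bsub>A\<^esub> (a \<odot>\<^bsub>A\<^esub> x)" if y: "y \<in> I +>\<^bsub>A\<^esub> x" for y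
    proof -
      obtain h where h: "h \<in> I" "y = h \<oplus>\<^bsub>A\<^esub> x"
        using y unfolding a_r_coset_def' by auto
      then have "a \<odot>\<^bsub>A\<^esub> y = a \<odot>\<^bsub>A\<^esub> h \<oplus>\<^bsub>A\<^esub> a \<odot>\<^bsub>A\<^esub> x"
        using a x I.a_Hcarr by (simp add: smult_r_distr)
      then have "a \<odot>\<^bsub>A\<^esub> y \<in> I +>\<^bsub>A\<^esub> (a \<odot>\<^bsub>A\<^esub> x)"
        using smult_in[OF a h(1)] unfolding a_r_coset_def' by auto
      then show ?thesis
        using I.a_repr_independence' smult_closed[OF a x] by blast
    qed
    moreover have "x \<in> I +>\<^bsub>A\<^esub> x"
      using x by (rule I.a_rcos_self)
    ultimately have "(\<Union>y\<in>I +>\<^bsub>A\<^esub> x. I +>\<^bsub>A\<^esub> (a \<odot>\<^bsub>A\<^esub> y)) = I +>\<^bsub>A\<^esub> (a \<odot>\<^bsub>A\<^esub> x)"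
      by blast
    then show ?thesis
      by (simp add: quot_algebra_def)
  qed
  then show "a \<in> carrier K \<Longrightarrow> x \<in> carrier A \<Longrightarrow>
      a \<odot>\<^bsub>quot_algebra A I\<^esub> (I +>\<^bsub>A\<^esub> x) = I +>\<^bsub>A\<^esub> (a \<odot>\<^bsub>A\<^esub> x)" .
  let ?Q = "quot_algebra A I"
  have ring_axioms_Q: "ring ?Q"
  proof -
    interpret Q: ring "A Quot I" by (rule I.quotient_is_ring)
    have "abelian_group ?Q"
    proof (rule abelian_groupI)
      fix X assume "X \<in> carrier ?Q"
      then have "X \<in> carrier (A Quot I)" by (simp add: quot_algebra_def)
      then show "\<exists>Y\<in>carrier ?Q. Y \<oplus>\<^bsub>?Q\<^esub> X = \<zero>\<^bsub>?Q\<^esub>"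
        unfolding quot_algebra_def using Q.a_inv_closed Q.l_neg by auto
    qed (simp_all add: quot_algebra_def Q.a_ac)
    moreover have "Group.monoid ?Q"
      by (rule monoidI) (simp_all add: quot_algebra_def Q.m_assoc)
    ultimately show ?thesis
      by (intro ringI) (simp_all add: quot_algebra_def Q.l_distr Q.r_distr)
  qed
  then interpret Q: ring ?Q .
  have carrier_Q: "X \<in> carrier ?Q \<longleftrightarrow> (\<exists>x\<in>carrier A. X = I +>\<^bsub>A\<^esub> x)" for X
    by (auto simp: quot_algebra_def FactRing_def A_RCOSETS_def')
  have add_Q: "(I +>\<^bsub>A\<^esub> x) \<oplus>\<^bsub>?Q\<^esub> (I +>\<^bsub>A\<^esub> y) = I +>\<^bsub>A\<^esub> (x \<oplus>\<^bsub>A\<^esub> y)"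
    if "x \<in> carrier A" "y \<in> carrier A" for x y
    using that by (simp add: quot_algebra_def FactRing_def I.a_rcos_sum)
  have mult_Q: "(I +>\<^bsub>A\<^esub> x) \<otimes>\<^bsub>?Q\<^esub> (I +>\<^bsub>A\<^esub> y) = I +>\<^bsub>A\<^esub> (x \<otimes>\<^bsub>A\<^esub> y)"
    if "x \<in> carrier A" "y \<in> carrier A" for x y
    using that by (simp add: quot_algebra_def FactRing_def I.rcoset_mult_add)
  have "module K ?Q"
  proof (rule moduleI)
    show "cring K" by (rule R.cring_axioms)
    show "abelian_group ?Q" by (rule Q.abelian_group_axioms)
  qed (auto simp: carrier_Q smult add_Q smult_l_distr smult_r_distr smult_assoc1)
  then have "vectorspace K ?Q"
    by (simp add: vectorspace_def field.field_axioms)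
  then show "assoc_algebra K ?Q"
    by (intro assoc_algebra.intro assoc_algebra_axioms.intro ring_axioms_Q)
      (auto simp: carrier_Q smult mult_Q smult_mult_left smult_mult_right)
qed


lemma bilinear_extension_superset:
  assumes "finite S" "Poly_Mapping.keys x \<subseteq> S" "finite T" "Poly_Mapping.keys y \<subseteq> T"
  shows "bilinear_extension \<beta> x y =
    (\<Sum>i\<in>S. \<Sum>j\<in>T. scale (Poly_Mapping.lookup x i * Poly_Mapping.lookup y j) (\<beta> i j))"
proof -
  have "bilinear_extension \<beta> x y =
    (\<Sum>i\<in>Poly_Mapping.keys x. \<Sum>j\<in>T. scale (Poly_Mapping.lookup x i * Poly_Mapping.lookup y j) (\<beta> i j))"
    unfolding bilinear_extension_def using assms
    by (intro sum.cong refl sum.mono_neutral_left) (simp_all add: in_keys_iff)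
  also have "\<dots> =
    (\<Sum>i\<in>S. \<Sum>j\<in>T. scale (Poly_Mapping.lookup x i * Poly_Mapping.lookup y j) (\<beta> i j))"
    using assms by (intro sum.mono_neutral_left) (simp_all add: in_keys_iff)
  finally show ?thesis .
qed

lemma bilinear_extension_add_left:
  "bilinear_extension \<beta> (x + y) z = bilinear_extension \<beta> x z + bilinear_extension \<beta> y z"
proof -
  have "finite (Poly_Mapping.keys x \<union> Poly_Mapping.keys y)" "finite (Poly_Mapping.keys z)"
    by simp_all
  note * = bilinear_extension_superset[OF this(1) _ this(2) order_refl]
  show ?thesis
    by (subst (1 2 3) *)
      (use keys_add[of x y] in \<open>simp_all add: lookup_add distrib_right scale_add_left sum.distrib\<close>)
qed

lemma bilinear_extension_add_right:
  "bilinear_extension \<beta> z (x + y) = bilinear_extension \<beta> z x + bilinear_extension \<beta> z y"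
proof -
  have "finite (Poly_Mapping.keys z)" "finite (Poly_Mapping.keys x \<union> Poly_Mapping.keys y)"
    by simp_all
  note * = bilinear_extension_superset[OF this(1) order_refl this(2)]
  show ?thesis
    by (subst (1 2 3) *)
      (use keys_add[of x y] in \<open>simp_all add: lookup_add distrib_left scale_add_left sum.distrib\<close>)
qed

lemma bilinear_extension_scale_left:
  "bilinear_extension \<beta> (scale a x) y = scale a (bilinear_extension \<beta> x y)"
  by (subst bilinear_extension_superset[of "Poly_Mapping.keys x" _ "Poly_Mapping.keys y"])
    (simp_all add: keys_scale_subset bilinear_extension_def scale_sum scale_scale mult.assoc)

lemma bilinear_extension_scale_right:
  "bilinear_extension \<beta> x (scale a y) = scale a (bilinear_extension \<beta> x y)"
  by (subst bilinear_extension_superset[of "Poly_Mapping.keys x" _ "Poly_Mapping.keys y"])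
    (simp_all add: keys_scale_subset bilinear_extension_def scale_sum scale_scale mult.left_commute)

lemma bilinear_extension_zero [simp]:
  "bilinear_extension \<beta> 0 y = 0" "bilinear_extension \<beta> x 0 = 0"
  by (simp_all add: bilinear_extension_def)

lemma bilinear_extension_single:
  "bilinear_extension \<beta> (Poly_Mapping.single i a) (Poly_Mapping.single j b) = scale (a * b) (\<beta> i j)"
  by (simp add: bilinear_extension_def)

lemma lie_algebra_on_basis:
  fixes \<beta> :: "'b \<Rightarrow> 'b \<Rightarrow> ('b \<Rightarrow>\<^sub>0 'k::field)"
  assumes self: "\<And>i. \<beta> i i = 0"
    and anti: "\<And>i j. \<beta> i j + \<beta> j i = 0"
    and jacobi: "\<And>i j k.
      bilinear_extension \<beta> (Poly_Mapping.single i 1) (\<beta> j k) +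
      bilinear_extension \<beta> (Poly_Mapping.single j 1) (\<beta> k i) +
      bilinear_extension \<beta> (Poly_Mapping.single k 1) (\<beta> i j) = 0"
  shows "lie_algebra class_ring (lie_algebra_on_basis \<beta>)"
proof -
  let ?L = "lie_algebra_on_basis \<beta>" and ?B = "bilinear_extension \<beta>"
  have "vectorspace class_ring ?L"
    by (rule vectorspace_poly_mapping) (simp_all add: lie_algebra_on_basis_def)
  moreover have anti_sum: "?B x y + ?B y x = 0" for x y
  proof (induction x arbitrary: y rule: poly_mapping_induct_basis)
    case (single i a)
    show ?case
    proof (induction y rule: poly_mapping_induct_basis)
      case (single j b)
      show ?case
        using anti[of i j]
        by (simp add: bilinear_extension_single mult.commute[of b] flip: scale_add_right)
    next
      case (add p q)
      have "?B (Poly_Mapping.single i a) (p + q) + ?B (p + q) (Poly_Mapping.single i a) =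
          (?B (Poly_Mapping.single i a) p + ?B p (Poly_Mapping.single i a)) +
          (?B (Poly_Mapping.single i a) q + ?B q (Poly_Mapping.single i a))"
        by (simp add: bilinear_extension_add_left bilinear_extension_add_right ac_simps)
      then show ?case by (simp add: add)
    qed simp
  next
    case (add p q)
    have "?B (p + q) y + ?B y (p + q) = (?B p y + ?B y p) + (?B q y + ?B y q)"
      by (simp add: bilinear_extension_add_left bilinear_extension_add_right ac_simps)
    then show ?case by (simp add: add)
  qed simp
  moreover have self_sum: "?B x x = 0" for x
  proof (induction x rule: poly_mapping_induct_basis)
    case (single i a)
    then show ?case by (simp add: bilinear_extension_single self)
  next
    case (add p q)
    then show ?case
      using anti_sum[of p q]
      by (simp add: bilinear_extension_add_left bilinear_extension_add_right add.commute)
  qed simp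
  moreover have "?B x (?B y z) + ?B y (?B z x) + ?B z (?B x y) = 0" (is "?J x y z = 0") for x y z
  proof -
    note lin = bilinear_extension_add_left bilinear_extension_add_right
      bilinear_extension_scale_left bilinear_extension_scale_right
    have J_add: "?J (p + q) y z = ?J p y z + ?J q y z" for p q y z
      by (simp add: lin ac_simps)
    have J_rot: "?J x y z = ?J y z x" for x y z
      by (simp add: ac_simps)
    have single: "?J (Poly_Mapping.single i a) (Poly_Mapping.single j b) (Poly_Mapping.single k c) = 0"
      for i j k a b c
    proof -
      have s: "Poly_Mapping.single i a = scale a (Poly_Mapping.single i (1::'k))" for i :: 'b and a
        by simp
      have "?J (Poly_Mapping.single i a) (Poly_Mapping.single j b) (Poly_Mapping.single k c) =
        scale (a * b * c)
          (?J (Poly_Mapping.single i 1) (Poly_Mapping.single j 1) (Poly_Mapping.single k 1))"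
        by (subst (1 2 3) s[of i a], subst (1 2 3) s[of j b], subst (1 2 3) s[of k c])
          (simp only: lin scale_scale scale_add_right mult.assoc mult.commute mult.left_commute)
      then show ?thesis
        using jacobi[of i j k] by (simp add: bilinear_extension_single)
    qed
    have single2: "?J (Poly_Mapping.single i a) (Poly_Mapping.single j b) z = 0" for i j a b z
    proof (induction z rule: poly_mapping_induct_basis)
      case zero
      then show ?case by simp
    next
      case (add p q)
      then show ?case
        using J_add[of p q "Poly_Mapping.single i a" "Poly_Mapping.single j b"]
        by (metis J_rot add.right_neutral)
    qed (rule single)
    have single1: "?J (Poly_Mapping.single i a) y z = 0" for i a y z
    proof (induction y rule: poly_mapping_induct_basis)
      case zero
      then show ?case by simp
    next
      case (add p q)
      then show ?case
        using J_add[of p q z "Poly_Mapping.single i a"] by (metis J_rot add.right_neutral)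
    qed (rule single2)
    show ?thesis
    proof (induction x rule: poly_mapping_induct_basis)
      case zero
      then show ?case by simp
    next
      case (add p q)
      then show ?case using J_add[of p q y z] by simp
    qed (rule single1)
  qed
  ultimately show ?thesis
    by (intro lie_algebra.intro lie_algebra_axioms.intro)
      (simp_all add: lie_algebra_on_basis_def bilinear_extension_add_left
        bilinear_extension_add_right bilinear_extension_scale_left bilinear_extension_scale_right)
qed

lemma lie_bracket_witt:
  "lie_bracket witt (Poly_Mapping.single i 1) (Poly_Mapping.single j 1) =
    scale (of_int (j - i)) (Poly_Mapping.single (i + j) (1 :: 'k::field_char_0))"
  by (simp add: witt_def lie_algebra_on_basis_def bilinear_extension_single witt_bracket_def)

lemma lie_algebra_witt: "lie_algebra class_ring (witt :: ('k::field_char_0, int \<Rightarrow>\<^sub>0 'k) lie_algebra)"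
  unfolding witt_def
proof (rule lie_algebra_on_basis)
  fix i j k :: int
  show "witt_bracket i i = (0 :: int \<Rightarrow>\<^sub>0 'k)"
    by (simp add: witt_bracket_def)
  show "witt_bracket i j + witt_bracket j i = (0 :: int \<Rightarrow>\<^sub>0 'k)"
    by (simp add: witt_bracket_def add.commute flip: single_add)
  have s: "bilinear_extension witt_bracket (Poly_Mapping.single i 1) (witt_bracket j k) =
      Poly_Mapping.single (i + j + k) (of_int ((k - j) * (j + k - i)) :: 'k)" for i j k :: int
    unfolding witt_bracket_def[of j k]
    by (simp add: bilinear_extension_single witt_bracket_def add.assoc)
  have "(k - j) * (j + k - i) + (i - k) * (k + i - j) + (j - i) * (i + j - k) = 0"
    by (simp add: algebra_simps)
  then have "(of_int ((k - j) * (j + k - i)) + of_int ((i - k) * (k + i - j))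
      + of_int ((j - i) * (i + j - k)) :: 'k) = 0"
    by (metis of_int_add of_int_0)
  moreover have "j + k + i = i + j + k" "k + i + j = i + j + k"
    by simp_all
  ultimately show "bilinear_extension witt_bracket (Poly_Mapping.single i 1) (witt_bracket j k) +
      bilinear_extension witt_bracket (Poly_Mapping.single j 1) (witt_bracket k i) +
      bilinear_extension witt_bracket (Poly_Mapping.single k 1) (witt_bracket i j)
      = (0 :: int \<Rightarrow>\<^sub>0 'k)"
    unfolding s by (simp only: flip: single_add) simp
qed

lemma lie_algebra_virasoro:
  "lie_algebra class_ring (virasoro :: ('k::field_char_0, virasoro_basis \<Rightarrow>\<^sub>0 'k) lie_algebra)"
  unfolding virasoro_def
proof (rule lie_algebra_on_basis)
  let ?\<beta> = "virasoro_bracket :: virasoro_basis \<Rightarrow> virasoro_basis \<Rightarrow> (virasoro_basis \<Rightarrow>\<^sub>0 'k)"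
  let ?B = "bilinear_extension ?\<beta>"
  define \<psi> where "\<psi> n = (of_int (n ^ 3 - n) / 12 :: 'k)" for n :: int
  have \<psi>_minus: "\<psi> (- n) = - \<psi> n" for n
  proof -
    have "(- n) ^ 3 - - n = - (n ^ 3 - n)" by (simp add: power3_eq_cube)
    then show ?thesis by (simp only: \<psi>_def of_int_minus minus_divide_left)
  qed
  have \<beta>_e: "?\<beta> (Vir_e i) (Vir_e j) = Poly_Mapping.single (Vir_e (i + j)) (of_int (j - i)) +
      Poly_Mapping.single Vir_c (if i + j = 0 then \<psi> i else 0)" for i j
    by (simp add: \<psi>_def)
  have \<beta>_c: "?\<beta> x Vir_c = 0" "?\<beta> Vir_c x = 0" for x
    by (cases x; simp)+
  show "?\<beta> x x = 0" for x
  proof (cases x)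
    case (Vir_e i)
    then show ?thesis by (cases "i = 0") (simp_all add: \<beta>_e \<psi>_def del: virasoro_bracket.simps(1))
  qed simp
  show "?\<beta> x y + ?\<beta> y x = 0" for x y
  proof (cases x; cases y)
    fix i j assume xy: "x = Vir_e i" "y = Vir_e j"
    have "?\<beta> x y + ?\<beta> y x =
        Poly_Mapping.single (Vir_e (i + j)) (of_int (j - i) + of_int (i - j)) +
        Poly_Mapping.single Vir_c
          ((if i + j = 0 then \<psi> i else 0) + (if i + j = 0 then \<psi> j else 0))"
      by (simp only: xy \<beta>_e single_add add.commute[of j i] ac_simps)
    moreover have "\<psi> i + \<psi> j = 0" if "i + j = 0"
      using that \<psi>_minus[of i] by (simp add: eq_neg_iff_add_eq_0 add.commute minus_unique)
    ultimately show ?thesis by simp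
  qed (simp_all add: \<beta>_c)
  show "?B (Poly_Mapping.single x 1) (?\<beta> y z) + ?B (Poly_Mapping.single y 1) (?\<beta> z x) +
      ?B (Poly_Mapping.single z 1) (?\<beta> x y) = 0" for x y z
  proof (cases "\<exists>i j k. x = Vir_e i \<and> y = Vir_e j \<and> z = Vir_e k")
    case True
    then obtain i j k where xyz: "x = Vir_e i" "y = Vir_e j" "z = Vir_e k" by blast
    have B: "?B (Poly_Mapping.single (Vir_e i) 1) (?\<beta> (Vir_e j) (Vir_e k)) =
        Poly_Mapping.single (Vir_e (i + j + k)) (of_int ((k - j) * (j + k - i))) +
        Poly_Mapping.single Vir_c (if i + j + k = 0 then of_int (k - j) * \<psi> i else 0)" for i j k
      by (simp add: \<beta>_e bilinear_extension_add_right bilinear_extension_single scale_add_right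
          add.assoc \<beta>_c del: virasoro_bracket.simps(1))
    have witt: "(of_int ((k - j) * (j + k - i)) + of_int ((i - k) * (k + i - j))
        + of_int ((j - i) * (i + j - k)) :: 'k) = 0"
    proof -
      have "(k - j) * (j + k - i) + (i - k) * (k + i - j) + (j - i) * (i + j - k) = 0"
        by (simp add: algebra_simps)
      then show ?thesis by (metis of_int_add of_int_0)
    qed
    have cocycle: "of_int (k - j) * \<psi> i + of_int (i - k) * \<psi> j + of_int (j - i) * \<psi> k = 0"
      if "i + j + k = 0"
    proof -
      have k: "k = - i - j" using that by simp
      have "(k - j) * (i ^ 3 - i) + (i - k) * (j ^ 3 - j) + (j - i) * (k ^ 3 - k) = 0"
        unfolding k by (simp add: algebra_simps power3_eq_cube)
      then have "of_int (k - j) * of_int (i ^ 3 - i) + of_int (i - k) * of_int (j ^ 3 - j)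
          + of_int (j - i) * of_int (k ^ 3 - k) = (0 :: 'k)"
        by (metis of_int_add of_int_mult of_int_0)
      then show ?thesis
        by (simp only: \<psi>_def times_divide_eq_right flip: add_divide_distrib) simp
    qed
    have rot: "j + k + i = i + j + k" "k + i + j = i + j + k" by simp_all
    have "?B (Poly_Mapping.single x 1) (?\<beta> y z) + ?B (Poly_Mapping.single y 1) (?\<beta> z x) +
        ?B (Poly_Mapping.single z 1) (?\<beta> x y) =
        Poly_Mapping.single (Vir_e (i + j + k)) (of_int ((k - j) * (j + k - i))
          + of_int ((i - k) * (k + i - j)) + of_int ((j - i) * (i + j - k))) +
        Poly_Mapping.single Vir_c ((if i + j + k = 0 then of_int (k - j) * \<psi> i else 0)
          + (if i + j + k = 0 then of_int (i - k) * \<psi> j else 0)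
          + (if i + j + k = 0 then of_int (j - i) * \<psi> k else 0))"
      unfolding xyz B rot single_add by (simp only: ac_simps)
    then show ?thesis
      using cocycle by (simp only: witt) simp
  next
    case False
    then have "x = Vir_c \<or> y = Vir_c \<or> z = Vir_c"
      by (metis virasoro_basis.exhaust)
    moreover have "?B (Poly_Mapping.single Vir_c 1) p = 0" for p
      by (simp add: bilinear_extension_def \<beta>_c)
    ultimately show ?thesis
      by (auto simp: \<beta>_c)
  qed
qed

lemma carrier_witt_plus:
  "carrier witt_plus = {x :: int \<Rightarrow>\<^sub>0 'k::field_char_0. Poly_Mapping.keys x \<subseteq> {1..}}"
proof -
  interpret lie_algebra class_ring "witt :: ('k, int \<Rightarrow>\<^sub>0 'k) lie_algebra"
    by (rule lie_algebra_witt)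
  let ?E = "{Poly_Mapping.single n 1 | n. n \<ge> 1} :: (int \<Rightarrow>\<^sub>0 'k) set"
  let ?N = "{x :: int \<Rightarrow>\<^sub>0 'k. Poly_Mapping.keys x \<subseteq> {1..}}"
  have w: "carrier (witt :: ('k, int \<Rightarrow>\<^sub>0 'k) lie_algebra) = UNIV"
    "add (witt :: ('k, int \<Rightarrow>\<^sub>0 'k) lie_algebra) = (+)"
    "zero (witt :: ('k, int \<Rightarrow>\<^sub>0 'k) lie_algebra) = 0"
    "smult (witt :: ('k, int \<Rightarrow>\<^sub>0 'k) lie_algebra) = scale"
    by (simp_all add: witt_def lie_algebra_on_basis_def)
  have "submodule class_ring ?N witt"
  proof (rule submodule.intro)
    show "v \<oplus>\<^bsub>witt\<^esub> u \<in> ?N" if "v \<in> ?N" "u \<in> ?N" for v u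
      using that keys_add[of v u] unfolding w by auto
    show "c \<odot>\<^bsub>witt\<^esub> v \<in> ?N" if "v \<in> ?N" for c v
      using that keys_scale_subset[of c v] unfolding w by auto
  qed (simp_all add: w module_axioms)
  moreover have "?E \<subseteq> ?N" by auto
  ultimately have "span ?E \<subseteq> ?N" by (intro span_is_subset)
  moreover have "x \<in> span ?E" if x: "x \<in> ?N" for x
  proof -
    have sub: "submodule class_ring (span ?E) witt"
      by (rule span_is_submodule) (simp add: w)
    have add: "p + q \<in> span ?E" and scale: "scale a p \<in> span ?E"
      if "p \<in> span ?E" "q \<in> span ?E" for p q a
      using submodule.m_closed[OF sub that]
        submodule.smult_closed[OF sub _ that(1), of a] by (simp_all add: w)
    have in_span: "Poly_Mapping.single n a \<in> span ?E" if "n \<ge> 1" for n a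
    proof -
      have "Poly_Mapping.single n 1 \<in> span ?E"
        using in_own_span[of ?E] that by (auto simp: w)
      from scale[OF this this, of a] show ?thesis by simp
    qed
    have zero: "0 \<in> span ?E" using submodule.zero_closed[OF sub] by (simp add: w)
    have "(\<Sum>k\<in>F. Poly_Mapping.single k (Poly_Mapping.lookup x k)) \<in> span ?E"
      if "finite F" "F \<subseteq> {1..}" for F
      using that by (induction F rule: finite_induct) (auto intro: zero add in_span)
    moreover have "x = (\<Sum>k\<in>Poly_Mapping.keys x. Poly_Mapping.single k (Poly_Mapping.lookup x k))"
      by (rule poly_mapping_eqI) (simp add: lookup_sum lookup_single when_def in_keys_iff)
    ultimately show ?thesis
      using x by (metis (no_types, lifting) finite_keys mem_Collect_eq)
  qed
  ultimately show ?thesis by (auto simp: witt_plus_def)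
qed

lemma lie_algebra_witt_plus:
  "lie_algebra class_ring (witt_plus :: ('k::field_char_0, int \<Rightarrow>\<^sub>0 'k) lie_algebra)"
proof -
  let ?W = "witt_plus :: ('k, int \<Rightarrow>\<^sub>0 'k) lie_algebra"
  interpret W: lie_algebra class_ring "witt :: ('k, int \<Rightarrow>\<^sub>0 'k) lie_algebra"
    by (rule lie_algebra_witt)
  have w: "carrier (witt :: ('k, int \<Rightarrow>\<^sub>0 'k) lie_algebra) = UNIV"
    "add ?W = add witt" "zero ?W = zero witt" "smult ?W = smult witt"
    "lie_bracket ?W = lie_bracket witt"
    by (simp_all add: witt_def witt_plus_def lie_algebra_on_basis_def)
  have ops: "add ?W = (+)" "zero ?W = 0" "smult ?W = scale" "lie_bracket ?W = bilinear_extension witt_bracket"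
    by (simp_all add: witt_def witt_plus_def lie_algebra_on_basis_def)
  have "vectorspace class_ring ?W"
  proof (rule vectorspace_poly_mapping)
    show "p + q \<in> carrier ?W" if "p \<in> carrier ?W" "q \<in> carrier ?W" for p q
      using that keys_add[of p q] by (auto simp: carrier_witt_plus)
    show "scale a p \<in> carrier ?W" if "p \<in> carrier ?W" for a p
      using that keys_scale_subset[of a p] unfolding carrier_witt_plus by blast
  qed (simp_all add: ops carrier_witt_plus)
  moreover have "lie_bracket ?W x y \<in> carrier ?W" if "x \<in> carrier ?W" "y \<in> carrier ?W" for x y
  proof -
    have "Poly_Mapping.keys (scale c (witt_bracket i j) :: int \<Rightarrow>\<^sub>0 'k) \<subseteq> {1..}"
      if "i \<in> Poly_Mapping.keys x" "j \<in> Poly_Mapping.keys y" for i j c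
    proof -
      have "i \<in> {1..}" "j \<in> {1..}"
        using that \<open>x \<in> carrier ?W\<close> \<open>y \<in> carrier ?W\<close> unfolding carrier_witt_plus by blast+
      then show ?thesis by (simp add: witt_bracket_def)
    qed
    then show ?thesis
      unfolding ops carrier_witt_plus bilinear_extension_def
      by (intro CollectI order_trans[OF keys_sum] UN_least)
  qed
  ultimately show ?thesis
    by (intro lie_algebra.intro lie_algebra_axioms.intro)
      (simp_all add: w W.bracket_add_left W.bracket_add_right W.bracket_smult_left
        W.bracket_smult_right W.bracket_self W.jacobi)
qed

lemma ideal_uea_ideal:
  fixes L :: "('k::field, 'l) lie_algebra"
  assumes "lie_algebra class_ring L"
  shows "ideal (uea_ideal L) (free_algebra (carrier L))"
proof -
  interpret lie_algebra class_ring L by fact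
  interpret F: assoc_algebra class_ring
    "free_algebra (carrier L) :: ('k, 'l free_monoid \<Rightarrow>\<^sub>0 'k) module"
    by (rule assoc_algebra_free_algebra)
  let ?C = "carrier (free_algebra (carrier L) :: ('k, 'l free_monoid \<Rightarrow>\<^sub>0 'k) module)"
  have gen: "free_gen x \<in> ?C" if "x \<in> carrier L" for x
    using that by (simp add: free_algebra_def free_gen_def)
  have mult: "p * q \<in> ?C" if "p \<in> ?C" "q \<in> ?C" for p q
    using F.m_closed[OF that] by (simp add: free_algebra_def)
  have diff: "p - q \<in> ?C" if "p \<in> ?C" "q \<in> ?C" for p q
    using that keys_diff[of p q] unfolding free_algebra_def by auto
  have scale: "scale a p \<in> ?C" if "p \<in> ?C" for a p
    using that keys_scale_subset[of a p] unfolding free_algebra_def by auto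
  have "uea_relations L \<subseteq> ?C"
    unfolding uea_relations_def
    using bracket_closed by (auto intro!: diff scale mult gen)
  then show ?thesis
    unfolding uea_ideal_def by (rule F.genideal_ideal)
qed

lemma assoc_algebra_uea:
  "lie_algebra class_ring L \<Longrightarrow> assoc_algebra class_ring (uea L)"
  unfolding uea_def
  by (intro assoc_algebra_quot_algebra assoc_algebra_free_algebra ideal_uea_ideal)

lemma assoc_algebra_uea_virasoro_level:
  "assoc_algebra class_ring (uea_virasoro_level (\<kappa> :: 'k::field_char_0))"
proof -
  let ?V = "virasoro :: ('k, virasoro_basis \<Rightarrow>\<^sub>0 'k) lie_algebra"
  interpret U: assoc_algebra class_ring "uea ?V"
    by (rule assoc_algebra_uea[OF lie_algebra_virasoro])
  interpret F: assoc_algebra class_ring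
    "free_algebra (carrier ?V) :: ('k, (virasoro_basis \<Rightarrow>\<^sub>0 'k) free_monoid \<Rightarrow>\<^sub>0 'k) module"
    by (rule assoc_algebra_free_algebra)
  interpret I: ideal "uea_ideal ?V"
    "free_algebra (carrier ?V) :: ('k, (virasoro_basis \<Rightarrow>\<^sub>0 'k) free_monoid \<Rightarrow>\<^sub>0 'k) module"
    by (rule ideal_uea_ideal[OF lie_algebra_virasoro])
  have "(free_gen virasoro_c :: (virasoro_basis \<Rightarrow>\<^sub>0 'k) free_monoid \<Rightarrow>\<^sub>0 'k)
      \<in> carrier (free_algebra (carrier ?V))"
    by (simp add: free_algebra_def free_gen_def virasoro_def lie_algebra_on_basis_def)
  then have "uea_embed ?V virasoro_c \<in> carrier (uea ?V)"
    unfolding uea_embed_def uea_def quot_algebra_def FactRing_def A_RCOSETS_def' by auto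
  then show ?thesis
    unfolding uea_virasoro_level_def
    by (intro assoc_algebra_quot_algebra U.assoc_algebra_axioms U.genideal_ideal) simp
qed

end

theory Submission
  imports Defs "HOL-Library.List_Lexorder"
begin

text \<open>
  All algebras of the theorem are generated by elements \<open>e\<^sub>i\<close> with
  \<open>[e\<^sub>i, e\<^sub>j] = (j - i) e\<^sub>i\<^sub>+\<^sub>j\<close>, up to a central term, for indices \<open>i\<close> in \<open>D\<close>, the
  positive or all integers.  Hence each of them, and each of its quotients, is a quotient of the
  ring of linear combinations of words in integer letters by an ideal \<open>J\<close> that contains these
  relations (locale \<open>vir_kernel\<close>).  Two facts prove the theorem: the sorted words are linearly
  independent in the enveloping algebras, which makes their growth superpolynomial; and a single
  nontrivial linear relation between sorted words forces polynomial growth.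

  For the second fact, let \<open>p \<in> J\<close> be a nonzero combination of sorted words.  Commutation with
  \<open>e\<^sub>N\<close> preserves \<open>J\<close> and is a derivation with \<open>e\<^sub>i \<mapsto> (i - N) e\<^sub>i\<^sub>+\<^sub>N\<close>.  Let \<open>d\<close> be the greatest
  length of a word in the part of highest weight of \<open>p\<close>, the weight of a word being the sum of its
  letters, and commute with \<open>e\<^sub>N\<close> for \<open>d\<close> large indices \<open>N = N\<^sub>0, N\<^sub>1, \<dots>\<close> in turn.  The result is a
  sum over all maps \<open>\<phi>\<close> that tell which letter each index hits (\<open>iter_ad_word\<close>).  If \<open>\<phi>\<close> sends \<open>a\<close>
  and \<open>b\<close> to the same letter, the resulting word depends only on \<open>N\<^sub>a + N\<^sub>b\<close>, whereas its
  coefficient is a polynomial of degree at most \<open>d\<close> along the step that raises \<open>N\<^sub>a\<close> and lowers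
  \<open>N\<^sub>b\<close>; so \<open>d + 1\<close> finite differences along this step annihilate it (\<open>Diff_hit_zero\<close>).  After
  taking these differences for all pairs, only words of length \<open>d\<close> survive in which every letter is
  hit exactly once.  If the \<open>N\<^sub>j\<close> are far apart, the largest of them has the letters
  \<open>x\<^sub>j + N\<^sub>j\<close>, where \<open>x\<close> is the lexicographically largest rearrangement of a word of \<open>p\<close> of
  length \<open>d\<close>, and its coefficient is nonzero in characteristic zero.  As \<open>N\<close> varies, all words \<open>t\<close>
  of length \<open>d\<close> with large letters and large gaps between them arise: modulo \<open>J\<close>, each such \<open>t\<close> is
  a combination of smaller words (\<open>spread_reducible\<close>).  Therefore every positive word reduces to
  sorted words that contain no such \<open>t\<close>.  These have a bounded number of distinct letters, so there
  are only polynomially many of bounded weight (\<open>positive_reduction\<close>, \<open>few_letters_bound\<close>).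

  This settles the positive Witt algebra.  For the other algebras, commutation with \<open>e\<^sub>0\<close> produces
  a homogeneous \<open>p\<close>; the argument applies to the words in positive letters and, by the symmetry
  \<open>e\<^sub>i \<mapsto> - e\<^sub>-\<^sub>i\<close>, to those in negative letters; and sorted words are products of a negative word, a
  power of \<open>e\<^sub>0\<close> and a positive word (\<open>full_polynomially_spanned\<close>).

  The linear independence of sorted words is the Poincare--Birkhoff--Witt theorem, at an arbitrary
  level \<open>\<kappa>\<close>.  It is proved by rewriting words to normal form: the result is compatible with every
  exchange of adjacent letters, since the only critical overlap is resolved by the Jacobi identity
  (\<open>nf_swap\<close>).
\<close>

section \<open>Words and linear extension\<close>

type_synonym 'k word_ring = "int free_monoid \<Rightarrow>\<^sub>0 'k"

abbreviation supp :: "('b \<Rightarrow>\<^sub>0 'k::zero) \<Rightarrow> 'b set" where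
  "supp \<equiv> Poly_Mapping.keys"

abbreviation coeff_at :: "('b \<Rightarrow>\<^sub>0 'k::zero) \<Rightarrow> 'b \<Rightarrow> 'k" where
  "coeff_at \<equiv> Poly_Mapping.lookup"

abbreviation mono_at :: "'b \<Rightarrow> 'k::zero \<Rightarrow> ('b \<Rightarrow>\<^sub>0 'k)" where
  "mono_at \<equiv> Poly_Mapping.single"

interpretation PM: vector_space "scale :: 'k::field \<Rightarrow> ('b \<Rightarrow>\<^sub>0 'k) \<Rightarrow> ('b \<Rightarrow>\<^sub>0 'k)"
  by standard (simp_all add: scale_add_right scale_add_left scale_scale)

definition word :: "'x list \<Rightarrow> ('x free_monoid \<Rightarrow>\<^sub>0 'k::field)" where
  "word xs = mono_at (Free_Monoid xs) 1"

lemma word_append: "word (xs @ ys) = word xs * word ys"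
  by (simp add: word_def mult_single plus_free_monoid_def)

lemma word_Nil: "word [] = 1"
  by (simp add: word_def flip: single_one zero_free_monoid_def)

lemma keys_word: "supp (word xs :: 'x free_monoid \<Rightarrow>\<^sub>0 'k::field) = {Free_Monoid xs}"
  by (simp add: word_def)

definition linear_extension :: "('b \<Rightarrow> ('c \<Rightarrow>\<^sub>0 'k::field)) \<Rightarrow> ('b \<Rightarrow>\<^sub>0 'k) \<Rightarrow> ('c \<Rightarrow>\<^sub>0 'k)" where
  "linear_extension F p = (\<Sum>w\<in>supp p. scale (coeff_at p w) (F w))"

lemma lin_superset:
  assumes "finite S" "supp p \<subseteq> S"
  shows "linear_extension F p = (\<Sum>w\<in>S. scale (coeff_at p w) (F w))"
  unfolding linear_extension_def using assms by (intro sum.mono_neutral_left) (simp_all add: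
      in_keys_iff)

lemma lin_zero [simp]: "linear_extension F 0 = 0"
  by (simp add: linear_extension_def)

lemma lin_add: "linear_extension F (p + q) = linear_extension F p + linear_extension F q"
proof -
  have f: "finite (supp p \<union> supp q)" by simp
  note * = lin_superset[OF f]
  show ?thesis
    by (subst (1 2 3) *)
      (use keys_add[of p q] in \<open>simp_all add: lookup_add scale_add_left sum.distrib\<close>)
qed

lemma lin_scale: "linear_extension F (scale a p) = scale a (linear_extension F p)"
  by (subst lin_superset[of "supp p"])
    (simp_all add: keys_scale_subset scale_sum scale_scale linear_extension_def)

lemma lin_minus: "linear_extension F (- p) = - linear_extension F p"
  using lin_scale[of F "-1" p] by (simp add: scale_minus)

lemma lin_diff: "linear_extension F (p - q) = linear_extension F p - linear_extension F q"
  using lin_add[of F p "- q"] by (simp add: lin_minus)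

lemma lin_single: "linear_extension F (mono_at w a) = scale a (F w)"
  by (cases "a = 0") (simp_all add: linear_extension_def)

lemma lin_sum: "linear_extension F (sum f S) = (\<Sum>s\<in>S. linear_extension F (f s))"
  by (induction S rule: infinite_finite_induct) (simp_all add: lin_add)

lemma lin_word: "linear_extension F (word xs) = F (Free_Monoid xs)"
  by (simp add: word_def lin_single)

lemma expand_words:
  fixes p :: "'x free_monoid \<Rightarrow>\<^sub>0 'k::field"
  shows "p = (\<Sum>w\<in>supp p. scale (coeff_at p w) (word (letters w)))"
  by (rule poly_mapping_eqI)
    (simp add: lookup_sum word_def lookup_single when_def in_keys_iff if_distrib cong: if_cong)

lemma lin_id_on:
  assumes "\<And>w. w \<in> supp p \<Longrightarrow> F w = word (letters w)"
  shows "linear_extension F p = p"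
  unfolding linear_extension_def by (subst (3) expand_words) (simp add: assms cong: sum.cong)

lemma word_induct [case_names zero word add scale]:
  fixes p :: "'x free_monoid \<Rightarrow>\<^sub>0 'k::field"
  assumes "P 0" "\<And>xs. P (word xs)" "\<And>p q. P p \<Longrightarrow> P q \<Longrightarrow> P (p + q)" "\<And>a p. P p \<Longrightarrow> P (scale a p)"
  shows "P p"
proof (induction p rule: poly_mapping_induct_basis)
  case (single k a)
  have "mono_at k a = scale a (word (letters k))" by (simp add: word_def)
  then show ?case by (simp add: assms)
qed (use assms in auto)

definition free_hom :: "('x \<Rightarrow> ('y free_monoid \<Rightarrow>\<^sub>0 'k::field)) \<Rightarrow> ('x free_monoid \<Rightarrow>\<^sub>0 'k) \<Rightarrow> ('y
    free_monoid \<Rightarrow>\<^sub>0 'k)"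
  where "free_hom g = linear_extension (\<lambda>w. prod_list (map g (letters w)))"

lemma lift_word: "free_hom g (word xs) = prod_list (map g xs)"
  by (simp add: free_hom_def lin_word)

lemma lift_mult: "free_hom g (p * q) = free_hom g p * free_hom g q"
proof (induction p rule: word_induct)
  case (word xs)
  show ?case
  proof (induction q rule: word_induct)
    case (word ys)
    then show ?case by (simp flip: word_append add: lift_word)
  qed (simp_all add: free_hom_def lin_add lin_scale scale_mult_right distrib_left)
qed (simp_all add: free_hom_def lin_add lin_scale scale_mult_left distrib_right)

section \<open>Normal forms\<close>

text \<open>
  The scalar contributed by the central element when it acts as \<open>\<kappa>\<close>; the Witt algebra is the
  case \<open>\<kappa> = 0\<close>.
\<close>

definition vir_cocycle :: "'k::field_char_0 \<Rightarrow> int \<Rightarrow> int \<Rightarrow> 'k" where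
  "vir_cocycle \<kappa> i j = (if i + j = 0 then \<kappa> * (of_int (i ^ 3 - i) / 12) else 0)"

fun inversions :: "int list \<Rightarrow> nat" where
  "inversions [] = 0"
| "inversions (x # xs) = length (filter (\<lambda>y. y < x) xs) + inversions xs"

text \<open>
  Makes rewriting terminate: an exchange keeps the length, and the bracket terms are shorter.
\<close>

lemma inversions_swap: "x > y \<Longrightarrow> inversions (u @ [x, y] @ v) = Suc (inversions (u @ [y, x] @ v))"
  by (induction u) auto

definition first_descent :: "int list \<Rightarrow> nat" where
  "first_descent xs = (LEAST i. Suc i < length xs \<and> xs ! i > xs ! Suc i)"

lemma first_descent:
  assumes "\<not> sorted xs"
  defines "i \<equiv> first_descent xs"
  shows "Suc i < length xs" "xs ! i > xs ! Suc i"
    and "xs = take i xs @ [xs ! i, xs ! Suc i] @ drop (i + 2) xs" "\<And>j. j < i \<Longrightarrow> xs ! j \<le> xs ! Suc j"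
proof -
  from assms obtain j where "Suc j < length xs" "xs ! j > xs ! Suc j"
    by (auto simp: sorted_iff_nth_Suc not_le)
  then have *: "Suc i < length xs \<and> xs ! i > xs ! Suc i"
    unfolding i_def first_descent_def
    using LeastI[of "\<lambda>i. Suc i < length xs \<and> xs ! i > xs ! Suc i" j] by blast
  then show "Suc i < length xs" "xs ! i > xs ! Suc i" by auto
  then show "xs = take i xs @ [xs ! i, xs ! Suc i] @ drop (i + 2) xs"
    by (metis Cons_nth_drop_Suc Suc_lessD add_2_eq_Suc' append_Cons append_Nil append_take_drop_id)
  show "xs ! j \<le> xs ! Suc j" if "j < i" for j
    using not_less_Least[of j "\<lambda>i. Suc i < length xs \<and> xs ! i > xs ! Suc i"] that *
    unfolding i_def first_descent_def by auto
qed

context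
  fixes \<kappa> :: "'k::field_char_0"
begin

text \<open>
  Rewriting always at the first descent makes the normal form a function.  That it does not depend
  on this strategy is the content of \<open>nf_swap\<close>.
\<close>

function nf :: "int list \<Rightarrow> 'k word_ring" where
  "nf xs = (if sorted xs then word xs else
     (let i = first_descent xs; u = take i xs; v = drop (i + 2) xs; x = xs ! i; y = xs ! Suc i in
       nf (u @ [y, x] @ v) + scale (of_int (y - x)) (nf (u @ [x + y] @ v))
         + scale (vir_cocycle \<kappa> x y) (nf (u @ v))))"
  by pat_completeness auto
termination
proof (relation "measures [length, inversions]")
  fix xs :: "int list" and i u v x y
  assume xs: "\<not> sorted xs" and "i = first_descent xs" "u = take i xs" "v = drop (i + 2) xs" "x = xs ! i"
    "y = xs ! Suc i"
  then have *: "xs = u @ [x, y] @ v" "x > y" using first_descent[OF xs] by metis+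
  show "(u @ [y, x] @ v, xs) \<in> measures [length, inversions]"
    "(u @ [x + y] @ v, xs) \<in> measures [length, inversions]"
    "(u @ v, xs) \<in> measures [length, inversions]"
    using inversions_swap[OF *(2), of u v] unfolding *(1) by simp_all
qed simp

declare nf.simps [simp del]

lemma nf_sorted: "sorted xs \<Longrightarrow> nf xs = word xs"
  by (simp add: nf.simps[of xs])

definition nf_bracket :: "int list \<Rightarrow> int \<Rightarrow> int \<Rightarrow> int list \<Rightarrow> 'k word_ring" where
  "nf_bracket u x y v = scale (of_int (y - x)) (nf (u @ [x + y] @ v)) + scale (vir_cocycle \<kappa> x y) (nf (u
      @ v))"

definition swappable :: "int list \<Rightarrow> int \<Rightarrow> int \<Rightarrow> int list \<Rightarrow> bool" where
  "swappable u x y v \<longleftrightarrow> nf (u @ [x, y] @ v) = nf (u @ [y, x] @ v) + nf_bracket u x y v"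

lemma vir_cocycle_swap: "vir_cocycle \<kappa> y x = - vir_cocycle \<kappa> x y"
proof (cases "x + y = 0")
  case True
  then have "y = - x" by simp
  then show ?thesis by (simp add: vir_cocycle_def field_simps)
qed (simp add: vir_cocycle_def add.commute)

lemma nf_bracket_swap: "nf_bracket u y x v = - nf_bracket u x y v"
proof -
  have "of_int (x - y) = - (of_int (y - x) :: 'k)" by simp
  then show ?thesis
    by (simp only: nf_bracket_def vir_cocycle_swap[of y x] scale_minus add.commute[of y x]) simp
qed

lemma swappable_swap: "swappable u x y v \<Longrightarrow> swappable u y x v"
  by (simp add: swappable_def nf_bracket_swap[of u x y])

lemma swappable_self: "swappable u x x v"
  using nf_bracket_swap[of u x x v] PM.scale_left_diff_distrib
  by (auto simp: swappable_def nf_bracket_def vir_cocycle_def)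

lemma vir_cocycle_jacobi:
  "of_int (z - y) * vir_cocycle \<kappa> x (y + z) + of_int (x - z) * vir_cocycle \<kappa> y (z + x)
     + of_int (y - x) * vir_cocycle \<kappa> z (x + y) = 0"
proof (cases "x + y + z = 0")
  case True
  then have z: "z = - x - y" by simp
  have "(z - y) * (x ^ 3 - x) + (x - z) * (y ^ 3 - y) + (y - x) * (z ^ 3 - z) = 0"
    unfolding z by (simp add: algebra_simps power3_eq_cube)
  then have "of_int (z - y) * of_int (x ^ 3 - x) + of_int (x - z) * of_int (y ^ 3 - y)
      + of_int (y - x) * of_int (z ^ 3 - z) = (0 :: 'k)"
    by (metis of_int_add of_int_mult of_int_0)
  then have "\<kappa> / 12 * (of_int (z - y) * of_int (x ^ 3 - x) + of_int (x - z) * of_int (y ^ 3 - y)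
      + of_int (y - x) * of_int (z ^ 3 - z)) = 0" by simp
  moreover have "x + (y + z) = 0" "y + (z + x) = 0" "z + (x + y) = 0" using True by simp_all
  moreover have "of_int p * (\<kappa> * (of_int q / 12)) = \<kappa> / 12 * (of_int p * of_int q)" for p q by simp
  ultimately show ?thesis
    unfolding vir_cocycle_def by (simp only: if_True simp_thms flip: distrib_left)
next
  case False
  then show ?thesis by (simp add: vir_cocycle_def add.assoc add.commute add.left_commute)
qed

text \<open>
  The overlap of the diamond lemma.  A word with three letters \<open>a, b, c\<close> in a row can be sorted in
  two ways; the difference consists of commutators of a letter with a bracket.  If exchanges in
  shorter words are respected, it is the Jacobi identity for the Witt bracket and the cocycle
  identity for the central term.
\<close>

lemma nf_bracket_jacobi:
  fixes u v :: "int list"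
  assumes sw: "\<And>p q. swappable u p q v"
  shows "scale (of_int (b - a)) (nf (u @ [a + b, c] @ v) - nf (u @ [c, a + b] @ v))
       + scale (of_int (c - a)) (nf (u @ [b, a + c] @ v) - nf (u @ [a + c, b] @ v))
       + scale (of_int (c - b)) (nf (u @ [b + c, a] @ v) - nf (u @ [a, b + c] @ v)) = 0"
proof -
  let ?X = "nf (u @ [a + b + c] @ v)" and ?Y = "nf (u @ v)"
  have comm: "nf (u @ [p, q] @ v) - nf (u @ [q, p] @ v) = nf_bracket u p q v" for p q
    using sw[of p q] by (simp add: swappable_def)
  have br: "scale t (nf_bracket u p q v) = scale (t * of_int (q - p)) ?X + scale (t * vir_cocycle \<kappa> p q)
      ?Y"
    if "p + q = a + b + c" for t p q
    unfolding nf_bracket_def that by (simp add: scale_add_right scale_scale)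
  have s: "a + b + c = a + b + c" "b + (a + c) = a + b + c" "b + c + a = a + b + c" by simp_all
  have "scale (of_int (b - a)) (nf_bracket u (a + b) c v)
       + scale (of_int (c - a)) (nf_bracket u b (a + c) v)
       + scale (of_int (c - b)) (nf_bracket u (b + c) a v)
    = scale (of_int (b - a) * of_int (c - (a + b)) + of_int (c - a) * of_int (a + c - b)
        + of_int (c - b) * of_int (a - (b + c))) ?X
     + scale (of_int (b - a) * vir_cocycle \<kappa> (a + b) c + of_int (c - a) * vir_cocycle \<kappa> b (a + c)
        + of_int (c - b) * vir_cocycle \<kappa> (b + c) a) ?Y"
    by (simp only: br[OF s(1)] br[OF s(2)] br[OF s(3)] scale_add_left) (simp only: ac_simps)
  moreover have "of_int (b - a) * of_int (c - (a + b)) + of_int (c - a) * of_int (a + c - b)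
        + of_int (c - b) * of_int (a - (b + c)) = (0 :: 'k)"
  proof -
    have "(b - a) * (c - (a + b)) + (c - a) * (a + c - b) + (c - b) * (a - (b + c)) = 0"
      by (simp add: algebra_simps)
    then show ?thesis by (metis of_int_add of_int_mult of_int_0)
  qed
  moreover have "of_int (b - a) * vir_cocycle \<kappa> (a + b) c + of_int (c - a) * vir_cocycle \<kappa> b (a + c)
        + of_int (c - b) * vir_cocycle \<kappa> (b + c) a = 0"
  proof -
    have "of_int (a - c) = - (of_int (c - a) :: 'k)" by simp
    then show ?thesis
      using vir_cocycle_jacobi[of c b a]
      by (simp only: vir_cocycle_swap[of "a + b" c] vir_cocycle_swap[of "b + c" a] add.commute[of c a])
        (simp add: algebra_simps)
  qed
  ultimately show ?thesis unfolding comm by (simp only: PM.scale_zero_left) simp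
qed

lemma nf_unfold:
  assumes "\<not> sorted xs"
  defines "i \<equiv> first_descent xs"
  shows "swappable (take i xs) (xs ! i) (xs ! Suc i) (drop (i + 2) xs)"
  using first_descent(3)[OF assms(1)] nf.simps[of xs] assms(1)
  unfolding swappable_def nf_bracket_def i_def by (simp add: Let_def add.assoc)

text \<open>
  Induction on length and number of inversions.  The definition of the normal form treats the first
  descent; any other descent is either disjoint from it, and then the two exchanges commute, or
  adjacent to it, and then the overlap identity applies.
\<close>

lemma nf_swap_descent: "xs = u @ [x, y] @ v \<Longrightarrow> x > y \<Longrightarrow> swappable u x y v"
proof (induction xs arbitrary: u x y v rule: wf_induct_rule[OF wf_measures[of "[length, inversions]"]])
  case (1 xs)
  have short: "swappable u' p q v'" if "length u' + length v' + 2 < length xs" for u' p q v'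
  proof -
    have gt: "swappable u' p q v'" if "p > q" for p q
      using 1(1)[of "u' @ [p, q] @ v'"] that \<open>length u' + length v' + 2 < length xs\<close> by simp
    consider "p > q" | "q > p" | "p = q" by linarith
    then show ?thesis using gt swappable_swap swappable_self by cases auto
  qed
  have fewer: "swappable u' p q v'"
    if "p > q" "length (u' @ [p, q] @ v') = length xs" "inversions (u' @ [p, q] @ v') < inversions xs"
        for u' p q v'
    using 1(1)[of "u' @ [p, q] @ v'"] that by simp
  have br: "nf_bracket (u1 @ u2) x y v = scale (of_int (y - x)) (nf (u1 @ u2 @ [x + y] @ v)) +
      scale (vir_cocycle \<kappa> x y) (nf (u1 @ u2 @ v))" for u1 u2 x y v
    by (simp add: nf_bracket_def)
  have xs: "xs = u @ [x, y] @ v" and xy: "x > y" using 1 by auto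
  have ns: "\<not> sorted xs" using xy by (simp add: xs sorted_append)
  define i where "i = first_descent xs"
  define a b w where "a = xs ! i" and "b = xs ! Suc i" and "w = take i xs"
  note fd = first_descent[OF ns, folded i_def]
  have unroll: "swappable w a b (drop (i + 2) xs)"
    using nf_unfold[OF ns] by (simp add: i_def a_def b_def w_def)
  have ab: "a > b" using fd(2) by (simp add: a_def b_def)
  have xs': "xs = w @ [a, b] @ drop (i + 2) xs" using fd(3) by (simp only: a_def b_def w_def)
  have lw: "length w = i" using fd(1) by (simp add: w_def)
  have "i \<le> length u"
  proof (rule ccontr)
    assume "\<not> i \<le> length u"
    then have "xs ! length u \<le> xs ! Suc (length u)" by (intro fd(4)) simp
    then show False using xy by (simp add: xs nth_append)
  qed
  then consider "length u = i" | "length u = Suc i" | "length u \<ge> i + 2" by linarith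
  then show ?case
  proof cases
    case 1
    then have "w = u" "a = x" "b = y" "drop (i + 2) xs = v"
      by (simp_all add: w_def a_def b_def xs nth_append)
    then show ?thesis using unroll by simp
  next
    case 2
    then have e: "u = w @ [a]" "b = x" "drop (i + 2) xs = y # v"
      using lw xs' unfolding xs by (auto simp: append_eq_append_conv2 Cons_eq_append_conv)
    have inv: "inversions xs = Suc (inversions (w @ [x, a] @ y # v))"
      using inversions_swap[OF ab, of w "y # v"] xs e by simp
    have ay: "a > y" using ab xy e by simp
    have s1: "swappable w a x (y # v)" using unroll e by simp
    have i2: "inversions (w @ [x, a, y] @ v) = Suc (inversions (w @ [x, y, a] @ v))"
      using inversions_swap[OF ay, of "w @ [x]" v] by simp
    have s2: "swappable (w @ [x]) a y v"
      by (rule fewer) (use ay inv in \<open>simp_all add: xs e\<close>)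
    have s3: "swappable w x y (a # v)"
      by (rule fewer) (use xy inv i2 in \<open>simp_all add: xs e\<close>)
    have ip: "inversions (w @ [a, x, y] @ v) = Suc (inversions (w @ [a, y, x] @ v))"
      using inversions_swap[OF xy, of "w @ [a]" v] by simp
    have s4: "swappable w a y (x # v)"
      by (rule fewer) (use ay ip in \<open>simp_all add: xs e\<close>)
    have i5: "inversions (w @ [a, y, x] @ v) = Suc (inversions (w @ [y, a, x] @ v))"
      using inversions_swap[OF ay, of w "x # v"] by simp
    have s5: "swappable (w @ [y]) a x v"
      by (rule fewer) (use ab ip i5 in \<open>simp_all add: xs e\<close>)
    have sh: "swappable w p q v" for p q by (rule short) (simp add: xs e)
    note J = nf_bracket_jacobi[of w v a x y, OF sh]
    have c: "nf_bracket (w @ [z]) p q v = scale (of_int (q - p)) (nf (w @ [z, p + q] @ v))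
          + scale (vir_cocycle \<kappa> p q) (nf (w @ [z] @ v))"
        "nf_bracket w p q (z # v) = scale (of_int (q - p)) (nf (w @ [p + q, z] @ v))
          + scale (vir_cocycle \<kappa> p q) (nf (w @ [z] @ v))" for z p q
      by (simp_all add: nf_bracket_def)
    \<comment> \<open>The two ways around the hexagon of exchanges of \<open>a\<close>, \<open>x\<close> and \<open>y\<close>.\<close>
    have hexagon: "p1 = q1 + B6"
      if "p1 = p2 + B1" "p2 = p3 + B2" "p3 = p4 + B3" "q1 = q2 + B4" "q2 = p4 + B5"
        "B1 + B2 + B3 = B4 + B5 + B6"
      for p1 p2 p3 p4 q1 q2 B1 B2 B3 B4 B5 B6 :: "'k word_ring"
    proof -
      have "p1 = p4 + (B1 + B2 + B3)" unfolding that(1-3) by (simp add: ac_simps)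
      also have "\<dots> = p4 + (B4 + B5) + B6" by (simp only: that(6)) (simp only: ac_simps)
      also have "p4 + (B4 + B5) = q1" unfolding that(4,5) by (simp add: ac_simps)
      finally show ?thesis .
    qed
    have H: "nf_bracket w a x ([y] @ v) + nf_bracket (w @ [x]) a y v + nf_bracket w x y ([a] @ v)
        = nf_bracket w a y ([x] @ v) + nf_bracket (w @ [y]) a x v + nf_bracket (w @ [a]) x y v"
      using J by (simp add: c PM.scale_right_diff_distrib algebra_simps)
    show ?thesis
      unfolding e(1) swappable_def
      by (rule hexagon[of _ _ "nf_bracket w a x ([y] @ v)" _ "nf_bracket (w @ [x]) a y v" _
            "nf_bracket w x y ([a] @ v)" _ _ "nf_bracket w a y ([x] @ v)" "nf_bracket (w @ [y]) a x v"])
        (use s1 s2 s3 s4 s5 H in \<open>simp_all add: swappable_def\<close>)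
  next
    case 3
    define m where "m = drop (i + 2) u"
    have u: "u = w @ [a, b] @ m"
    proof -
      have "w @ [a, b] = take (i + 2) xs" using arg_cong[OF xs', of "take (i + 2)"] lw by simp
      also have "\<dots> = take (i + 2) u" using 3 by (simp add: xs)
      finally show ?thesis unfolding m_def
        by (metis append_assoc append_take_drop_id)
    qed
    have tl: "drop (i + 2) xs = m @ [x, y] @ v" unfolding xs u by (simp add: lw)
    have s1: "swappable w a b (m @ [x, y] @ v)" using unroll tl by simp
    have i1: "inversions xs = Suc (inversions (w @ [b, a] @ m @ [x, y] @ v))"
      using inversions_swap[OF ab, of w "m @ [x, y] @ v"] by (simp add: xs u)
    have i2: "inversions xs = Suc (inversions (u @ [y, x] @ v))"
      using inversions_swap[OF xy, of u v] by (simp add: xs)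
    have s2: "swappable (w @ [b, a] @ m) x y v"
      by (rule fewer) (use xy i1 in \<open>simp_all add: xs u\<close>)
    have s3: "swappable w a b (m @ [y, x] @ v)"
      by (rule fewer) (use ab i2 in \<open>simp_all add: xs u\<close>)
    have s4: "swappable (w @ [a + b] @ m) x y v" "swappable (w @ m) x y v"
      "swappable w a b (m @ [x + y] @ v)" "swappable w a b (m @ v)"
      by (rule short, simp add: xs u)+
    have square: "p1 = q1 + E" if "p1 = p2 + A" "p2 = p3 + B" "q1 = p3 + C" "A + B = C + E"
      for p1 p2 p3 q1 A B C E :: "'k word_ring"
    proof -
      have "p1 = p3 + (A + B)" unfolding that(1,2) by (simp add: ac_simps)
      also have "\<dots> = q1 + E" unfolding that(3,4) by (simp add: ac_simps)
      finally show ?thesis .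
    qed
    have H: "nf_bracket w a b (m @ [x, y] @ v) + nf_bracket (w @ [b, a] @ m) x y v
      = nf_bracket w a b (m @ [y, x] @ v) + nf_bracket (w @ [a, b] @ m) x y v"
    proof -
      note sw = s4[unfolded swappable_def nf_bracket_def append_assoc append_Cons append_Nil]
      show ?thesis
        unfolding nf_bracket_def append_assoc append_Cons append_Nil sw
        by (simp only: scale_add_right scale_scale mult.commute ac_simps)
    qed
    show ?thesis
      unfolding u swappable_def
      by (rule square[of _ _ "nf_bracket w a b (m @ [x, y] @ v)" _ "nf_bracket (w @ [b, a] @ m) x y v" _
          "nf_bracket w a b (m @ [y, x] @ v)"])
        (use s1 s2 s3 H in \<open>simp_all add: swappable_def\<close>)
  qed
qed

text \<open>
  The normal form does not depend on the order in which letters are exchanged: an ascent is handled by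
  the exchange in the opposite direction.
\<close>

lemma nf_swap: "nf (u @ [x, y] @ v) = nf (u @ [y, x] @ v) + nf_bracket u x y v"
proof -
  consider "x > y" | "y > x" | "x = y" by linarith
  then have "swappable u x y v"
    using nf_swap_descent swappable_swap swappable_self by cases auto
  then show ?thesis by (simp add: swappable_def)
qed

definition vir_bracket :: "int \<Rightarrow> int \<Rightarrow> 'k word_ring" where
  "vir_bracket i j = scale (of_int (j - i)) (word [i + j]) + scale (vir_cocycle \<kappa> i j) 1"

definition normal_form :: "'k word_ring \<Rightarrow> 'k word_ring" where
  "normal_form = linear_extension (\<lambda>w. nf (letters w))"

lemma normal_form_sorted:
  assumes "\<And>w. w \<in> supp p \<Longrightarrow> sorted (letters w)"
  shows "normal_form p = p"
  unfolding normal_form_def using assms by (intro lin_id_on) (simp add: nf_sorted)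

lemma normal_form_relation:
  "normal_form (p * (word [i] * word [j] - word [j] * word [i] - vir_bracket i j) * q) = 0"
proof (induction p rule: word_induct)
  case (word u)
  show ?case
  proof (induction q rule: word_induct)
    case (word v)
    have "word u * (word [i] * word [j] - word [j] * word [i] - vir_bracket i j) * word v
       = word (u @ [i, j] @ v) - word (u @ [j, i] @ v)
         - (scale (of_int (j - i)) (word (u @ [i + j] @ v)) + scale (vir_cocycle \<kappa> i j) (word (u @ v)))"
      unfolding vir_bracket_def
      by (simp add: left_diff_distrib right_diff_distrib distrib_left distrib_right scale_mult_left
          scale_mult_right
          flip: word_append mult.assoc)
    then show ?case
      using nf_swap[of u i j v]
      by (simp add: normal_form_def lin_diff lin_add lin_scale lin_word nf_bracket_def)
  qed (simp_all add: normal_form_def lin_add lin_scale scale_mult_right distrib_left)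
qed (simp_all add: normal_form_def lin_add lin_scale scale_mult_left distrib_right)

end


section \<open>Reordering words\<close>

text \<open>
  The summand 1 makes brackets strictly smaller: \<open>\<bar>i + j\<bar> + 1 < (\<bar>i\<bar> + 1) + (\<bar>j\<bar> + 1)\<close>.  Unlike
  the weight, this norm leaves finitely many words below a bound also when negative letters occur.
\<close>

definition word_norm :: "int list \<Rightarrow> nat" where
  "word_norm xs = (\<Sum>x\<leftarrow>xs. nat \<bar>x\<bar> + 1)"

lemma word_norm_append [simp]: "word_norm (xs @ ys) = word_norm xs + word_norm ys"
  by (simp add: word_norm_def)

lemma word_norm_Cons [simp]: "word_norm (x # xs) = nat \<bar>x\<bar> + 1 + word_norm xs"
  by (simp add: word_norm_def)

lemma word_norm_Nil [simp]: "word_norm [] = 0"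
  by (simp add: word_norm_def)

lemma word_norm_mset: "mset xs = mset ys \<Longrightarrow> word_norm xs = word_norm ys"
  unfolding word_norm_def by (metis mset_map sum_mset_sum_list)

text \<open>
  The kernels to be studied: ideals of the ring of words that contain the Virasoro relations between
  the letters in \<open>D\<close>.  The other letters are ballast; they are sent to 0 when \<open>D\<close> is the set of
  positive integers, so that \<open>J\<close> is an ideal of the full ring in both cases.
\<close>

locale vir_kernel =
  fixes \<kappa> :: "'k::field_char_0" and J :: "'k word_ring set" and D :: "int set"
  assumes subspace: "PM.subspace J"
    and mult_left: "p \<in> J \<Longrightarrow> q * p \<in> J"
    and mult_right: "p \<in> J \<Longrightarrow> p * q \<in> J"
    and relation: "i \<in> D \<Longrightarrow> j \<in> D \<Longrightarrow> word [i] * word [j] - word [j] * word [i] - vir_bracket \<kappa> i j \<in> J"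
    and D_add: "i \<in> D \<Longrightarrow> j \<in> D \<Longrightarrow> i + j \<in> D"
    and D_pos: "0 < i \<Longrightarrow> i \<in> D"
begin

definition reducible_to :: "int list set \<Rightarrow> 'k word_ring set" where
  "reducible_to X = PM.span (J \<union> word ` X)"

lemma red_mono: "p \<in> reducible_to X \<Longrightarrow> X \<subseteq> Y \<Longrightarrow> p \<in> reducible_to Y"
  unfolding reducible_to_def using PM.span_mono[of "J \<union> word ` X" "J \<union> word ` Y"] by blast

lemma red_J: "p \<in> J \<Longrightarrow> p \<in> reducible_to X"
  unfolding reducible_to_def by (simp add: PM.span_base)

lemma red_word: "xs \<in> X \<Longrightarrow> word xs \<in> reducible_to X"
  unfolding reducible_to_def by (simp add: PM.span_base)

lemma red_zero: "0 \<in> reducible_to X"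
  unfolding reducible_to_def by (rule PM.span_zero)

lemma red_add: "p \<in> reducible_to X \<Longrightarrow> q \<in> reducible_to X \<Longrightarrow> p + q \<in> reducible_to X"
  unfolding reducible_to_def by (rule PM.span_add)

lemma red_diff: "p \<in> reducible_to X \<Longrightarrow> q \<in> reducible_to X \<Longrightarrow> p - q \<in> reducible_to X"
  unfolding reducible_to_def by (rule PM.span_diff)

lemma red_scale: "p \<in> reducible_to X \<Longrightarrow> scale a p \<in> reducible_to X"
  unfolding reducible_to_def by (rule PM.span_scale)

lemma red_sum: "(\<And>i. i \<in> I \<Longrightarrow> f i \<in> reducible_to X) \<Longrightarrow> sum f I \<in> reducible_to X"
  unfolding reducible_to_def by (rule PM.span_sum)

lemma red_minus_commute: "p - q \<in> reducible_to X \<longleftrightarrow> q - p \<in> reducible_to X"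
  using red_scale[of "p - q" X "-1"] red_scale[of "q - p" X "-1"] by (auto simp: scale_minus)

lemma red_cong: "p - q \<in> reducible_to X \<Longrightarrow> q \<in> reducible_to X \<Longrightarrow> p \<in> reducible_to X"
  using red_add[of "p - q" X q] by simp

lemma red_trans:
  assumes "p \<in> reducible_to X" "\<And>xs. xs \<in> X \<Longrightarrow> word xs \<in> reducible_to Y"
  shows "p \<in> reducible_to Y"
proof -
  have "J \<union> word ` X \<subseteq> reducible_to Y" using assms(2) red_J by auto
  then have "PM.span (J \<union> word ` X) \<subseteq> reducible_to Y"
    unfolding reducible_to_def by (rule PM.span_minimal) simp
  then show ?thesis using assms(1) by (auto simp: reducible_to_def)
qed

lemma red_mult:
  assumes "p \<in> reducible_to X" "\<And>xs. xs \<in> X \<Longrightarrow> q * word xs * r \<in> reducible_to Y"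
  shows "q * p * r \<in> reducible_to Y"
  using assms(1) unfolding reducible_to_def
proof (induction rule: PM.span_induct_alt)
  case base
  show ?case using red_zero[of Y] by (simp add: reducible_to_def)
next
  case (step c x y)
  have "q * x * r \<in> reducible_to Y"
    using step(1) assms(2) by (auto intro: red_J mult_left mult_right)
  then have "scale c (q * x * r) \<in> reducible_to Y" by (rule red_scale)
  then have "scale c (q * x * r) + q * y * r \<in> reducible_to Y"
    using step(2) by (auto simp: reducible_to_def intro: PM.span_add)
  then show ?case
    by (simp add: reducible_to_def scale_mult_left scale_mult_right distrib_left distrib_right)
qed

lemma red_sandwich:
  assumes "p \<in> reducible_to X" "\<And>xs. xs \<in> X \<Longrightarrow> u @ xs @ v \<in> Y"
  shows "word u * p * word v \<in> reducible_to Y"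
  using assms by (intro red_mult[of p X]) (auto simp flip: word_append intro: red_word)

text \<open>
  What an exchange of letters produces besides the exchanged word: the weight is kept, the length
  drops, the norm does not grow.
\<close>

definition shorter :: "int list \<Rightarrow> int list set" where
  "shorter xs = {zs. set zs \<subseteq> D \<and> sum_list zs = sum_list xs \<and> length zs < length xs \<and> word_norm zs \<le>
      word_norm xs}"

lemma shorter_append: "zs \<in> shorter xs \<Longrightarrow> set u \<subseteq> D \<Longrightarrow> set v \<subseteq> D \<Longrightarrow> u @ zs @ v \<in> shorter (u @ xs @ v)"
  by (auto simp: shorter_def)

lemma shorter_mset: "mset xs = mset ys \<Longrightarrow> shorter xs = shorter ys"
  unfolding shorter_def using mset_eq_length[of xs ys] word_norm_mset[of xs ys] sum_mset_sum_list by
      metis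

lemma shorter_sandwich:
  assumes "word xs - word ys \<in> reducible_to (shorter xs)" "set u \<subseteq> D" "set v \<subseteq> D"
  shows "word (u @ xs @ v) - word (u @ ys @ v) \<in> reducible_to (shorter (u @ xs @ v))"
proof -
  have "word u * (word xs - word ys) * word v \<in> reducible_to (shorter (u @ xs @ v))"
    using assms by (intro red_sandwich[of _ "shorter xs"]) (auto intro: shorter_append)
  then show ?thesis
    by (simp add: left_diff_distrib right_diff_distrib mult.assoc flip: word_append)
qed

lemma swap_letters:
  assumes "x \<in> D" "y \<in> D"
  shows "word [x, y] - word [y, x] \<in> reducible_to (shorter [x, y])"
proof -
  have "vir_bracket \<kappa> x y \<in> reducible_to (shorter [x, y])"
  proof -
    have "[x + y] \<in> shorter [x, y]" using assms by (auto simp: shorter_def D_add)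
    moreover have "scale (vir_cocycle \<kappa> x y) 1 \<in> reducible_to (shorter [x, y])"
    proof (cases "x + y = 0")
      case True
      then have "[] \<in> shorter [x, y]" by (simp add: shorter_def)
      then have "1 \<in> reducible_to (shorter [x, y])" by (metis red_word word_Nil)
      then show ?thesis by (rule red_scale)
    qed (simp add: vir_cocycle_def red_zero)
    ultimately show ?thesis
      unfolding vir_bracket_def by (intro red_add red_scale[of "word _"] red_word)
  qed
  moreover have "word [x, y] - word [y, x] - vir_bracket \<kappa> x y \<in> J"
    using relation[OF assms] by (simp flip: word_append)
  ultimately show ?thesis by (meson red_J red_cong)
qed

lemma move_letter:
  assumes "x \<in> D" "set u \<subseteq> D"
  shows "word (x # u) - word (u @ [x]) \<in> reducible_to (shorter (x # u))"
  using assms(2)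
proof (induction u)
  case (Cons a u)
  have 1: "word ([x, a] @ u) - word ([a, x] @ u) \<in> reducible_to (shorter ([x, a] @ u))"
    using shorter_sandwich[OF swap_letters[OF assms(1), of a], of "[]" u] Cons by simp
  have 2: "word ([a] @ (x # u)) - word ([a] @ (u @ [x])) \<in> reducible_to (shorter ([a] @ (x # u)))"
    using shorter_sandwich[OF Cons(1), of "[a]" "[]"] Cons by simp
  have "shorter ([a] @ (x # u)) = shorter ([x, a] @ u)"
    by (rule shorter_mset) simp
  then show ?case using red_add[OF 1 2[unfolded \<open>shorter ([a] @ (x # u)) = _\<close>]] by simp
qed (simp add: red_zero)

lemma reorder:
  assumes "set xs \<subseteq> D" "mset xs = mset ys"
  shows "word xs - word ys \<in> reducible_to (shorter xs)"
  using assms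
proof (induction xs arbitrary: ys)
  case (Cons x xs)
  have "x \<in> set ys" using Cons(3) by (metis list.set_intros(1) mset_eq_setD)
  then obtain u v where ys: "ys = u @ x # v" by (meson split_list)
  have m: "mset xs = mset (u @ v)" using Cons(3) ys by simp
  then have uv: "set u \<subseteq> D" "set v \<subseteq> D" using Cons(2) mset_eq_setD[OF m] by auto
  have 1: "word (x # xs) - word (x # u @ v) \<in> reducible_to (shorter (x # xs))"
    using shorter_sandwich[OF Cons(1)[OF _ m], of "[x]" "[]"] Cons(2) by simp
  have "word (x # u @ v) - word ys \<in> reducible_to (shorter (x # u @ v))"
    using shorter_sandwich[OF move_letter[OF _ uv(1), of x], of "[]" v] Cons(2) uv ys by simp
  moreover have "shorter (x # u @ v) = shorter (x # xs)"
    using m by (intro shorter_mset) simp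
  ultimately show ?case using red_add[OF 1, of "word (x # u @ v) - word ys"] by simp
qed (simp add: red_zero)

lemma red_sorted:
  assumes "set xs \<subseteq> D"
  shows "word xs \<in> reducible_to {zs. sorted zs \<and> set zs \<subseteq> D \<and> sum_list zs = sum_list xs \<and> word_norm zs \<le>
      word_norm xs}"
  using assms
proof (induction "length xs" arbitrary: xs rule: less_induct)
  case less
  let ?Y = "{zs. sorted zs \<and> set zs \<subseteq> D \<and> sum_list zs = sum_list xs \<and> word_norm zs \<le> word_norm xs}"
  have "word xs - word (sort xs) \<in> reducible_to (shorter xs)"
    using less by (intro reorder) simp_all
  then have "word xs - word (sort xs) \<in> reducible_to ?Y"
  proof (rule red_trans)
    fix ys assume "ys \<in> shorter xs"
    then have ys: "length ys < length xs" "set ys \<subseteq> D" "sum_list ys = sum_list xs" "word_norm ys \<le>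
        word_norm xs"
      by (auto simp: shorter_def)
    show "word ys \<in> reducible_to ?Y"
      by (rule red_mono[OF less(1)[OF ys(1,2)]]) (use ys in auto)
  qed
  moreover have "word (sort xs) \<in> reducible_to ?Y"
  proof (intro red_word CollectI conjI)
    show "sum_list (sort xs) = sum_list xs" by (metis mset_sort sum_mset_sum_list)
    show "word_norm (sort xs) \<le> word_norm xs" by (simp add: word_norm_mset[of "sort xs" xs])
  qed (use less(2) in simp_all)
  ultimately show ?case by (rule red_cong)
qed

section \<open>Commutators with generators\<close>

definition ad :: "int \<Rightarrow> 'k word_ring \<Rightarrow> 'k word_ring" where
  "ad N p = word [N] * p - p * word [N]"

lemma ad_J: "p \<in> J \<Longrightarrow> ad N p \<in> J"
  unfolding ad_def using PM.subspace_diff[OF subspace] mult_left mult_right by blast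

lemma ad_diff: "ad N (p - q) = ad N p - ad N q"
  by (simp add: ad_def algebra_simps)

lemma ad_add: "ad N (p + q) = ad N p + ad N q"
  by (simp add: ad_def algebra_simps)

lemma ad_scale: "ad N (scale a p) = scale a (ad N p)"
  by (simp add: ad_def scale_mult_left scale_mult_right PM.scale_right_diff_distrib)

lemma ad_sum: "ad N (sum f S) = (\<Sum>s\<in>S. ad N (f s))"
  by (induction S rule: infinite_finite_induct) (simp_all add: ad_add, simp_all add: ad_def)

text \<open>
  The Leibniz rule; the hypothesis on the cocycle keeps the central term away, and holds both for
  large \<open>N\<close> and for \<open>N = 0\<close>.
\<close>

lemma ad_word:
  assumes "N \<in> D" "set xs \<subseteq> D" "\<And>x. x \<in> set xs \<Longrightarrow> vir_cocycle \<kappa> N x = 0"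
  shows "ad N (word xs) - (\<Sum>l<length xs. scale (of_int (xs ! l - N)) (word (xs[l := xs ! l + N]))) \<in> J"
  using assms(2,3)
proof (induction xs)
  case Nil
  show ?case using PM.subspace_0[OF subspace] by (simp add: ad_def word_Nil)
next
  case (Cons x xs)
  let ?S = "\<Sum>l<length xs. scale (of_int (xs ! l - N)) (word (xs[l := xs ! l + N]))"
  have wx: "word (x # xs) = word [x] * word xs" by (simp flip: word_append)
  have sum: "(\<Sum>l<length (x # xs). scale (of_int ((x # xs) ! l - N)) (word ((x # xs)[l := (x # xs) ! l +
      N])))
      = scale (of_int (x - N)) (word [x + N]) * word xs + word [x] * ?S"
    by (simp add: sum.lessThan_Suc_shift sum_distrib_left scale_mult_left scale_mult_right del:
        sum.lessThan_Suc
        flip: word_append)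
  have 1: "(word [N] * word [x] - word [x] * word [N] - scale (of_int (x - N)) (word [x + N])) * word xs
      \<in> J"
    using relation[OF assms(1), of x] Cons(2,3) by (intro mult_right) (simp add: vir_bracket_def
        add.commute)
  have 2: "word [x] * (ad N (word xs) - ?S) \<in> J"
    using Cons by (intro mult_left) auto
  have "ad N (word (x # xs)) - (scale (of_int (x - N)) (word [x + N]) * word xs + word [x] * ?S)
    = (word [N] * word [x] - word [x] * word [N] - scale (of_int (x - N)) (word [x + N])) * word xs
      + word [x] * (ad N (word xs) - ?S)"
    unfolding wx ad_def by (simp add: algebra_simps)
  then show ?case using PM.subspace_add[OF subspace 1 2] by (simp only: sum)
qed

end


section \<open>Iterated commutators\<close>

lemma map_ident: "Poly_Mapping.map (\<lambda>a. a) p = p"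
  by (rule poly_mapping_eqI) (simp add: Poly_Mapping.map.rep_eq when_def)

context vir_kernel
begin

primrec iter_ad :: "(nat \<Rightarrow> int) \<Rightarrow> nat \<Rightarrow> 'k word_ring \<Rightarrow> 'k word_ring" where
  "iter_ad N 0 p = p"
| "iter_ad N (Suc d) p = ad (N d) (iter_ad N d p)"

end

text \<open>
  The word obtained from \<open>xs\<close> when, for each \<open>i < d\<close>, the index \<open>N i\<close> is added to the letter at
  position \<open>\<phi> i\<close>; \<open>hit_coeff\<close> is the product of the structure constants met on the way.
\<close>

definition hit :: "(nat \<Rightarrow> int) \<Rightarrow> (nat \<Rightarrow> nat) \<Rightarrow> nat \<Rightarrow> int list \<Rightarrow> int list" where
  "hit N \<phi> d xs = map (\<lambda>l. xs ! l + (\<Sum>i | i < d \<and> \<phi> i = l. N i)) [0..<length xs]"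

definition hit_coeff :: "(nat \<Rightarrow> int) \<Rightarrow> (nat \<Rightarrow> nat) \<Rightarrow> nat \<Rightarrow> int list \<Rightarrow> 'k::field_char_0" where
  "hit_coeff N \<phi> d xs = (\<Prod>i<d. of_int (xs ! \<phi> i + (\<Sum>i' | i' < i \<and> \<phi> i' = \<phi> i. N i') - N i))"

lemma length_hit [simp]: "length (hit N \<phi> d xs) = length xs"
  by (simp add: hit_def)

lemma nth_hit: "l < length xs \<Longrightarrow> hit N \<phi> d xs ! l = xs ! l + (\<Sum>i | i < d \<and> \<phi> i = l. N i)"
  by (simp add: hit_def)

lemma hit_Suc:
  assumes "l < length xs"
  shows "hit N (\<phi>(d := l)) (Suc d) xs = (hit N \<phi> d xs)[l := hit N \<phi> d xs ! l + N d]"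
proof (rule nth_equalityI)
  fix l' assume "l' < length (hit N (\<phi>(d := l)) (Suc d) xs)"
  then have l': "l' < length xs" by simp
  have "{i. i < Suc d \<and> (\<phi>(d := l)) i = l'} = (if l' = l then insert d else id) {i. i < d \<and> \<phi> i = l'}"
    by (auto simp: less_Suc_eq)
  then show "hit N (\<phi>(d := l)) (Suc d) xs ! l' = (hit N \<phi> d xs)[l := hit N \<phi> d xs ! l + N d] ! l'"
    using l' by (simp add: nth_hit nth_list_update)
qed simp

lemma hit_coeff_Suc:
  assumes "l < length xs"
  shows "hit_coeff N (\<phi>(d := l)) (Suc d) xs = hit_coeff N \<phi> d xs * of_int (hit N \<phi> d xs ! l - N d)"
proof -
  have 1: "(\<Sum>i' | i' < i \<and> (\<phi>(d := l)) i' = (\<phi>(d := l)) i. N i') = (\<Sum>i' | i' < i \<and> \<phi> i' = \<phi> i. N i')" if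
      "i < d" for i
    using that by (intro sum.cong) auto
  have 2: "(\<Sum>i' | i' < d \<and> (\<phi>(d := l)) i' = l. N i') = (\<Sum>i' | i' < d \<and> \<phi> i' = l. N i')"
    by (intro sum.cong) auto
  have "(\<Prod>i<d. of_int (xs ! (\<phi>(d := l)) i + (\<Sum>i' | i' < i \<and> (\<phi>(d := l)) i' = (\<phi>(d := l)) i. N i') - N i)
      :: 'a)
     = hit_coeff N \<phi> d xs"
    unfolding hit_coeff_def by (intro prod.cong refl) (simp only: 1 lessThan_iff, simp)
  then show ?thesis
    unfolding hit_coeff_def[of N "\<phi>(d := l)"] prod.lessThan_Suc
    using assms by (simp only: 2 fun_upd_same nth_hit)
qed

context vir_kernel
begin

lemma iter_ad_J: "p \<in> J \<Longrightarrow> iter_ad N d p \<in> J"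
  by (induction d) (simp_all add: ad_J)

lemma iter_ad_add: "iter_ad N d (p + q) = iter_ad N d p + iter_ad N d q"
  by (induction d) (simp_all add: ad_add)

lemma iter_ad_scale: "iter_ad N d (scale a p) = scale a (iter_ad N d p)"
  by (induction d) (simp_all add: ad_scale)

lemma iter_ad_sum: "iter_ad N d (sum f S) = (\<Sum>s\<in>S. iter_ad N d (f s))"
  by (induction d) (simp_all add: ad_sum)

lemma D_add_nonneg: "x \<in> D \<Longrightarrow> 0 \<le> s \<Longrightarrow> x + s \<in> D"
  using D_add[of x s] D_pos[of s] by (cases "s = 0") auto

text \<open>
  Iterating the Leibniz rule, each of the \<open>d\<close> commutations picks a position, which gives the sum over
  all maps \<open>\<phi>\<close>.
\<close>

lemma iter_ad_word:
  assumes "set xs \<subseteq> D" "\<And>j. j < d \<Longrightarrow> 0 < N j" "\<And>x j. x \<in> set xs \<Longrightarrow> j < d \<Longrightarrow> 0 < x + N j"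
  shows "iter_ad N d (word xs) -
    (\<Sum>\<phi>\<in>{..<d} \<rightarrow>\<^sub>E {..<length xs}. scale (hit_coeff N \<phi> d xs) (word (hit N \<phi> d xs))) \<in> J"
  using assms(2,3)
proof (induction d)
  case 0
  have "hit N \<phi> 0 xs = xs" "hit_coeff N \<phi> 0 xs = (1::'k)" for \<phi>
    by (simp_all add: hit_def hit_coeff_def map_nth)
  then show ?case using PM.subspace_0[OF subspace] by (simp add: map_ident)
next
  case (Suc d)
  let ?P = "\<lambda>d. {..<d} \<rightarrow>\<^sub>E {..<length xs}"
  let ?t = "\<lambda>d \<phi>. scale (hit_coeff N \<phi> d xs) (word (hit N \<phi> d xs)) :: 'k word_ring"
  have 1: "ad (N d) (iter_ad N d (word xs)) - ad (N d) (\<Sum>\<phi>\<in>?P d. ?t d \<phi>) \<in> J"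
    using ad_J[OF Suc.IH] Suc.prems by (simp add: ad_diff)
  have nonneg: "0 \<le> (\<Sum>i | i < d \<and> \<phi> i = l. N i)" for \<phi> l
    using Suc.prems(1) by (intro sum_nonneg) (simp add: less_imp_le less_Suc_eq)
  have D: "set (hit N \<phi> d xs) \<subseteq> D" for \<phi>
  proof
    fix y assume "y \<in> set (hit N \<phi> d xs)"
    then obtain l where "l < length xs" "y = hit N \<phi> d xs ! l" by (auto simp: in_set_conv_nth)
    then show "y \<in> D" using assms(1) nonneg by (auto simp: nth_hit intro!: D_add_nonneg)
  qed
  have coc: "vir_cocycle \<kappa> (N d) y = 0" if "y \<in> set (hit N \<phi> d xs)" for y \<phi>
  proof -
    obtain l where "l < length xs" "y = hit N \<phi> d xs ! l" using \<open>y \<in> _\<close> by (auto simp: in_set_conv_nth)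
    then have "0 < N d + y"
      using Suc.prems(2)[of "xs ! l" d] nonneg[of \<phi> l] by (simp add: nth_hit)
    then show ?thesis by (simp add: vir_cocycle_def)
  qed
  have ad: "ad (N d) (?t d \<phi>) - (\<Sum>l<length xs. ?t (Suc d) (\<phi>(d := l))) \<in> J" for \<phi>
  proof -
    have "ad (N d) (word (hit N \<phi> d xs)) - (\<Sum>l<length xs. scale (of_int (hit N \<phi> d xs ! l - N d))
        (word ((hit N \<phi> d xs)[l := hit N \<phi> d xs ! l + N d]))) \<in> J" (is "_ - (\<Sum>l<_. ?s l) \<in> J")
      using ad_word[of "N d" "hit N \<phi> d xs", OF _ D coc] Suc.prems(1) D_pos by (simp only: length_hit)
    then have "scale (hit_coeff N \<phi> d xs) (ad (N d) (word (hit N \<phi> d xs)) - (\<Sum>l<length xs. ?s l)) \<in> J"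
      by (rule PM.subspace_scale[OF subspace])
    moreover have "scale (hit_coeff N \<phi> d xs) (\<Sum>l<length xs. ?s l) = (\<Sum>l<length xs. ?t (Suc d) (\<phi>(d :=
        l)))"
      unfolding scale_sum by (intro sum.cong refl) (simp add: hit_Suc hit_coeff_Suc scale_scale)
    ultimately show ?thesis by (simp add: PM.scale_right_diff_distrib ad_scale)
  qed
  have "(\<Sum>\<phi>\<in>?P d. ad (N d) (?t d \<phi>) - (\<Sum>l<length xs. ?t (Suc d) (\<phi>(d := l)))) \<in> J"
    by (intro PM.subspace_sum[OF subspace] ad)
  moreover have "(\<Sum>\<phi>\<in>?P d. \<Sum>l<length xs. ?t (Suc d) (\<phi>(d := l))) = (\<Sum>\<phi>\<in>?P (Suc d). ?t (Suc d) \<phi>)"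
  proof -
    have "(\<Sum>\<phi>\<in>?P (Suc d). ?t (Suc d) \<phi>) =
        (\<Sum>(l, \<phi>)\<in>{..<length xs} \<times> ?P d. ?t (Suc d) (\<phi>(d := l)))"
      unfolding lessThan_Suc PiE_insert_eq
      by (subst sum.reindex[OF inj_combinator]) (simp_all add: case_prod_unfold)
    then show ?thesis by (subst sum.swap) (simp add: sum.cartesian_product)
  qed
  ultimately have "ad (N d) (\<Sum>\<phi>\<in>?P d. ?t d \<phi>) - (\<Sum>\<phi>\<in>?P (Suc d). ?t (Suc d) \<phi>) \<in> J"
    by (simp add: sum_subtractf ad_sum)
  from PM.subspace_add[OF subspace 1 this] show ?case by simp
qed

end

section \<open>Finite differences\<close>

text \<open>
  The step \<open>N + \<delta>\<^sub>a - \<delta>\<^sub>b\<close>; it preserves the sum of the indices, hence the weight of all words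
  produced.
\<close>

fun twist :: "nat \<times> nat \<Rightarrow> (nat \<Rightarrow> int) \<Rightarrow> (nat \<Rightarrow> int)" where
  "twist (a, b) N = (\<lambda>j. N j + ((if j = a then 1 else 0) - (if j = b then 1 else 0)))"

definition Delta :: "nat \<times> nat \<Rightarrow> ((nat \<Rightarrow> int) \<Rightarrow> 'v::ab_group_add) \<Rightarrow> (nat \<Rightarrow> int) \<Rightarrow> 'v" where
  "Delta p G N = G (twist p N) - G N"

abbreviation Diff :: "(nat \<times> nat) list \<Rightarrow> ((nat \<Rightarrow> int) \<Rightarrow> 'v::ab_group_add) \<Rightarrow> (nat \<Rightarrow> int) \<Rightarrow> 'v" where
  "Diff ps \<equiv> fold Delta ps"

lemma twist_commute: "twist p (twist q N) = twist q (twist p N)"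
  by (cases p; cases q) (auto simp: fun_eq_iff)

lemma Delta_commute: "Delta p (Delta q G) = Delta q (Delta p G)"
  by (rule ext) (simp add: Delta_def twist_commute[of p q])

lemma Diff_Delta: "Diff ps (Delta p G) = Delta p (Diff ps G)"
proof (induction ps arbitrary: G)
  case (Cons q ps)
  then show ?case by (simp only: fold_Cons comp_def Delta_commute[of q p])
qed simp

lemma Diff_Cons: "Diff (p # ps) G N = Diff ps G (twist p N) - Diff ps G N"
  by (simp add: Diff_Delta) (simp add: Delta_def)

lemma Diff_mset: "mset ps = mset qs \<Longrightarrow> Diff ps = Diff qs"
  by (rule fold_multiset_equiv) (auto simp: fun_eq_iff Delta_commute)

lemma Diff_zero: "Diff ps (\<lambda>_. 0) = (\<lambda>_. 0)"
proof -
  have "Delta p (\<lambda>_. 0) = (\<lambda>_. 0 :: 'a)" for p by (simp add: Delta_def fun_eq_iff)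
  then show ?thesis by (induction ps) simp_all
qed

lemma Diff_add: "Diff ps (\<lambda>N. G N + H N) N = Diff ps G N + Diff ps H N"
  by (induction ps arbitrary: N) (simp_all only: Diff_Cons, simp_all)

lemma Diff_sum: "Diff ps (\<lambda>N. \<Sum>s\<in>S. G s N) N = (\<Sum>s\<in>S. Diff ps (G s) N)"
  by (induction S rule: infinite_finite_induct) (simp_all add: Diff_zero Diff_add)

lemma Diff_scale: "Diff ps (\<lambda>N. scale c (G N)) N = scale c (Diff ps G N)"
  by (induction ps arbitrary: N) (simp_all only: Diff_Cons, simp_all add: PM.scale_right_diff_distrib)

lemma Diff_twist: "Diff ps (\<lambda>N. G (twist p N)) N = Diff ps G (twist p N)"
  by (induction ps arbitrary: N) (simp_all only: Diff_Cons, simp_all add: twist_commute)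

text \<open>
  A finite difference lowers the degree of a polynomial: if \<open>n\<close> differences annihilate \<open>H\<close>, then
  \<open>n + 1\<close> differences annihilate the product of \<open>H\<close> with a function that is affine along the step.
\<close>

lemma Diff_affine:
  fixes H :: "(nat \<Rightarrow> int) \<Rightarrow> ('b \<Rightarrow>\<^sub>0 'k::field)"
  assumes "Diff (replicate n p) H = (\<lambda>_. 0)" "\<And>N. f (twist p N) = f N + c"
  shows "Diff (replicate (Suc n) p) (\<lambda>N. scale (f N) (H N)) = (\<lambda>_. 0)"
  using assms(1)
proof (induction n arbitrary: H)
  case 0
  then have "H = (\<lambda>_. 0)" by simp
  then show ?case by (simp add: Delta_def fun_eq_iff)
next
  case (Suc n)
  have D: "Delta p (\<lambda>N. scale (f N) (H N)) = (\<lambda>N. scale (f N) (Delta p H N) + scale c (H (twist p N)))"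
    by (simp add: fun_eq_iff Delta_def assms(2) scale_add_left PM.scale_right_diff_distrib
        algebra_simps)
  have "Diff (replicate n p) (Delta p H) = (\<lambda>_. 0)" using Suc.prems by simp
  from Suc.IH[OF this] have 1: "Diff (replicate (Suc n) p) (\<lambda>N. scale (f N) (Delta p H N)) = (\<lambda>_. 0)" .
  have 2: "Diff (replicate (Suc n) p) (\<lambda>N. scale c (H (twist p N))) N = 0" for N
    by (simp only: Diff_scale Diff_twist[of _ H] Suc.prems scale_zero_right)
  have 3: "Diff (replicate (Suc (Suc n)) p) (\<lambda>N. scale (f N) (H N)) =
      Diff (replicate (Suc n) p) (\<lambda>N. scale (f N) (Delta p H N) + scale c (H (twist p N)))"
    by (simp only: replicate_Suc[of "Suc n"] fold_Cons comp_def D)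
  show ?case unfolding 3 by (rule ext) (simp only: Diff_add fun_cong[OF 1] 2 add_0)
qed

text \<open>
  The \<open>(d + 1)\<close>-fold step for every pair \<open>a < b < d\<close>.  In terms of generating functions in variables
  \<open>t\<^sub>0, t\<^sub>1, \<dots>\<close>, taking these differences amounts to multiplication by the power
  \<open>d + 1\<close> of a Vandermonde product.
\<close>

definition all_twists :: "nat \<Rightarrow> (nat \<times> nat) list" where
  "all_twists d = concat (map (replicate (Suc d)) (filter (\<lambda>(a, b). a < b) (List.product [0..<d]
      [0..<d])))"

lemma all_twists_pairs: "(a, b) \<in> set (all_twists d) \<Longrightarrow> a < b \<and> b < d"
  by (auto simp: all_twists_def)

lemma Diff_all_twists_zero:
  assumes "a < b" "b < d" "Diff (replicate (Suc d) (a, b)) G = (\<lambda>_. 0)"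
  shows "Diff (all_twists d) G = (\<lambda>_. 0)"
proof -
  define prs where "prs = filter (\<lambda>(a, b). a < b) (List.product [0..<d] [0..<d])"
  have "(a, b) \<in> set prs" using assms by (auto simp: prs_def)
  then obtain us vs where prs: "prs = us @ (a, b) # vs"
    by (meson split_list)
  have "all_twists d = concat (map (replicate (Suc d)) us) @ replicate (Suc d) (a, b) @ concat (map
      (replicate (Suc d)) vs)"
    unfolding all_twists_def prs_def[symmetric] prs
    by (simp only: map_append concat_append list.map concat.simps append_assoc)
  then have "mset (all_twists d) = mset (replicate (Suc d) (a, b) @
      concat (map (replicate (Suc d)) us) @ concat (map (replicate (Suc d)) vs))"
    by (simp only: mset_append ac_simps)
  from fun_cong[OF Diff_mset[OF this], of G] have "Diff (all_twists d) G = Diff (concat (map (replicate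
      (Suc d)) us) @ concat (map (replicate (Suc d)) vs))
      (Diff (replicate (Suc d) (a, b)) G)"
    by (simp only: fold_append comp_def)
  then show ?thesis by (simp only: assms(3) Diff_zero)
qed

lemma twist_shift: "twist p N j = N j + twist p (\<lambda>_. 0) j"
  by (cases p) simp

text \<open>
  If \<open>a\<close> and \<open>b\<close> hit the same letter, the step changes the coefficient but not the word, and the
  coefficient is a product of \<open>d\<close> affine functions.
\<close>

lemma Diff_hit_zero:
  assumes "a < b" "b < d" "\<phi> a = \<phi> b"
  shows "Diff (replicate (Suc d) (a, b)) (\<lambda>N. scale (hit_coeff N \<phi> d xs :: 'k::field_char_0) (word (hit
      N \<phi> d xs)))
    = (\<lambda>_. 0)"
proof -
  have inv: "hit (twist (a, b) N) \<phi> d xs = hit N \<phi> d xs" for N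
  proof -
    have "(\<Sum>i | i < d \<and> \<phi> i = l. twist (a, b) N i) = (\<Sum>i | i < d \<and> \<phi> i = l. N i)" for l
      using assms by (simp add: sum.distrib sum_subtractf)
    then show ?thesis by (simp only: hit_def)
  qed
  define f where "f i N = (of_int (xs ! \<phi> i + (\<Sum>i' | i' < i \<and> \<phi> i' = \<phi> i. N i') - N i) :: 'k)" for i and
      N :: "nat \<Rightarrow> int"
  have aff: "f i (twist (a, b) N) = f i N +
      of_int ((\<Sum>i' | i' < i \<and> \<phi> i' = \<phi> i. twist (a, b) (\<lambda>_. 0) i') - twist (a, b) (\<lambda>_. 0) i)" for i N
    unfolding f_def of_int_add[symmetric] of_int_eq_iff twist_shift[of "(a, b)" N] sum.distrib by simp
  have "Diff (replicate (Suc e) (a, b)) (\<lambda>N. scale (\<Prod>i<e. f i N) (word (hit N \<phi> d xs) :: 'k word_ring))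
      = (\<lambda>_. 0)" for e
  proof (induction e)
    case 0
    show ?case by (simp add: Delta_def fun_eq_iff inv del: twist.simps)
  next
    case (Suc e)
    have eq: "(\<lambda>N. scale (\<Prod>i<Suc e. f i N) (word (hit N \<phi> d xs) :: 'k word_ring)) =
       (\<lambda>N. scale (f e N) (scale (\<Prod>i<e. f i N) (word (hit N \<phi> d xs))))"
      by (simp add: scale_scale mult.commute)
    show ?case unfolding eq by (rule Diff_affine[where f = "f e", OF Suc]) (rule aff)
  qed
  then show ?thesis by (simp only: hit_coeff_def f_def)
qed


section \<open>The leading word\<close>

definition translate :: "nat \<Rightarrow> int list \<Rightarrow> (nat \<Rightarrow> int) \<Rightarrow> int list" where
  "translate d x N = map (\<lambda>j. x ! j + N j) [0..<d]"

text \<open>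
  A numerical stand-in for the lexicographic order on multisets of letters: if at most \<open>m - 1\<close> letters
  are compared, one larger letter outweighs all smaller ones.  Being additive under
  concatenation, it survives multiplication by further words.
\<close>

definition lex_weight :: "nat \<Rightarrow> int list \<Rightarrow> nat" where
  "lex_weight m ys = (\<Sum>y\<leftarrow>ys. m ^ nat y)"

text \<open>
  The letters \<open>x\<^sub>j + N\<^sub>j\<close> are positive and decreasing, with room for \<open>n\<close> further steps.
\<close>

definition spread :: "nat \<Rightarrow> int list \<Rightarrow> (nat \<Rightarrow> int) \<Rightarrow> nat \<Rightarrow> bool" where
  "spread d x N n \<longleftrightarrow> (\<forall>a b. a < b \<and> b < d \<longrightarrow> x ! b + N b + 2 * int n \<le> x ! a + N a)
    \<and> (\<forall>j<d. int n < x ! j + N j)"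

definition same_size_below :: "nat \<Rightarrow> nat \<Rightarrow> int list \<Rightarrow> int list set" where
  "same_size_below m d t = {ys. length ys = d \<and> set ys \<subseteq> {0<..} \<and> sum_list ys = sum_list t \<and> lex_weight
      m ys < lex_weight m t}"

lemma length_translate [simp]: "length (translate d x N) = d"
  by (simp add: translate_def)

lemma sum_upt: "(\<Sum>j\<leftarrow>[0..<d]. f j) = (\<Sum>j<d. f j)"
  by (simp add: interv_sum_list_conv_sum_set_nat lessThan_atLeast0)

lemma sum_list_translate: "sum_list (translate d x N) = (\<Sum>j<d. x ! j) + (\<Sum>j<d. N j)"
  by (simp add: translate_def sum.distrib sum_upt)

lemma lex_weight_translate: "lex_weight m (translate d x N) = (\<Sum>j<d. m ^ nat (x ! j + N j))"
  by (simp add: translate_def lex_weight_def comp_def sum_upt)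

lemma spread_mono: "spread d x N n \<Longrightarrow> n' \<le> n \<Longrightarrow> spread d x N n'"
proof -
  assume *: "spread d x N n" and le: "n' \<le> n"
  show ?thesis
    unfolding spread_def
  proof (intro conjI allI impI)
    fix a b assume "a < b \<and> b < d"
    then have "x ! b + N b + 2 * int n \<le> x ! a + N a" using * by (simp only: spread_def)
    then show "x ! b + N b + 2 * int n' \<le> x ! a + N a" using le by linarith
  next
    fix j assume "j < d"
    then have "int n < x ! j + N j" using * by (simp only: spread_def)
    then show "int n' < x ! j + N j" using le by linarith
  qed
qed

lemma spread_twist: "spread d x N (Suc n) \<Longrightarrow> a < b \<Longrightarrow> b < d \<Longrightarrow> spread d x (twist (a, b) N) n"
proof -
  assume *: "spread d x N (Suc n)" and ab: "a < b" "b < d"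
  have lo: "N j - 1 \<le> twist (a, b) N j" and hi: "twist (a, b) N j \<le> N j + 1" for j by simp_all
  show ?thesis
    unfolding spread_def
  proof (intro conjI allI impI)
    fix a' b' assume "a' < b' \<and> b' < d"
    then have "x ! b' + N b' + 2 * int (Suc n) \<le> x ! a' + N a'" using * by (simp only: spread_def)
    then show "x ! b' + twist (a, b) N b' + 2 * int n \<le> x ! a' + twist (a, b) N a'"
      using lo[of a'] hi[of b'] by simp
  next
    fix j assume "j < d"
    then have "int (Suc n) < x ! j + N j" using * by (simp only: spread_def)
    then show "int n < x ! j + twist (a, b) N j" using lo[of j] by simp
  qed
qed

lemma spread_fold:
  "spread d x N (length ps) \<Longrightarrow> set ps \<subseteq> {(a, b). a < b \<and> b < d} \<Longrightarrow> spread d x (fold twist ps N) 0"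
proof (induction ps arbitrary: N)
  case (Cons p ps)
  obtain a b where p: "p = (a, b)" by fastforce
  have "spread d x (twist p N) (length ps)" unfolding p by (rule spread_twist) (use Cons.prems p in
      auto)
  then show ?case using Cons.IH[of "twist p N"] Cons.prems by simp
qed simp

lemma fold_twist_commute: "fold twist ps (twist p N) = twist p (fold twist ps N)"
proof (induction ps arbitrary: N)
  case (Cons q ps)
  show ?case by (simp only: fold_Cons comp_def twist_commute[of q p] Cons)
qed simp

lemma fold_twist_Cons: "fold twist (p # ps) N = twist p (fold twist ps N)"
  by (simp add: fold_twist_commute)

lemma fold_twist_shift: "fold twist ps N j = N j + fold twist ps (\<lambda>_. 0) j"
proof (induction ps arbitrary: N)
  case (Cons p ps)
  show ?case
    by (simp add: Cons.IH[of "twist p N"] Cons.IH[of "twist p (\<lambda>_. 0)"]) (simp add: twist_shift[of p N])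
qed simp

lemma fold_twist_bound: "\<bar>fold twist ps N j - N j\<bar> \<le> int (length ps)"
proof (induction ps arbitrary: N)
  case (Cons p ps)
  have "\<bar>twist p N j - N j\<bar> \<le> 1" by (cases p) simp
  then show ?case using Cons[of "twist p N"] by simp
qed simp

lemma sum_twist: "a < d \<Longrightarrow> b < d \<Longrightarrow> (\<Sum>j<d. twist (a, b) N j) = (\<Sum>j<d. N j)"
  by (simp add: sum.distrib sum_subtractf)

lemma sum_fold_twist:
  "set ps \<subseteq> {(a, b). a < b \<and> b < d} \<Longrightarrow> (\<Sum>j<d. fold twist ps N j) = (\<Sum>j<d. N j)"
proof (induction ps arbitrary: N)
  case (Cons p ps)
  obtain a b where p: "p = (a, b)" by fastforce
  have "(\<Sum>j<d. twist p N j) = (\<Sum>j<d. N j)" unfolding p by (rule sum_twist) (use Cons.prems p in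
      fastforce)+
  then show ?case using Cons.IH[of "twist p N"] Cons.prems by simp
qed simp

text \<open>
  Convexity: raising the larger of two letters gains more than lowering the smaller one loses.
\<close>

lemma lex_weight_twist:
  assumes "spread d x N 0" "a < b" "b < d" "2 \<le> m"
  shows "lex_weight m (translate d x N) < lex_weight m (translate d x (twist (a, b) N))"
proof -
  let ?A = "{..<d} - {a} - {b}"
  have split: "sum f {..<d} = f a + (f b + sum f ?A)" for f :: "nat \<Rightarrow> nat"
    using assms by (subst sum.remove[of _ a]; simp; subst sum.remove[of _ b]; simp)
  have "x ! b + N b \<le> x ! a + N a" "0 < x ! a + N a" using assms by (auto simp: spread_def)
  then have "nat (x ! b + N b) \<le> nat (x ! a + N a)" "nat (x ! a + N a + 1) = Suc (nat (x ! a + N a))" by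
      auto
  then have "m ^ nat (x ! b + N b) \<le> m ^ nat (x ! a + N a)"
      "2 * m ^ nat (x ! a + N a) \<le> m ^ nat (x ! a + N a + 1)"
    using assms(4) by (auto intro!: power_increasing)
  then have "m ^ nat (x ! a + N a) + m ^ nat (x ! b + N b) < m ^ nat (x ! a + N a + 1) + m ^ nat (x ! b
      + N b - 1)"
    using zero_less_power[of m "nat (x ! b + N b - 1)"] assms(4) by linarith
  moreover have "(\<Sum>j\<in>?A. m ^ nat (x ! j + twist (a, b) N j)) = (\<Sum>j\<in>?A. m ^ nat (x ! j + N j))"
    by (intro sum.cong) auto
  ultimately show ?thesis
    unfolding lex_weight_translate split using assms(2) by (simp add: algebra_simps)
qed

text \<open>
  Expanding the differences gives the values of \<open>G\<close> after all subsets of the steps.  Since each step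
  makes the word larger, the term in which all steps are taken dominates.
\<close>

lemma Diff_leading:
  fixes G :: "(nat \<Rightarrow> int) \<Rightarrow> ('k::field) word_ring"
  assumes "\<And>N. \<exists>c. G N = scale c (word (translate d x N))" "2 \<le> m"
    "set ps \<subseteq> {(a, b). a < b \<and> b < d}" "spread d x N (length ps)"
  shows "Diff ps G N - G (fold twist ps N) \<in> PM.span (word ` same_size_below m d (translate d x (fold
      twist ps N)))"
  using assms(3,4)
proof (induction ps arbitrary: N)
  case (Cons p ps)
  obtain a b where p: "p = (a, b)" by fastforce
  have ab: "a < b" "b < d" using Cons.prems(1) p by auto
  have pairs: "set ps \<subseteq> {(a, b). a < b \<and> b < d}" using Cons.prems(1) by simp
  let ?M = "fold twist ps N"
  let ?B = "PM.span (word ` same_size_below m d (translate d x (twist p ?M))) :: 'k word_ring set"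
  have sp: "spread d x N (length ps)" using Cons.prems(2) by (rule spread_mono) simp
  have spM: "spread d x ?M 0" by (rule spread_fold[OF sp pairs])
  have less: "lex_weight m (translate d x ?M) < lex_weight m (translate d x (twist p ?M))"
    unfolding p by (rule lex_weight_twist[OF spM ab assms(2)])
  have sum: "sum_list (translate d x ?M) = sum_list (translate d x (twist p ?M))"
    using ab by (simp only: sum_list_translate p sum_twist)
  have 1: "Diff ps G (twist p N) - G (twist p ?M) \<in> ?B"
    using Cons.IH[OF pairs, of "twist p N"] spread_twist[OF _ ab] Cons.prems(2)
    by (simp only: p fold_twist_commute length_Cons)
  have "same_size_below m d (translate d x ?M) \<subseteq> same_size_below m d (translate d x (twist p ?M))"
    using less sum by (auto simp: same_size_below_def)
  then have 2: "Diff ps G N - G ?M \<in> ?B"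
    using Cons.IH[OF pairs sp] PM.span_mono[OF image_mono] by blast
  have "set (translate d x ?M) \<subseteq> {0<..}"
    using spM by (auto simp: translate_def spread_def)
  then have "translate d x ?M \<in> same_size_below m d (translate d x (twist p ?M))"
    using less sum by (simp add: same_size_below_def)
  then have "word (translate d x ?M) \<in> ?B" by (simp add: PM.span_base)
  then have 3: "G ?M \<in> ?B" using assms(1)[of ?M] PM.span_scale by metis
  have "Diff (p # ps) G N - G (fold twist (p # ps) N)
    = (Diff ps G (twist p N) - G (twist p ?M)) - ((Diff ps G N - G ?M) + G ?M)"
    by (simp only: Diff_Cons fold_twist_Cons) (simp add: algebra_simps)
  also have "\<dots> \<in> ?B" by (intro PM.span_diff PM.span_add 1 2 3)
  finally show ?case by (simp only: fold_twist_Cons)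
qed (simp add: PM.span_zero)

text \<open>
  At the first place where \<open>x\<close> and \<open>x'\<close> differ, \<open>x'\<close> gains a factor \<open>d + 1\<close> over each of the at most
  \<open>d\<close> remaining letters of \<open>x\<close>.
\<close>

lemma lex_weight_lex:
  assumes "x < x'" "length x = d" "length x' = d" "spread d x N 0"
  shows "lex_weight (Suc d) (translate d x N) < lex_weight (Suc d) (translate d x' N)"
proof -
  obtain j where j: "j < d" "take j x = take j x'" "x ! j < x' ! j"
    using assms(1-3) by (auto simp: list_less_def lexord_take_index_conv)
  have eq: "x ! i = x' ! i" if "i < j" for i using j(2) that by (metis nth_take)
  let ?e = "\<lambda>x i. Suc d ^ nat (x ! i + N i)"
  have split: "sum f {..<d} = sum f {..<j} + sum f {j..<d}" for f :: "nat \<Rightarrow> nat"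
    using j(1) sum.atLeastLessThan_concat[of 0 j d f] by (simp add: lessThan_atLeast0)
  have "nat (x ! i + N i) \<le> nat (x ! j + N j)" if "i \<in> {j..<d}" for i
    using assms(4) that by (cases "i = j") (auto simp: spread_def intro!: nat_mono)
  then have "?e x i \<le> ?e x j" if "i \<in> {j..<d}" for i using that by (intro power_increasing) auto
  then have "(\<Sum>i\<in>{j..<d}. ?e x i) \<le> of_nat (card {j..<d}) * ?e x j" by (intro sum_bounded_above) auto
  also have "\<dots> \<le> d * ?e x j" by simp
  also have "\<dots> < Suc d * ?e x j" by simp
  also have "\<dots> = Suc d ^ Suc (nat (x ! j + N j))" by simp
  also have "\<dots> \<le> ?e x' j"
  proof (rule power_increasing)
    have "0 < x ! j + N j" using assms(4) j(1) by (auto simp: spread_def)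
    then show "Suc (nat (x ! j + N j)) \<le> nat (x' ! j + N j)" using j(3) by linarith
  qed simp
  also have "\<dots> \<le> (\<Sum>i\<in>{j..<d}. ?e x' i)" using j(1) by (intro member_le_sum) auto
  finally have "(\<Sum>i\<in>{j..<d}. ?e x i) < (\<Sum>i\<in>{j..<d}. ?e x' i)" .
  moreover have "(\<Sum>i<j. ?e x i) = (\<Sum>i<j. ?e x' i)" using eq by (intro sum.cong) auto
  ultimately show ?thesis unfolding lex_weight_translate split by simp
qed

text \<open>
  Differences only involve indices that are at most as many units lower as there are steps, and have
  the same sum.  This transfers a property of all indices in a region to the differences.
\<close>

lemma Diff_closed:
  assumes "\<And>p q. p \<in> S \<Longrightarrow> q \<in> S \<Longrightarrow> p - q \<in> S"
    "set ps \<subseteq> {(a, b). a < b \<and> b < d}"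
    "\<And>N'. (\<And>j. N j - int (length ps) \<le> N' j) \<Longrightarrow> (\<Sum>j<d. N' j) = (\<Sum>j<d. N j) \<Longrightarrow> G N' \<in> S"
  shows "Diff ps G N \<in> S"
  using assms(2,3)
proof (induction ps arbitrary: N)
  case (Cons p ps)
  obtain a b where p: "p = (a, b)" by fastforce
  have ab: "a < b" "b < d" using Cons.prems(1) p by auto
  have sum: "(\<Sum>j<d. twist p N j) = (\<Sum>j<d. N j)" unfolding p by (rule sum_twist) (use ab in auto)
  have low: "N j - 1 \<le> twist p N j" for j by (simp add: p)
  have ps: "set ps \<subseteq> {(a, b). a < b \<and> b < d}" using Cons.prems(1) by simp
  have "Diff ps G (twist p N) \<in> S"
  proof (rule Cons.IH[OF ps Cons.prems(2)])
    fix N' j assume N': "\<And>j. twist p N j - int (length ps) \<le> N' j"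
    show "N j - int (length (p # ps)) \<le> N' j" using N'[of j] low[of j] by simp
  qed (simp only: sum)
  moreover have "Diff ps G N \<in> S"
  proof (rule Cons.IH[OF ps Cons.prems(2)])
    fix N' j assume N': "\<And>j. N j - int (length ps) \<le> N' j"
    show "N j - int (length (p # ps)) \<le> N' j" using N'[of j] by simp
  qed
  ultimately show ?case unfolding Diff_Cons by (rule assms(1))
qed simp

lemma Diff_diff: "Diff ps (\<lambda>N. G N - H N) N = Diff ps G N - Diff ps H N"
  by (induction ps arbitrary: N) (simp_all only: Diff_Cons, simp_all)

lemma mset_map_perm:
  assumes "\<phi> \<in> {..<d} \<rightarrow>\<^sub>E {..<d}" "inj_on \<phi> {..<d}"
  shows "mset (map (\<lambda>j. g (\<phi> j)) [0..<d]) = mset (map g [0..<d])"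
proof -
  have "\<phi> ` {..<d} = {..<d}"
    using assms by (intro endo_inj_surj) auto
  then have "image_mset \<phi> (mset_set {..<d}) = mset_set {..<d}"
    using image_mset_mset_set[OF assms(2)] by simp
  then have "image_mset g (image_mset \<phi> (mset_set {..<d})) = image_mset g (mset_set {..<d})" by simp
  then show ?thesis by (simp add: lessThan_atLeast0 image_mset.compositionality comp_def
      mset_upt[symmetric] del: mset_upt)
qed


section \<open>Reducing spread words\<close>

definition perms :: "nat \<Rightarrow> (nat \<Rightarrow> nat) set" where
  "perms d = {\<phi> \<in> {..<d} \<rightarrow>\<^sub>E {..<d}. inj_on \<phi> {..<d}}"

definition rearrange :: "nat \<Rightarrow> int list \<Rightarrow> (nat \<Rightarrow> nat) \<Rightarrow> int list" where
  "rearrange d xs \<phi> = map (\<lambda>j. xs ! \<phi> j) [0..<d]"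

lemma finite_perms: "finite (perms d)"
  unfolding perms_def by (rule finite_subset[of _ "{..<d} \<rightarrow>\<^sub>E {..<d}"]) (auto intro: finite_PiE)

lemma length_rearrange [simp]: "length (rearrange d xs \<phi>) = d"
  by (simp add: rearrange_def)

lemma mset_rearrange: "\<phi> \<in> perms d \<Longrightarrow> length xs = d \<Longrightarrow> mset (rearrange d xs \<phi>) = mset xs"
proof -
  assume "\<phi> \<in> perms d" and len: "length xs = d"
  then have "mset (map (\<lambda>j. xs ! \<phi> j) [0..<d]) = mset (map ((!) xs) [0..<d])"
    unfolding perms_def by (intro mset_map_perm) blast+
  also have "map ((!) xs) [0..<d] = xs" unfolding len[symmetric] by (rule map_nth)
  finally show ?thesis by (simp only: rearrange_def)
qed

lemma hit_coeff_inj: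
  assumes "\<phi> \<in> perms d" "length xs = d"
  shows "hit_coeff N \<phi> d xs = (\<Prod>j<d. of_int (rearrange d xs \<phi> ! j - N j))"
  unfolding hit_coeff_def
proof (rule prod.cong[OF refl])
  fix i assume i: "i \<in> {..<d}"
  then have "{i'. i' < i \<and> \<phi> i' = \<phi> i} = {}"
    using assms(1) by (fastforce simp: perms_def inj_on_def)
  then have E: "(\<Sum>i' | i' < i \<and> \<phi> i' = \<phi> i. N i') = 0" by (simp only: sum.empty)
  show "of_int (xs ! \<phi> i + (\<Sum>i' | i' < i \<and> \<phi> i' = \<phi> i. N i') - N i) = of_int (rearrange d xs \<phi> ! i - N
      i)"
    unfolding E using i by (simp add: rearrange_def)
qed

lemma mset_hit_inj:
  assumes "\<phi> \<in> perms d" "length xs = d"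
  shows "mset (hit N \<phi> d xs) = mset (translate d (rearrange d xs \<phi>) N)"
proof -
  let ?g = "\<lambda>l. xs ! l + (\<Sum>i | i < d \<and> \<phi> i = l. N i)"
  have \<phi>: "\<phi> \<in> {..<d} \<rightarrow>\<^sub>E {..<d}" and inj: "inj_on \<phi> {..<d}"
    using assms(1) unfolding perms_def by blast+
  have g: "?g (\<phi> j) = rearrange d xs \<phi> ! j + N j" if "j < d" for j
  proof -
    have "{i. i < d \<and> \<phi> i = \<phi> j} = {j}"
      using that inj_onD[OF inj] by auto
    then have E: "(\<Sum>i | i < d \<and> \<phi> i = \<phi> j. N i) = N j" by simp
    show ?thesis unfolding E using that by (simp add: rearrange_def)
  qed
  then have "translate d (rearrange d xs \<phi>) N = map (\<lambda>j. ?g (\<phi> j)) [0..<d]"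
    unfolding translate_def by (intro map_cong refl) (simp only: g set_upt atLeastLessThan_iff)
  then show ?thesis
    using mset_map_perm[OF \<phi> inj, of ?g] unfolding hit_def assms(2) by simp
qed

definition lead_term :: "nat \<Rightarrow> int list \<Rightarrow> (nat \<Rightarrow> int) \<Rightarrow> ('k::field_char_0) word_ring" where
  "lead_term d x N = scale (\<Prod>j<d. of_int (x ! j - N j)) (word (translate d x N))"

definition hit_term :: "nat \<Rightarrow> int list \<Rightarrow> (nat \<Rightarrow> nat) \<Rightarrow> (nat \<Rightarrow> int) \<Rightarrow> ('k::field_char_0) word_ring" where
  "hit_term d xs \<phi> N = scale (hit_coeff N \<phi> d xs) (word (hit N \<phi> d xs))"

text \<open>
  The order along which positive words are reduced: weight first, then length, then lexicographic
  weight.  The terms of lower weight come from inhomogeneous relations, those of lower length from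
  reordering.
\<close>

definition smaller :: "nat \<Rightarrow> int list \<Rightarrow> int list set" where
  "smaller m t = {ys. set ys \<subseteq> {0<..} \<and> (sum_list ys < sum_list t \<or> sum_list ys = sum_list t \<and>
     (length ys < length t \<or> length ys = length t \<and> lex_weight m ys < lex_weight m t))}"

lemma all_twists_subset: "set (all_twists d) \<subseteq> {(a, b). a < b \<and> b < d}"
  using all_twists_pairs by auto

lemma Diff_all_twists_hit_term:
  assumes "\<phi> \<in> {..<d} \<rightarrow>\<^sub>E S" "\<not> inj_on \<phi> {..<d}"
  shows "Diff (all_twists d) (hit_term d xs \<phi> :: _ \<Rightarrow> ('k::field_char_0) word_ring) = (\<lambda>_. 0)"
proof -
  obtain a b where ab: "a < b" "b < d" "\<phi> a = \<phi> b"
    using assms(2) unfolding inj_on_def by (metis lessThan_iff linorder_neqE_nat)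
  have "hit_term d xs \<phi> = (\<lambda>N. scale (hit_coeff N \<phi> d xs :: 'k) (word (hit N \<phi> d xs)))"
    by (rule ext) (simp add: hit_term_def)
  then show ?thesis
    using Diff_all_twists_zero[OF ab(1,2) Diff_hit_zero[OF ab]] by simp
qed

lemma mset_sum_list: "mset xs = mset ys \<Longrightarrow> sum_list xs = (sum_list ys :: int)"
  by (metis sum_mset_sum_list)

context vir_kernel
begin

lemma positive_kernel: "vir_kernel \<kappa> J {0<..}"
  by unfold_locales (auto intro: subspace mult_left mult_right relation D_pos)

text \<open>
  Words of lower weight in \<open>p\<close> only contribute words of lower weight, whatever letters are hit.
\<close>

lemma iter_ad_below:
  assumes "p \<in> reducible_to {ys. set ys \<subseteq> {0<..} \<and> sum_list ys < s}" "\<And>j. j < d \<Longrightarrow> 0 < N j"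
  shows "iter_ad N d p \<in> reducible_to {ys. set ys \<subseteq> {0<..} \<and> sum_list ys < s + (\<Sum>j<d. N j)}"
  using assms(2)
proof (induction d)
  case (Suc d)
  let ?q = "iter_ad N d p"
  let ?Y = "{ys. set ys \<subseteq> {0<..} \<and> sum_list ys < s + (\<Sum>j<Suc d. N j)}"
  have q: "?q \<in> reducible_to {ys. set ys \<subseteq> {0<..} \<and> sum_list ys < s + (\<Sum>j<d. N j)}" using Suc by simp
  have N: "0 < N d" using Suc.prems by simp
  have "word [N d] * ?q * word [] \<in> reducible_to ?Y"
    using N by (intro red_sandwich[OF q]) auto
  moreover have "word [] * ?q * word [N d] \<in> reducible_to ?Y"
    using N by (intro red_sandwich[OF q]) auto
  ultimately show ?case by (simp add: ad_def word_Nil red_diff)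
qed (use assms(1) in simp)

text \<open>
  For bijective \<open>\<phi>\<close> the word that was hit is a rearrangement of the translate of a rearrangement of
  \<open>xs\<close>, and reordering costs only shorter words.  All letters are positive here, so the relations
  between positive letters suffice and no nonpositive letters come up.
\<close>

lemma hit_term_reorder:
  assumes "\<phi> \<in> perms d" "length xs = d" "set (translate d (rearrange d xs \<phi>) N) \<subseteq> {0<..}"
  shows "hit_term d xs \<phi> N - lead_term d (rearrange d xs \<phi>) N
    \<in> reducible_to {ys. set ys \<subseteq> {0<..} \<and> sum_list ys = sum_list xs + (\<Sum>j<d. N j) \<and> length ys < d}"
proof -
  interpret pos: vir_kernel \<kappa> J "{0<..}" by (rule positive_kernel)
  let ?t = "translate d (rearrange d xs \<phi>) N"
  have m: "mset (hit N \<phi> d xs) = mset ?t" using assms by (intro mset_hit_inj)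
  have "sum_list (hit N \<phi> d xs) = sum_list ?t" using m by (rule mset_sum_list)
  also have "\<dots> = sum_list (rearrange d xs \<phi>) + (\<Sum>j<d. N j)"
    unfolding sum_list_translate by (simp add: sum_list_sum_nth lessThan_atLeast0)
  also have "sum_list (rearrange d xs \<phi>) = sum_list xs"
    using assms by (intro mset_sum_list mset_rearrange)
  finally have sum: "sum_list (hit N \<phi> d xs) = sum_list xs + (\<Sum>j<d. N j)" .
  have "word (hit N \<phi> d xs) - word ?t \<in> reducible_to (pos.shorter (hit N \<phi> d xs))"
    using assms m by (intro pos.reorder) (auto dest: mset_eq_setD)
  moreover have "pos.shorter (hit N \<phi> d xs) \<subseteq>
      {ys. set ys \<subseteq> {0<..} \<and> sum_list ys = sum_list xs + (\<Sum>j<d. N j) \<and> length ys < d}"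
    using sum assms(2) by (auto simp: pos.shorter_def)
  ultimately show ?thesis
    unfolding hit_term_def lead_term_def hit_coeff_inj[OF assms(1,2)]
      PM.scale_right_diff_distrib[symmetric]
    by (intro red_scale) (rule red_mono)
qed

lemma Diff_lead_term:
  assumes "spread d x N (length (all_twists d))"
  shows "Diff (all_twists d) (lead_term d x) N - lead_term d x (fold twist (all_twists d) N)
    \<in> reducible_to (same_size_below (Suc d) d (translate d x (fold twist (all_twists d) N)))"
proof (cases "d = 0")
  case True
  then have "all_twists d = []" by (simp add: all_twists_def)
  then show ?thesis by (simp add: red_zero)
next
  case False
  have "Diff (all_twists d) (lead_term d x) N - lead_term d x (fold twist (all_twists d) N)
    \<in> PM.span (word ` same_size_below (Suc d) d (translate d x (fold twist (all_twists d) N)))"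
    by (rule Diff_leading) (use False assms all_twists_subset in \<open>auto simp: lead_term_def\<close>)
  then show ?thesis
    unfolding reducible_to_def using PM.span_mono[OF Un_upper2] by blast
qed

text \<open>
  The contribution of a bijective \<open>\<phi>\<close> after all differences: its leading term, up to shorter words
  and words of the same length that are lexicographically smaller.
\<close>

lemma Diff_hit_term_inj:
  assumes \<phi>: "\<phi> \<in> perms d" and xs: "length xs = d"
    and bound: "\<And>y. y \<in> set xs \<Longrightarrow> \<bar>y\<bar> \<le> B"
    and N: "\<And>j. j < d \<Longrightarrow> B + int (length (all_twists d)) < N j"
    and sp: "spread d (rearrange d xs \<phi>) N (length (all_twists d))"
  shows "Diff (all_twists d) (hit_term d xs \<phi>) N - lead_term d (rearrange d xs \<phi>) (fold twist
      (all_twists d) N)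
    \<in> reducible_to ({ys. set ys \<subseteq> {0<..} \<and> sum_list ys = sum_list xs + (\<Sum>j<d. N j) \<and> length ys < d} \<union>
      same_size_below (Suc d) d (translate d (rearrange d xs \<phi>) (fold twist (all_twists d) N)))" (is "_
          \<in> reducible_to (?Y \<union> ?Z)")
proof -
  let ?x = "rearrange d xs \<phi>"
  have b: "- B \<le> ?x ! j" if "j < d" for j
  proof -
    have "?x ! j \<in> set xs"
      using \<phi> xs that by (auto simp: rearrange_def perms_def intro!: nth_mem)
    then show ?thesis using bound by fastforce
  qed
  have "Diff (all_twists d) (\<lambda>N. hit_term d xs \<phi> N - lead_term d ?x N) N \<in> reducible_to ?Y"
  proof (rule Diff_closed[where d = d, OF _ all_twists_subset])
    fix N' assume N': "\<And>j. N j - int (length (all_twists d)) \<le> N' j" "(\<Sum>j<d. N' j) = (\<Sum>j<d. N j)"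
    have "0 < ?x ! j + N' j" if "j < d" for j
      using b[OF that] N[OF that] N'(1)[of j] by linarith
    then have "set (translate d ?x N') \<subseteq> {0<..}" by (auto simp: translate_def)
    from hit_term_reorder[OF \<phi> xs this]
    show "hit_term d xs \<phi> N' - lead_term d ?x N' \<in> reducible_to ?Y" by (simp only: N'(2))
  qed (rule red_diff)
  then have 1: "Diff (all_twists d) (hit_term d xs \<phi>) N - Diff (all_twists d) (lead_term d ?x) N \<in>
      reducible_to (?Y \<union> ?Z)"
    by (simp only: Diff_diff) (rule red_mono, auto)
  have 2: "Diff (all_twists d) (lead_term d ?x) N - lead_term d ?x (fold twist (all_twists d) N) \<in>
      reducible_to (?Y \<union> ?Z)"
    by (rule red_mono[OF Diff_lead_term[OF sp]]) auto
  show ?thesis using red_add[OF 1 2] by simp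
qed

end


lemma sorted_mset_unique: "sorted xs \<Longrightarrow> sorted ys \<Longrightarrow> mset xs = mset ys \<Longrightarrow> xs = ys"
  by (metis properties_for_sort)

lemma sum_list_nth: "sum_list x = (\<Sum>j<length x. x ! j)"
  by (simp add: sum_list_sum_nth lessThan_atLeast0)

context vir_kernel
begin

text \<open>
  The main reduction.  The hypotheses single out the part of \<open>p\<close> of highest weight \<open>W\<close>; words of lower
  weight must be positive, so that commutators keep them positive and of lower weight.  Distinct
  words in the support have distinct multisets of letters, which prevents cancellation between
  their rearrangements.
\<close>

lemma spread_reducible:
  assumes pJ: "p \<in> J"
    and keys: "\<And>w. w \<in> supp p \<Longrightarrow>
      set (letters w) \<subseteq> D \<and> sum_list (letters w) \<le> W"
    and inj: "inj_on (\<lambda>w. mset (letters w)) (supp p)"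
    and low: "\<And>w. w \<in> supp p \<Longrightarrow> sum_list (letters w) < W \<Longrightarrow> set (letters w) \<subseteq> {0<..}"
    and top: "\<exists>w\<in>supp p. sum_list (letters w) = W"
  shows "\<exists>C d. \<forall>t. length t = d \<longrightarrow> (\<forall>a b. a < b \<and> b < d \<longrightarrow> t ! b + C \<le> t ! a) \<longrightarrow> (\<forall>j<d. C \<le> t ! j)
    \<longrightarrow> word t \<in> reducible_to (smaller (Suc d) t)"
proof -
  define T where "T = {w \<in> supp p. sum_list (letters w) = W}"
  have finT: "finite T" and neT: "T \<noteq> {}" using top by (auto simp: T_def)
  define d where "d = Max ((\<lambda>w. length (letters w)) ` T)"
  define Td where "Td = {w \<in> T. length (letters w) = d}"
  have len_le: "length (letters w) \<le> d" if "w \<in> T" for w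
    unfolding d_def using finT that by (intro Max_ge) auto
  have "d \<in> (\<lambda>w. length (letters w)) ` T" unfolding d_def using finT neT by (intro Max_in) auto
  then have neTd: "Td \<noteq> {}" by (auto simp: Td_def)
  have finTd: "finite Td" using finT by (simp add: Td_def)
  define c where "c = coeff_at p"
  have c0: "c w \<noteq> 0" if "w \<in> T" for w using that by (auto simp: T_def c_def in_keys_iff)
  define L where "L = length (all_twists d)"
  obtain B where B: "0 \<le> B" "\<And>w y. w \<in> supp p \<Longrightarrow> y \<in> set (letters w) \<Longrightarrow> \<bar>y\<bar> \<le> B"
  proof
    let ?S = "\<Union>w\<in>supp p. set (letters w)"
    show "0 \<le> (\<Sum>y\<in>?S. \<bar>y\<bar>)" by (intro sum_nonneg) simp
    show "\<bar>y\<bar> \<le> (\<Sum>y\<in>?S. \<bar>y\<bar>)" if "w \<in> supp p" "y \<in> set (letters w)" for w y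
      using that by (intro member_le_sum[of y ?S abs]) auto
  qed
  \<comment> \<open>The leading exponent \<open>x\<close> is chosen independently of the target \<open>t\<close>.\<close>
  define X where "X = (\<lambda>(w, \<phi>). rearrange d (letters w) \<phi>) ` (Td \<times> perms d)"
  have "(\<lambda>j\<in>{..<d}. j) \<in> perms d" by (auto simp: perms_def inj_on_def)
  then have "X \<noteq> {}" "finite X" using neTd finTd finite_perms by (auto simp: X_def)
  define x where "x = Max X"
  have xX: "x \<in> X" and xmax: "\<And>y. y \<in> X \<Longrightarrow> y \<le> x"
    using \<open>X \<noteq> {}\<close> \<open>finite X\<close> by (auto simp: x_def)
  then obtain w0 \<phi>0 where w0: "w0 \<in> Td" "\<phi>0 \<in> perms d" "x = rearrange d (letters w0) \<phi>0"
    unfolding X_def by auto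
  have lenx: "length x = d" by (simp add: w0)
  have Td_mset: "mset (rearrange d (letters w) \<phi>) = mset (letters w)" if "w \<in> Td" "\<phi> \<in> perms d" for w \<phi>
    using that by (intro mset_rearrange) (auto simp: Td_def)
  have unique: "w = w0" if "w \<in> Td" "\<phi> \<in> perms d" "rearrange d (letters w) \<phi> = x" for w \<phi>
  proof -
    have "mset (letters w) = mset (letters w0)" 
      using Td_mset[OF that(1,2)] Td_mset[OF w0(1,2)] unfolding that(3) w0(3)[symmetric] by simp
    moreover have "w \<in> supp p" "w0 \<in> supp p"
      using that(1) w0(1) by (auto simp: Td_def T_def)
    ultimately show ?thesis using inj_onD[OF inj] by blast
  qed
  \<comment> \<open>Up to the product of the structure constants, \<open>K\<close> is the coefficient of the leading word.\<close>
  define K where "K = (\<Sum>(w, \<phi>)\<in>Td \<times> perms d. if rearrange d (letters w) \<phi> = x then c w else 0)"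
  have "K \<noteq> 0"
  proof -
    define P where "P s \<longleftrightarrow> rearrange d (letters (fst s)) (snd s) = x" for s
    define S where "S = {s \<in> Td \<times> perms d. P s}"
    have fin: "finite (Td \<times> perms d)" using finTd finite_perms by (intro finite_cartesian_product)
    then have fS: "finite S" by (rule finite_subset[rotated]) (simp add: S_def)
    have "K = (\<Sum>s\<in>Td \<times> perms d. if P s then c (fst s) else 0)"
      unfolding K_def P_def case_prod_unfold by (rule refl)
    also have "\<dots> = (\<Sum>s\<in>S. c (fst s))"
      unfolding S_def by (rule sum.inter_filter[OF fin, symmetric])
    also have "\<dots> = (\<Sum>s\<in>S. c w0)"
    proof (rule sum.cong[OF refl])
      fix s assume "s \<in> S"
      then obtain w \<phi> where "s = (w, \<phi>)" "w \<in> Td" "\<phi> \<in> perms d" "rearrange d (letters w) \<phi> = x"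
        unfolding S_def P_def by auto
      then show "c (fst s) = c w0" using unique by simp
    qed
    also have "\<dots> = of_nat (card S) * c w0" by simp
    finally have "K = of_nat (card S) * c w0" .
    moreover have "(w0, \<phi>0) \<in> S" unfolding S_def P_def using w0(1,2) by (simp flip: w0(3))
    then have "card S \<noteq> 0" using fS by auto
    ultimately show ?thesis using c0 w0(1) by (simp add: Td_def)
  qed
  \<comment> \<open>The letters of \<open>p\<close> account for \<open>B\<close>, the finite differences for \<open>L\<close> in each of the estimates below.\<close>
  define C where "C = 4 * int L + 4 * B + 1"
  have main: "word t \<in> reducible_to (smaller (Suc d) t)"
    if t: "length t = d" "\<And>a b. a < b \<and> b < d \<Longrightarrow> t ! b + C \<le> t ! a" "\<And>j. j < d \<Longrightarrow> C \<le> t ! j" for t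
  proof -
    define M where "M j = t ! j - x ! j" for j
    \<comment> \<open>After all steps the indices are \<open>M\<close>, so that the leading word becomes \<open>t\<close>.\<close>
    define N where "N j = M j - fold twist (all_twists d) (\<lambda>_. 0) j" for j
    have foldN: "fold twist (all_twists d) N = M"
      by (rule ext) (simp add: fold_twist_shift[of _ N] N_def)
    have shift: "\<bar>N j - M j\<bar> \<le> int L" for j
      using fold_twist_bound[of "all_twists d" "\<lambda>_. 0" j] by (simp add: N_def L_def)
    have tM: "translate d x M = t"
      using t(1) by (intro nth_equalityI) (simp_all add: translate_def M_def)
    have sumNM: "(\<Sum>j<d. N j) = (\<Sum>j<d. M j)"
      using sum_fold_twist[OF all_twists_subset, of d N] by (simp add: foldN)
    have sumr: "sum_list (rearrange d (letters w) \<phi>) = W" if "w \<in> Td" "\<phi> \<in> perms d" for w \<phi>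
      using mset_sum_list[OF Td_mset[OF that]] that by (simp add: Td_def T_def)
    have sumt: "sum_list (translate d (rearrange d (letters w) \<phi>) M) = W + (\<Sum>j<d. N j)"
      if "w \<in> Td" "\<phi> \<in> perms d" for w \<phi>
      using sumr[OF that] unfolding sum_list_translate sumNM by (simp add: sum_list_nth)
    have sumT: "sum_list t = W + (\<Sum>j<d. N j)" using sumt[OF w0(1,2)] by (simp add: tM flip: w0(3))
    have rb: "\<bar>rearrange d (letters w) \<phi> ! j\<bar> \<le> B" if "w \<in> Td" "\<phi> \<in> perms d" "j < d" for w \<phi> j
    proof -
      have "rearrange d (letters w) \<phi> ! j \<in> set (rearrange d (letters w) \<phi>)" using that(3) by (intro
          nth_mem) simp
      also have "\<dots> = set (letters w)" by (rule mset_eq_setD[OF Td_mset[OF that(1,2)]])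
      finally show ?thesis using B(2) that(1) by (auto simp: Td_def T_def)
    qed
    have xb: "\<bar>x ! j\<bar> \<le> B" if "j < d" for j using rb[OF w0(1,2) that] w0(3) by simp
    have Nlow: "B + int L < N j" if "j < d" for j
      using t(3)[OF that] xb[OF that] shift[of j] B(1) unfolding M_def C_def by linarith
    have sp: "spread d (rearrange d (letters w) \<phi>) N L" if "w \<in> Td" "\<phi> \<in> perms d" for w \<phi>
      unfolding spread_def
    proof (intro conjI allI impI)
      fix a b assume ab: "a < b \<and> b < d"
      then have "a < d" "b < d" by auto
      then show "rearrange d (letters w) \<phi> ! b + N b + 2 * int L \<le> rearrange d (letters w) \<phi> ! a + N a"
        using t(2)[OF ab] xb[of a] xb[of b] rb[OF that, of a] rb[OF that, of b] shift[of a] shift[of b]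
            B(1)
        unfolding M_def C_def by linarith
    next
      fix j assume "j < d"
      then show "int L < rearrange d (letters w) \<phi> ! j + N j"
        using Nlow[of j] rb[OF that, of j] by linarith
    qed
    have spM: "spread d (rearrange d (letters w) \<phi>) M 0" if "w \<in> Td" "\<phi> \<in> perms d" for w \<phi>
      using spread_fold[OF _ all_twists_subset, of d _ N] sp[OF that] by (simp add: foldN L_def)
    let ?h = "\<lambda>w. hit_term d (letters w) :: (nat \<Rightarrow> nat) \<Rightarrow> (nat \<Rightarrow> int) \<Rightarrow> 'k word_ring"
    let ?E = "\<lambda>w. {..<d} \<rightarrow>\<^sub>E {..<length (letters w)}"
    \<comment> \<open>The sum over all hits agrees with the iterated commutator only for large indices,
      but it can be differenced formally.\<close>
    define H where "H N = (\<Sum>w\<in>T. scale (c w) (\<Sum>\<phi>\<in>?E w. ?h w \<phi> N))" for N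
    let ?R = "reducible_to (smaller (Suc d) t)"
    have H: "H N' \<in> reducible_to {ys. set ys \<subseteq> {0<..} \<and> sum_list ys < W + (\<Sum>j<d. N' j)}" (is "_ \<in>
        reducible_to ?Y")
      if N': "\<And>j. j < d \<Longrightarrow> B < N' j" for N'
    proof -
      define q where "q = (\<Sum>w\<in>supp p - T. scale (c w) (word (letters w)))"
      have p: "p = (\<Sum>w\<in>T. scale (c w) (word (letters w))) + q"
        unfolding q_def c_def
        by (subst (1) expand_words, subst sum.subset_diff[of T]) (auto simp: T_def)
      have "q \<in> reducible_to {ys. set ys \<subseteq> {0<..} \<and> sum_list ys < W}"
        unfolding q_def using keys low by (intro red_sum red_scale red_word) (force simp: T_def)
      then have "iter_ad N' d q \<in> reducible_to ?Y"
        using N' B(1) by (intro iter_ad_below) force+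
      moreover have "iter_ad N' d p \<in> reducible_to ?Y" using pJ by (intro red_J iter_ad_J)
      ultimately have "iter_ad N' d p - iter_ad N' d q \<in> reducible_to ?Y" by (intro red_diff)
      moreover have "iter_ad N' d p - iter_ad N' d q = (\<Sum>w\<in>T. scale (c w) (iter_ad N' d (word (letters
          w))))"
        by (subst p) (simp add: iter_ad_add iter_ad_sum iter_ad_scale)
      ultimately have 1: "(\<Sum>w\<in>T. scale (c w) (iter_ad N' d (word (letters w)))) \<in> reducible_to ?Y" by
          simp
      have "(\<Sum>w\<in>T. scale (c w) (iter_ad N' d (word (letters w)) - (\<Sum>\<phi>\<in>?E w. ?h w \<phi> N'))) \<in> J"
      proof (intro PM.subspace_sum[OF subspace] PM.subspace_scale[OF subspace])
        fix w assume "w \<in> T"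
        then have w: "w \<in> supp p" by (simp add: T_def)
        have "0 < y + N' j" if "y \<in> set (letters w)" "j < d" for y j
          using B(2)[OF w that(1)] N'[OF that(2)] by linarith
        moreover have "0 < N' j" if "j < d" for j using N'[OF that] B(1) by linarith
        ultimately show "iter_ad N' d (word (letters w)) - (\<Sum>\<phi>\<in>?E w. ?h w \<phi> N') \<in> J"
          unfolding hit_term_def using keys[OF w] by (intro iter_ad_word) auto
      qed
      then have "(\<Sum>w\<in>T. scale (c w) (iter_ad N' d (word (letters w)))) - H N' \<in> reducible_to ?Y"
        by (intro red_J) (simp add: H_def PM.scale_right_diff_distrib sum_subtractf)
      then show ?thesis using red_cong[OF _ 1] red_minus_commute by blast
    qed
    have "Diff (all_twists d) H N \<in> reducible_to {ys. set ys \<subseteq> {0<..} \<and> sum_list ys < sum_list t}"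
    proof (rule Diff_closed[where d = d, OF _ all_twists_subset])
      fix N' assume N': "\<And>j. N j - int (length (all_twists d)) \<le> N' j" "(\<Sum>j<d. N' j) = (\<Sum>j<d. N j)"
      have "B < N' j" if "j < d" for j using N'(1)[of j] Nlow[OF that] by (simp add: L_def)
      from H[of N', OF this] show "H N' \<in> reducible_to {ys. set ys \<subseteq> {0<..} \<and> sum_list ys < sum_list t}"
        by (simp only: N'(2) sumT)
    qed (rule red_diff)
    then have DH: "Diff (all_twists d) H N \<in> ?R" by (rule red_mono) (auto simp: smaller_def)
    \<comment> \<open>Only words of length \<open>d\<close> and injective \<open>\<phi>\<close> survive.\<close>
    have DH_eq: "Diff (all_twists d) H N = (\<Sum>(w, \<phi>)\<in>Td \<times> perms d. scale (c w) (Diff (all_twists d) (?h w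
        \<phi>) N))"
    proof -
      have inner: "(\<Sum>\<phi>\<in>?E w. Diff (all_twists d) (?h w \<phi>) N) = (if w \<in> Td then \<Sum>\<phi>\<in>perms d. Diff
          (all_twists d) (?h w \<phi>) N else 0)"
        if "w \<in> T" for w
      proof -
        have zero: "Diff (all_twists d) (?h w \<phi>) N = 0" if "\<phi> \<in> ?E w" "\<not> inj_on \<phi> {..<d}" for \<phi>
          by (simp only: Diff_all_twists_hit_term[OF that])
        show ?thesis
        proof (cases "w \<in> Td")
          case True
          then have l: "length (letters w) = d" by (simp add: Td_def)
          have "(\<Sum>\<phi>\<in>?E w. Diff (all_twists d) (?h w \<phi>) N) = (\<Sum>\<phi>\<in>perms d. Diff (all_twists d) (?h w \<phi>)
              N)"
            using zero by (intro sum.mono_neutral_right) (auto simp: l perms_def intro!: finite_PiE)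
          then show ?thesis using True by simp
        next
          case False
          then have "length (letters w) < d" using len_le[OF \<open>w \<in> T\<close>] \<open>w \<in> T\<close> by (simp add: Td_def)
          then have "\<not> inj_on \<phi> {..<d}" if "\<phi> \<in> ?E w" for \<phi>
            using card_inj_on_le[of \<phi> "{..<d}" "{..<length (letters w)}"] that by auto
          then show ?thesis using zero False by (simp add: sum.neutral)
        qed
      qed
      have "Diff (all_twists d) H N = (\<Sum>w\<in>T. scale (c w) (\<Sum>\<phi>\<in>?E w. Diff (all_twists d) (?h w \<phi>) N))"
        unfolding H_def by (simp only: Diff_sum Diff_scale)
      also have "\<dots> = (\<Sum>w\<in>T. if w \<in> Td then scale (c w) (\<Sum>\<phi>\<in>perms d. Diff (all_twists d) (?h w \<phi>) N) else
          0)"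
        by (intro sum.cong refl) (simp only: inner split: if_split, simp)
      also have "\<dots> = (\<Sum>w\<in>{w \<in> T. w \<in> Td}. scale (c w) (\<Sum>\<phi>\<in>perms d. Diff (all_twists d) (?h w \<phi>) N))"
        by (rule sum.inter_filter[OF finT, symmetric])
      also have "{w \<in> T. w \<in> Td} = Td" by (auto simp: Td_def)
      finally show ?thesis by (simp add: scale_sum sum.cartesian_product)
    qed
    have each: "Diff (all_twists d) (?h w \<phi>) N - (if rearrange d (letters w) \<phi> = x then lead_term d x M
        else 0) \<in> ?R"
      if w: "w \<in> Td" "\<phi> \<in> perms d" for w \<phi>
    proof -
      let ?y = "rearrange d (letters w) \<phi>"
      have "?y \<in> X" using w by (auto simp: X_def)
      then have "?y \<le> x" by (rule xmax)
      have lt: "lex_weight (Suc d) (translate d ?y M) < lex_weight (Suc d) t" if "?y \<noteq> x"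
        using lex_weight_lex[OF _ _ lenx spM[OF w]] \<open>?y \<le> x\<close> that by (simp add: tM)
      then have le: "lex_weight (Suc d) (translate d ?y M) \<le> lex_weight (Suc d) t" by (cases "?y = x")
          (auto simp: tM)
      have sW: "sum_list (letters w) = W" and lw: "length (letters w) = d" using w by (auto simp: Td_def
          T_def)
      have "Diff (all_twists d) (?h w \<phi>) N - lead_term d ?y M \<in>
        reducible_to ({ys. set ys \<subseteq> {0<..} \<and> sum_list ys = sum_list (letters w) + (\<Sum>j<d. N j) \<and> length
            ys < d} \<union>
          same_size_below (Suc d) d (translate d ?y M))"
        unfolding foldN[symmetric]
      proof (rule Diff_hit_term_inj[OF w(2) lw])
        show "\<bar>y\<bar> \<le> B" if "y \<in> set (letters w)" for y using B(2) that w by (auto simp: Td_def T_def)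
      qed (use Nlow sp[OF w] in \<open>auto simp: L_def\<close>)
      then have 1: "Diff (all_twists d) (?h w \<phi>) N - lead_term d ?y M \<in> ?R"
      proof (rule red_mono)
        show "{ys. set ys \<subseteq> {0<..} \<and> sum_list ys = sum_list (letters w) + (\<Sum>j<d. N j) \<and> length ys < d} \<union>
          same_size_below (Suc d) d (translate d ?y M) \<subseteq> smaller (Suc d) t"
          using le sumt[OF w] sumT t(1) sW by (auto simp: smaller_def same_size_below_def)
      qed
      show ?thesis
      proof (cases "?y = x")
        case True
        then show ?thesis using 1 by simp
      next
        case False
        have "set (translate d ?y M) \<subseteq> {0<..}" using spM[OF w] by (auto simp: translate_def spread_def)
        then have "translate d ?y M \<in> smaller (Suc d) t"
          using lt[OF False] sumt[OF w] sumT t(1) by (simp add: smaller_def)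
        then have "lead_term d ?y M \<in> ?R" unfolding lead_term_def by (intro red_scale red_word)
        from red_add[OF 1 this] show ?thesis using False by simp
      qed
    qed
    let ?l = "\<lambda>w \<phi>. if rearrange d (letters w) \<phi> = x then lead_term d x M else (0 :: 'k word_ring)"
    have "(\<Sum>(w, \<phi>)\<in>Td \<times> perms d. scale (c w) (Diff (all_twists d) (?h w \<phi>) N - ?l w \<phi>)) \<in> ?R"
      by (rule red_sum) (auto intro!: red_scale each)
    moreover have "(\<Sum>(w, \<phi>)\<in>Td \<times> perms d. scale (c w) (Diff (all_twists d) (?h w \<phi>) N - ?l w \<phi>))
      = Diff (all_twists d) H N - (\<Sum>(w, \<phi>)\<in>Td \<times> perms d. scale (c w) (?l w \<phi>))"
      unfolding DH_eq sum_subtractf[symmetric] by (intro sum.cong) (auto simp: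
          PM.scale_right_diff_distrib)
    moreover have "(\<Sum>(w, \<phi>)\<in>Td \<times> perms d. scale (c w) (?l w \<phi>)) = scale K (lead_term d x M)"
      unfolding K_def PM.scale_sum_left by (intro sum.cong) auto
    ultimately have "Diff (all_twists d) H N - scale K (lead_term d x M) \<in> ?R" by simp
    then have "scale K (lead_term d x M) \<in> ?R" using red_diff[OF DH] by fastforce
    moreover have "scale K (lead_term d x M) = scale (K * (\<Prod>j<d. of_int (x ! j - M j))) (word t)"
      by (simp add: lead_term_def scale_scale tM)
    moreover have "(\<Prod>j<d. of_int (x ! j - M j) :: 'k) \<noteq> 0"
    proof -
      have "x ! j \<noteq> M j" if "j < d" for j
        using xb[OF that] Nlow[OF that] shift[of j] by linarith
      then have "(of_int (x ! j - M j) :: 'k) \<noteq> 0" if "j < d" for j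
        using that by (simp only: of_int_eq_0_iff) simp
      then show ?thesis by (simp only: prod_zero_iff finite_lessThan) blast
    qed
    ultimately have k: "scale (K * (\<Prod>j<d. of_int (x ! j - M j))) (word t) \<in> ?R"
        "K * (\<Prod>j<d. of_int (x ! j - M j)) \<noteq> 0"
      using \<open>K \<noteq> 0\<close> by (simp_all only: mult_eq_0_iff) simp
    from red_scale[OF k(1), of "inverse (K * (\<Prod>j<d. of_int (x ! j - M j)))"]
    show ?thesis by (simp only: scale_scale left_inverse[OF k(2)] scale_one)
  qed
  show ?thesis
    by (rule exI[of _ C], rule exI[of _ d]) (use main in blast)
qed

end


section \<open>Counting the irreducible words\<close>

lemma strict_sorted_gap:
  fixes s :: "int list"
  assumes "sorted_wrt (<) s" "i \<le> j" "j < length s"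
  shows "s ! i + int (j - i) \<le> s ! j"
  using assms(2,3)
proof (induction j rule: dec_induct)
  case (step k)
  have "s ! k < s ! Suc k" using assms(1) step by (simp add: sorted_wrt_nth_less)
  moreover have "s ! i + int (k - i) \<le> s ! k" using step by simp
  ultimately show ?case using step(1) by (simp add: Suc_diff_le)
qed simp

text \<open>
  In a word with more than \<open>C * d\<close> distinct positive letters, every \<open>C\<close>-th of them in sorted order
  gives \<open>d\<close> letters with gaps of at least \<open>C\<close>.
\<close>

lemma spread_subword:
  assumes "set xs \<subseteq> {0<..}" "0 < C" "C * d < card (set xs)"
  obtains t r :: "int list" where "mset xs = mset (t @ r)" "length t = d"
    "\<And>a b. a < b \<Longrightarrow> b < d \<Longrightarrow> t ! b + int C \<le> t ! a" "\<And>j. j < d \<Longrightarrow> int C \<le> t ! j"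
proof -
  define s where "s = sorted_list_of_set (set xs)"
  have s: "sorted_wrt (<) s" "set s = set xs" "length s = card (set xs)"
    by (simp_all add: s_def)
  define t where "t = map (\<lambda>j. s ! (C * (d - j))) [0..<d]"
  have ix: "C * (d - j) < length s" for j
  proof -
    have "C * (d - j) \<le> C * d" by simp
    then show ?thesis using assms(3) s(3) by linarith
  qed
  have gap: "t ! b + int C \<le> t ! a" if "a < b" "b < d" for a b
  proof -
    have "d - a = (d - b) + (b - a)" using that by simp
    then have "C * (d - a) = C * (d - b) + C * (b - a)" by (simp only: distrib_left)
    moreover have "C * 1 \<le> C * (b - a)" using that by (intro mult_le_mono2) simp
    ultimately have le: "C * (d - b) + C \<le> C * (d - a)" by simp
    have "s ! (C * (d - b)) + int (C * (d - a) - C * (d - b)) \<le> s ! (C * (d - a))"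
      by (rule strict_sorted_gap[OF s(1) order_trans[OF le_add1 le] ix])
    moreover have "int C \<le> int (C * (d - a) - C * (d - b))" using le by linarith
    ultimately have "s ! (C * (d - b)) + int C \<le> s ! (C * (d - a))" by linarith
    then show ?thesis using that by (simp add: t_def)
  qed
  have low: "int C \<le> t ! j" if "j < d" for j
  proof -
    have "0 < length s" using ix[of 0] by linarith
    then have "s ! 0 \<in> set xs" using s(2) nth_mem by blast
    then have "0 < s ! 0" using assms(1) by auto
    moreover have "C * 1 \<le> C * (d - j)" using that by (intro mult_le_mono2) simp
    then have "int C \<le> int (C * (d - j) - 0)" by (simp only: of_nat_le_iff mult_1_right
        minus_nat.diff_0)
    moreover have "s ! 0 + int (C * (d - j) - 0) \<le> s ! (C * (d - j))"
      by (rule strict_sorted_gap[OF s(1) le0 ix])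
    ultimately have "int C \<le> s ! (C * (d - j))" by linarith
    then show ?thesis using that by (simp add: t_def)
  qed
  have "distinct t"
    unfolding distinct_conv_nth
  proof (intro allI impI)
    fix a b assume ab: "a < length t" "b < length t" "a \<noteq> b"
    then have "a < b \<and> b < d \<or> b < a \<and> a < d" by (auto simp: t_def)
    then show "t ! a \<noteq> t ! b" using gap[of a b] gap[of b a] assms(2) by auto
  qed
  moreover have "set t \<subseteq> set xs"
    using ix s(2) by (auto simp: t_def intro: nth_mem)
  ultimately have "mset t \<subseteq># mset xs"
    by (auto simp: subseteq_mset_def distinct_count_atmost_1 Suc_le_eq count_mset_0_iff)
  then obtain A where "mset xs = mset t + A" by (auto simp: mset_subset_eq_exists_conv)
  moreover obtain r where "mset r = A" by (metis ex_mset)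
  ultimately show ?thesis using that[of t r] gap low by (simp add: t_def)
qed

lemma lex_weight_append: "lex_weight m (xs @ ys) = lex_weight m xs + lex_weight m ys"
  by (simp add: lex_weight_def)

lemma lex_weight_mset: "mset xs = mset ys \<Longrightarrow> lex_weight m xs = lex_weight m ys"
  unfolding lex_weight_def by (metis mset_map sum_mset_sum_list)

lemma smaller_append: "ys \<in> smaller m t \<Longrightarrow> set r \<subseteq> {0<..} \<Longrightarrow> ys @ r \<in> smaller m (t @ r)"
  by (auto simp: smaller_def lex_weight_append)

lemma smaller_mset: "mset xs = mset ys \<Longrightarrow> smaller m xs = smaller m ys"
proof -
  assume m: "mset xs = mset ys"
  show ?thesis unfolding smaller_def mset_sum_list[OF m] lex_weight_mset[OF m] mset_eq_length[OF m] ..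
qed

lemma positive_sum_list:
  fixes ys :: "int list"
  shows "set ys \<subseteq> {0<..} \<Longrightarrow> int (length ys) \<le> sum_list ys"
  by (induction ys) auto

text \<open>
  The words that remain when all spread subwords have been eliminated.
\<close>

definition few_letters :: "nat \<Rightarrow> int \<Rightarrow> int list set" where
  "few_letters K n = {ys. sorted ys \<and> set ys \<subseteq> {0<..} \<and> sum_list ys \<le> n \<and> card (set ys) \<le> K}"

text \<open>
  Such a word is determined by at most \<open>K\<close> pairs of a letter and its multiplicity, all of them
  bounded by \<open>n\<close>.
\<close>

lemma few_letters_bound:
  "finite (few_letters K (int n))" "card (few_letters K (int n)) \<le> (n + 1) ^ (2 * K)"
proof -
  define f where "f ps = sort (concat (map (\<lambda>(v, m). replicate m (int v)) ps))" for ps :: "(nat \<times> nat)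
      list"
  define Q where "Q = {ps. set ps \<subseteq> {0..n} \<times> {0..n} \<and> length ps = K}"
  have fin: "finite Q" and card: "card Q = (n + 1) ^ (2 * K)"
    using finite_lists_length_eq[of "{0..n} \<times> {0..n}" K] card_lists_length_eq[of "{0..n} \<times> {0..n}" K]
    by (simp_all add: Q_def power_mult power2_eq_square card_cartesian_product)
  have sub: "few_letters K (int n) \<subseteq> f ` Q"
  proof
    fix ys assume "ys \<in> few_letters K (int n)"
    then have ys: "sorted ys" "set ys \<subseteq> {0<..}" "sum_list ys \<le> int n" "card (set ys) \<le> K"
      by (auto simp: few_letters_def)
    define vs where "vs = sorted_list_of_set (set ys)"
    define ps where "ps = map (\<lambda>v. (nat v, count (mset ys) v)) vs @ replicate (K - length vs) (0, 0)"
    have vs: "distinct vs" "set vs = set ys" "length vs = card (set ys)" by (simp_all add: vs_def)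
    have "concat (map (\<lambda>(v, m). replicate m (int v)) ps) = concat (map (\<lambda>v. replicate (count (mset ys)
        v) v) vs)"
    proof -
      have M: "map (\<lambda>(v, m). replicate m (int v)) (map (\<lambda>v. (nat v, count (mset ys) v)) vs)
          = map (\<lambda>v. replicate (count (mset ys) v) v) vs"
        unfolding map_map comp_def using ys(2) vs(2) by (intro map_cong) auto
      moreover have "concat (map (\<lambda>(v, m). replicate m (int v)) (replicate k (0, 0))) = []" for k
        by (induction k) auto
      ultimately show ?thesis by (simp only: ps_def map_append concat_append M append_Nil2)
    qed
    moreover have "mset (concat (map (\<lambda>v. replicate (count (mset ys) v) v) vs)) = mset ys"
    proof (rule multiset_eqI)
      fix v
      have "count (mset (concat (map (\<lambda>v. replicate (g v) v) vs))) v = (if v \<in> set vs then g v else 0)"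
          for g
        using vs(1) by (induction vs) auto
      then show "count (mset (concat (map (\<lambda>v. replicate (count (mset ys) v) v) vs))) v = count (mset
          ys) v"
        by (simp add: vs(2) count_mset_0_iff)
    qed
    ultimately have "f ps = ys"
      using ys(1) unfolding f_def by (intro sorted_mset_unique) simp_all
    moreover have "ps \<in> Q"
    proof -
      have "nat v \<le> n" if "v \<in> set ys" for v
      proof -
        have "v \<le> sum_list ys" using that ys(2) by (intro member_le_sum_list) auto
        then show ?thesis using ys(3) by simp
      qed
      moreover have "count (mset ys) v \<le> n" for v
        using positive_sum_list[OF ys(2)] ys(3) count_le_length[of ys v] by (simp add: count_mset) 
      ultimately show ?thesis
        using vs ys(4) by (auto simp: Q_def ps_def)
    qed
    ultimately show "ys \<in> f ` Q" by blast
  qed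
  show "finite (few_letters K (int n))" using finite_subset[OF sub] fin by simp
  have "card (few_letters K (int n)) \<le> card (f ` Q)" using sub fin by (intro card_mono) simp_all
  also have "\<dots> \<le> card Q" by (rule card_image_le[OF fin])
  finally show "card (few_letters K (int n)) \<le> (n + 1) ^ (2 * K)" using card by simp
qed

context vir_kernel
begin

text \<open>
  Well-founded induction along \<open>smaller\<close>: a word with too many distinct letters contains, up to
  reordering, a spread subword, and replacing it leads to smaller words because all three components
  of the order are additive.
\<close>

lemma positive_reduction:
  assumes spread: "\<And>t. length t = d \<Longrightarrow> (\<And>a b. a < b \<Longrightarrow> b < d \<Longrightarrow> t ! b + int C \<le> t ! a) \<Longrightarrow>
      (\<And>j. j < d \<Longrightarrow> int C \<le> t ! j) \<Longrightarrow> word t \<in> reducible_to (smaller (Suc d) t)"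
    and "0 < C" "set xs \<subseteq> {0<..}"
  shows "word xs \<in> reducible_to (few_letters (C * d) (sum_list xs))"
  using assms(3)
proof (induction xs rule: wf_induct_rule[OF wf_measures[of "[\<lambda>xs. nat (sum_list xs), length, lex_weight
    (Suc d)]"]])
  case (1 xs)
  interpret pos: vir_kernel \<kappa> J "{0<..}" by (rule positive_kernel)
  have IH: "word ys \<in> reducible_to (few_letters (C * d) (sum_list xs))" if ys: "ys \<in> smaller (Suc d) xs"
      for ys
  proof -
    have pos: "set ys \<subseteq> {0<..}" and le: "sum_list ys \<le> sum_list xs" using ys by (auto simp: smaller_def)
    have "0 \<le> sum_list ys" using positive_sum_list[OF pos] by simp
    then have "(ys, xs) \<in> measures [\<lambda>xs. nat (sum_list xs), length, lex_weight (Suc d)]"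
      using ys by (auto simp: smaller_def)
    from 1(1)[OF this pos] show ?thesis
      by (rule red_mono) (use le in \<open>auto simp: few_letters_def\<close>)
  qed
  have short: "pos.shorter xs \<subseteq> smaller (Suc d) xs"
    by (auto simp: pos.shorter_def smaller_def)
  show ?case
  proof (cases "card (set xs) \<le> C * d")
    case True
    have "word xs - word (sort xs) \<in> reducible_to (smaller (Suc d) xs)"
      using pos.reorder[of xs "sort xs"] 1(2) short red_mono by simp
    then have "word xs - word (sort xs) \<in> reducible_to (few_letters (C * d) (sum_list xs))"
      by (rule red_trans) (rule IH)
    moreover have "word (sort xs) \<in> reducible_to (few_letters (C * d) (sum_list xs))"
      using True 1(2) mset_sum_list[of "sort xs" xs] by (intro red_word) (simp add: few_letters_def)
    ultimately show ?thesis by (rule red_cong)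
  next
    case False
    then obtain t r where tr: "mset xs = mset (t @ r)" "length t = d"
        "\<And>a b. a < b \<Longrightarrow> b < d \<Longrightarrow> t ! b + int C \<le> t ! a" "\<And>j. j < d \<Longrightarrow> int C \<le> t ! j"
      using spread_subword[OF 1(2) assms(2), of d] by (metis not_le)
    have r: "set r \<subseteq> {0<..}" using mset_eq_setD[OF tr(1)] 1(2) by auto
    have "word xs - word (t @ r) \<in> reducible_to (smaller (Suc d) xs)"
      using pos.reorder[OF 1(2) tr(1)] short red_mono by blast
    moreover have "word (t @ r) \<in> reducible_to (smaller (Suc d) xs)"
    proof -
      have "word [] * word t * word r \<in> reducible_to (smaller (Suc d) (t @ r))"
        using spread[OF tr(2-4)] r by (intro red_sandwich) (auto intro: smaller_append)
      then show ?thesis unfolding smaller_mset[OF tr(1)] by (simp add: word_Nil word_append)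
    qed
    ultimately have "word xs \<in> reducible_to (smaller (Suc d) xs)" by (rule red_cong)
    then show ?thesis by (rule red_trans) (rule IH)
  qed
qed

text \<open>
  A single element of \<open>J\<close> provides the spread words that reduce, hence the bound, for the positive
  words alone, even if its own letters are not positive.
\<close>

lemma positive_growth:
  assumes "p \<in> J"
    and "\<And>w. w \<in> supp p \<Longrightarrow> set (letters w) \<subseteq> D \<and> sum_list (letters w) \<le> W"
    and "inj_on (\<lambda>w. mset (letters w)) (supp p)"
    and "\<And>w. w \<in> supp p \<Longrightarrow> sum_list (letters w) < W \<Longrightarrow> set (letters w) \<subseteq> {0<..}"
    and "\<exists>w\<in>supp p. sum_list (letters w) = W"
  shows "\<exists>K. \<forall>n. \<exists>S. finite S \<and> card S \<le> (n + 1) ^ K \<and>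
    (\<forall>xs. set xs \<subseteq> {0<..} \<longrightarrow> sum_list xs \<le> int n \<longrightarrow> word xs \<in> PM.span (J \<union> S))"
proof -
  have "\<exists>C d. \<forall>t. length t = d \<longrightarrow> (\<forall>a b. a < b \<and> b < d \<longrightarrow> t ! b + C \<le> t ! a) \<longrightarrow> (\<forall>j<d. C \<le> t ! j)
      \<longrightarrow> word t \<in> reducible_to (smaller (Suc d) t)"
    using assms by (rule spread_reducible)
  then obtain C d where
    C: "\<forall>t. length t = d \<longrightarrow> (\<forall>a b. a < b \<and> b < d \<longrightarrow> t ! b + C \<le> t ! a) \<longrightarrow> (\<forall>j<d. C \<le> t ! j)
      \<longrightarrow> word t \<in> reducible_to (smaller (Suc d) t)"
    by (elim exE)
  define C' where "C' = nat (max C 1)"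
  have C': "C \<le> int C'" "0 < C'" by (auto simp: C'_def)
  have "word t \<in> reducible_to (smaller (Suc d) t)" if t: "length t = d" "\<And>a b. a < b \<Longrightarrow> b < d \<Longrightarrow> t ! b +
      int C' \<le> t ! a"
      "\<And>j. j < d \<Longrightarrow> int C' \<le> t ! j" for t
  proof (rule C[rule_format, OF t(1)])
    show "t ! b + C \<le> t ! a" if "a < b \<and> b < d" for a b using t(2)[of a b] that C'(1) by linarith
    show "C \<le> t ! j" if "j < d" for j using t(3)[OF that] C'(1) by linarith
  qed
  then have reducible_to: "word xs \<in> reducible_to (few_letters (C' * d) (sum_list xs))" if "set xs \<subseteq>
      {0<..}" for xs
    using C'(2) that by (rule positive_reduction)
  show ?thesis
  proof (intro exI allI conjI impI)
    fix n
    show "finite (word ` few_letters (C' * d) (int n) :: 'k word_ring set)"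
      by (intro finite_imageI few_letters_bound)
    show "card (word ` few_letters (C' * d) (int n) :: 'k word_ring set) \<le> (n + 1) ^ (2 * (C' * d))"
      by (rule order_trans[OF card_image_le few_letters_bound(2)]) (rule few_letters_bound)
    fix xs :: "int list" assume xs: "set xs \<subseteq> {0<..}" "sum_list xs \<le> int n"
    have "word xs \<in> reducible_to (few_letters (C' * d) (int n))"
      by (rule red_mono[OF reducible_to[OF xs(1)]]) (use xs in \<open>auto simp: few_letters_def\<close>)
    then show "word xs \<in> PM.span (J \<union> word ` few_letters (C' * d) (int n))" by (simp add:
        reducible_to_def)
  qed
qed

end


section \<open>Growth of the words modulo a kernel\<close>

definition polynomially_spanned :: "('k::field) word_ring set \<Rightarrow> int set \<Rightarrow> bool" where
  "polynomially_spanned J D \<longleftrightarrow> (\<exists>K. \<forall>n. \<exists>S. finite S \<and> card S \<le> (n + 1) ^ K \<and>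
    (\<forall>xs. set xs \<subseteq> D \<longrightarrow> word_norm xs \<le> n \<longrightarrow> word xs \<in> PM.span (J \<union> S)))"

lemma sum_list_uminus: "sum_list (map uminus xs) = - sum_list (xs :: int list)"
  by (induction xs) auto

lemma sum_list_le_word_norm: "\<bar>sum_list xs\<bar> \<le> int (word_norm xs)"
  by (induction xs) auto

lemma lookup_word_sum:
  assumes "finite S"
  shows "coeff_at (\<Sum>w\<in>S. scale (a w) (word (letters w) :: 'x free_monoid \<Rightarrow>\<^sub>0 'k::field)) v = (if v \<in> S
      then a v else 0)"
  using assms by (simp add: lookup_sum word_def lookup_single when_def if_distrib cong: if_cong)

context vir_kernel
begin

lemma ad_zero_word:
  assumes "0 \<in> D" "set xs \<subseteq> D"
  shows "ad 0 (word xs) - scale (of_int (sum_list xs)) (word xs) \<in> J"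
proof -
  have "(\<Sum>l<length xs. scale (of_int (xs ! l - 0)) (word (xs[l := xs ! l + 0]))) =
      scale (of_int (sum_list xs)) (word xs :: 'k word_ring)"
    by (simp add: sum_list_nth PM.scale_sum_left)
  then show ?thesis
    using ad_word[of 0 xs] assms by (simp add: vir_cocycle_def)
qed

text \<open>
  Commutation with \<open>e\<^sub>0\<close> multiplies a word by its weight.  If two weights occur in \<open>p\<close>, a combination of
  \<open>p\<close> and \<open>[e\<^sub>0, p]\<close> removes one of them and keeps the other, so an element with smallest support is
  homogeneous.
\<close>

lemma homogeneous_element:
  assumes "0 \<in> D" "p \<in> J" "p \<noteq> 0" "\<And>w. w \<in> supp p \<Longrightarrow> set (letters w) \<subseteq> D"
  shows "\<exists>q W. q \<in> J \<and> q \<noteq> 0 \<and> supp q \<subseteq> supp p \<and>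
    (\<forall>w\<in>supp q. sum_list (letters w) = W)"
  using assms(2-)
proof (induction "card (supp p)" arbitrary: p rule: less_induct)
  case less
  let ?c = "coeff_at p" and ?s = "\<lambda>w. of_int (sum_list (letters w)) :: 'k"
  let ?K = "supp p"
  obtain w1 where w1: "w1 \<in> ?K" using less(3) by (metis keys_eq_empty ex_in_conv)
  show ?case
  proof (cases "\<forall>w\<in>?K. sum_list (letters w) = sum_list (letters w1)")
    case True
    then show ?thesis using less(2,3) by blast
  next
    case False
    then obtain w2 where w2: "w2 \<in> ?K" "sum_list (letters w2) \<noteq> sum_list (letters w1)" by blast
    define q where "q = (\<Sum>w\<in>?K. scale (?c w * (?s w - ?s w1)) (word (letters w)))"
    have lq: "coeff_at q v = (if v \<in> ?K then ?c v * (?s v - ?s w1) else 0)" for v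
      unfolding q_def by (rule lookup_word_sum) simp
    have "supp q \<subseteq> ?K - {w1}"
      by (auto simp: in_keys_iff[of _ q] lq split: if_splits)
    then have sub: "supp q \<subseteq> ?K" and card: "card (supp q) < card ?K"
      using w1 psubset_card_mono[of ?K "supp q"] by auto
    have "coeff_at q w2 \<noteq> 0"
      using w2 by (simp add: lq in_keys_iff)
    then have q0: "q \<noteq> 0" by auto
    have ad_p: "ad 0 p = (\<Sum>w\<in>?K. scale (?c w) (ad 0 (word (letters w))))"
      by (subst (1) expand_words) (simp add: ad_sum ad_scale)
    have s_p: "scale (?s w1) p = (\<Sum>w\<in>?K. scale (?c w * ?s w1) (word (letters w)))"
      by (subst (2) expand_words) (simp add: scale_sum scale_scale mult.commute)
    have "(\<Sum>w\<in>?K. scale (?c w) (ad 0 (word (letters w)) - scale (?s w) (word (letters w)))) \<in> J"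
      using less(4) assms(1)
      by (intro PM.subspace_sum[OF subspace] PM.subspace_scale[OF subspace] ad_zero_word) auto
    then have 1: "ad 0 p - (\<Sum>w\<in>?K. scale (?c w * ?s w) (word (letters w))) \<in> J"
      by (simp add: ad_p PM.scale_right_diff_distrib sum_subtractf scale_scale)
    have 2: "ad 0 p - scale (?s w1) p \<in> J"
      using less(2) ad_J PM.subspace_diff[OF subspace] PM.subspace_scale[OF subspace] by blast
    have "q = (ad 0 p - scale (?s w1) p) - (ad 0 p - (\<Sum>w\<in>?K. scale (?c w * ?s w) (word (letters w))))"
      unfolding q_def s_p by (simp add: right_diff_distrib PM.scale_left_diff_distrib sum_subtractf)
    then have qJ: "q \<in> J" using PM.subspace_diff[OF subspace 2 1] by simp
    obtain q' W where "q' \<in> J" "q' \<noteq> 0" "supp q' \<subseteq> supp q"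
        "\<forall>w\<in>supp q'. sum_list (letters w) = W"
      using less(1)[OF card qJ q0] less(4) sub by blast
    then show ?thesis using sub by blast
  qed
qed

lemma span_sandwich:
  assumes "x \<in> PM.span (J \<union> A)" "y \<in> PM.span (J \<union> B)" "\<And>a b. a \<in> A \<Longrightarrow> b \<in> B \<Longrightarrow> a * m * b \<in> C"
  shows "x * m * y \<in> PM.span (J \<union> C)"
  using assms(1)
proof (induction rule: PM.span_induct_alt)
  case base
  then show ?case by (simp add: PM.span_zero)
next
  case (step c x x')
  have "x * m * y \<in> PM.span (J \<union> C)"
  proof (cases "x \<in> J")
    case True
    then show ?thesis by (intro PM.span_base UnI1 mult_right)
  next
    case False
    then have xA: "x \<in> A" using step(1) by simp
    show ?thesis
      using assms(2)
    proof (induction rule: PM.span_induct_alt)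
      case base
      then show ?case by (simp add: PM.span_zero)
    next
      case (step c y y')
      have "x * m * y \<in> J \<union> C" using step(1) mult_left assms(3)[OF xA] by blast
      then have "scale c (x * m * y) + x * m * y' \<in> PM.span (J \<union> C)"
        using step(2) by (intro PM.span_add PM.span_scale[OF PM.span_base])
      then show ?case by (simp add: scale_mult_right distrib_left)
    qed
  qed
  then have "scale c (x * m * y) + x' * m * y \<in> PM.span (J \<union> C)"
    using step(2) by (intro PM.span_add PM.span_scale)
  then show ?case by (simp add: scale_mult_left distrib_right)
qed

end

section \<open>The reflection of the Virasoro algebra\<close>

text \<open>
  The automorphism \<open>e\<^sub>i \<mapsto> - e\<^sub>-\<^sub>i\<close>, which changes the sign of the level.
\<close>

definition flip :: "('k::field) word_ring \<Rightarrow> 'k word_ring" where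
  "flip = free_hom (\<lambda>i. scale (-1) (word [- i]))"

lemma lift_one: "free_hom g 1 = 1"
  using lift_word[of g "[]"] by (simp add: word_Nil)

lemma flip_word: "(flip (word xs) :: ('k::field) word_ring) = scale ((-1) ^ length xs) (word (map uminus
    xs))"
proof (induction xs)
  case Nil
  show ?case by (simp add: flip_def lift_one word_Nil map_ident)
next
  case (Cons x xs)
  have "flip (word (x # xs)) = scale (-1) (word [- x]) * (flip (word xs) :: 'k word_ring)"
    unfolding flip_def lift_word by (simp only: list.map prod_list.Cons)
  also have "\<dots> = scale (- 1 * (- 1) ^ length xs) (word ([- x] @ map uminus xs))"
    unfolding Cons scale_mult_left scale_mult_right scale_scale word_append
    by (simp only: mult.commute[of _ "- 1"])
  finally show ?case by (simp only: append_Cons append_Nil list.map length_Cons power_Suc)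
qed

lemma flip_add: "flip (p + q) = flip p + flip q"
  by (simp add: flip_def free_hom_def lin_add)

lemma flip_diff: "flip (p - q) = flip p - flip q"
  by (simp add: flip_def free_hom_def lin_diff)

lemma flip_scale: "flip (scale a p) = scale a (flip p)"
  by (simp add: flip_def free_hom_def lin_scale)

lemma flip_mult: "flip (p * q) = flip p * flip q"
  by (simp add: flip_def lift_mult)

lemma flip_zero: "flip 0 = 0"
  by (simp add: flip_def free_hom_def)

lemma flip_flip: "flip (flip p) = p"
proof (induction p rule: word_induct)
  case (word xs)
  have "(-1) ^ length xs * (-1) ^ length xs = (1 :: 'a)" by (simp flip: power_mult_distrib)
  then show ?case by (simp only: flip_word flip_scale scale_scale length_map map_map) (simp add:
      comp_def map_ident)
qed (simp_all add: flip_zero flip_add flip_scale)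

lemma keys_flip:
  assumes "v \<in> supp (flip p)"
  shows "\<exists>w\<in>supp p. v = Free_Monoid (map uminus (letters w))"
proof -
  have F: "flip p = (\<Sum>w\<in>supp p. scale (coeff_at p w) (flip (word (letters w))))"
    unfolding flip_def free_hom_def linear_extension_def[of _ p] lin_word by simp
  have "v \<in> (\<Union>w\<in>supp p. supp (scale (coeff_at p w) (flip (word (letters w)))))"
    using assms unfolding F by (rule subsetD[OF keys_sum])
  then obtain w where w: "w \<in> supp p"
      "v \<in> supp (scale (coeff_at p w) (flip (word (letters w))))" by blast
  from w(2) have "v \<in> supp (word (map uminus (letters w)) :: 'a word_ring)"
    unfolding flip_word scale_scale by (rule subsetD[OF keys_scale_subset])
  then show ?thesis using w(1) by (auto simp: keys_word)
qed

lemma vir_cocycle_flip: "vir_cocycle \<kappa> (- i) (- j) = vir_cocycle (- \<kappa>) i j"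
proof -
  have "(- i) ^ 3 - (- i) = - (i ^ 3 - i)" by simp
  then have "of_int ((- i) ^ 3 - (- i)) = - (of_int (i ^ 3 - i) :: 'a)" by (simp only: of_int_minus)
  moreover have "- i + - j = 0 \<longleftrightarrow> i + j = 0" by auto
  ultimately show ?thesis unfolding vir_cocycle_def by (simp add: right_diff_distrib)
qed

lemma flip_vir_bracket: "flip (vir_bracket (- \<kappa>) i j) = vir_bracket \<kappa> (- i) (- j)"
proof -
  have 1: "flip 1 = (1 :: 'a word_ring)" by (simp add: flip_def lift_one)
  have "of_int (j - i) * - 1 = (of_int (- j - - i) :: 'a)" by simp
  then show ?thesis
    unfolding vir_bracket_def flip_add flip_scale flip_word vir_cocycle_flip 1 scale_scale
    by (simp only: length_Cons list.size(3) power_Suc power_0 mult_1_right list.map minus_add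
        add.commute)
qed

lemma flip_kernel:
  assumes "vir_kernel \<kappa> J UNIV"
  shows "vir_kernel (- \<kappa>) {p. flip p \<in> J} UNIV"
proof -
  interpret vir_kernel \<kappa> J UNIV by fact
  show ?thesis
  proof unfold_locales
    show "PM.subspace {p. flip p \<in> J}"
      using PM.subspace_0[OF subspace] PM.subspace_add[OF subspace] PM.subspace_scale[OF subspace]
      by (intro PM.subspaceI) (simp_all add: flip_zero flip_add flip_scale)
    fix i j :: int
    have "flip (word [i] * word [j] - word [j] * word [i] - vir_bracket (- \<kappa>) i j)
      = word [- i] * word [- j] - word [- j] * word [- i] - vir_bracket \<kappa> (- i) (- j)"
      by (simp add: flip_diff flip_mult flip_vir_bracket flip_word scale_mult_left scale_mult_right
          scale_scale map_ident)
    then show "word [i] * word [j] - word [j] * word [i] - vir_bracket (- \<kappa>) i j \<in> {p. flip p \<in> J}"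
      using relation[of "- i" "- j"] by simp
  qed (simp_all add: flip_mult mult_left mult_right)
qed

lemma flip_span:
  assumes "x \<in> PM.span ({p. flip p \<in> J} \<union> S)"
  shows "flip x \<in> PM.span (J \<union> flip ` S)"
  using assms
proof (induction rule: PM.span_induct_alt)
  case (step c x y)
  have "flip x \<in> J \<union> flip ` S" using step(1) by auto
  then show ?case unfolding flip_add flip_scale
    using step(2) by (intro PM.span_add PM.span_scale[OF PM.span_base])
qed (simp add: flip_zero PM.span_zero)

text \<open>
  The positive Witt algebra has no \<open>e\<^sub>0\<close>, so \<open>p\<close> cannot be made homogeneous; but all its words are
  positive, and the part of highest weight is enough.
\<close>

theorem positive_polynomially_spanned:
  fixes p :: "('k::field_char_0) word_ring"
  assumes "vir_kernel \<kappa> J {0<..}" "p \<in> J" "p \<noteq> 0"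
    and "\<And>w. w \<in> supp p \<Longrightarrow> set (letters w) \<subseteq> {0<..}"
    and "inj_on (\<lambda>w. mset (letters w)) (supp p)"
  shows "polynomially_spanned J {0<..}"
proof -
  interpret vir_kernel \<kappa> J "{0<..}" by fact
  let ?M = "(\<lambda>w. sum_list (letters w)) ` supp p"
  have ne: "?M \<noteq> {}" using assms(3) by simp
  have "Max ?M \<in> ?M" using ne by (intro Max_in) auto
  then have top: "\<exists>w\<in>supp p. sum_list (letters w) = Max ?M" by auto
  have "set (letters w) \<subseteq> {0<..} \<and> sum_list (letters w) \<le> Max ?M" if "w \<in> supp p" for w
    using assms(4) that by (intro conjI Max_ge) auto
  from positive_growth[OF assms(2) this assms(5,4) top]
  obtain K where K: "\<And>n. \<exists>S. finite S \<and> card S \<le> (n + 1) ^ K \<and>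
    (\<forall>xs. set xs \<subseteq> {0<..} \<longrightarrow> sum_list xs \<le> int n \<longrightarrow> word xs \<in> PM.span (J \<union> S))" by auto
  have "sum_list xs \<le> int n" if "word_norm xs \<le> n" for xs n
    using sum_list_le_word_norm[of xs] that by linarith
  then show ?thesis unfolding polynomially_spanned_def using K by meson
qed

text \<open>
  A homogeneous element of \<open>J\<close> bounds the positive words modulo \<open>J\<close>, and its reflection bounds the
  negative ones.  Sorting a word does not increase its norm and splits it into a negative word, a
  power of the letter 0 and a positive word, whence the product of the three bounds.
\<close>

theorem full_polynomially_spanned:
  fixes p :: "('k::field_char_0) word_ring"
  assumes "vir_kernel \<kappa> J UNIV" "p \<in> J" "p \<noteq> 0"
    and "inj_on (\<lambda>w. mset (letters w)) (supp p)"
  shows "polynomially_spanned J UNIV"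
proof -
  interpret vir_kernel \<kappa> J UNIV by fact
  let ?J' = "{p. flip p \<in> J}"
  interpret neg: vir_kernel "- \<kappa>" ?J' UNIV by (rule flip_kernel[OF assms(1)])
  obtain q W where q: "q \<in> J" "q \<noteq> 0" "supp q \<subseteq> supp p"
      "\<forall>w\<in>supp q. sum_list (letters w) = W"
    using homogeneous_element[OF _ assms(2,3)] by auto
  have neq: "\<exists>w. w \<in> supp q" using q(2) by (metis ex_in_conv keys_eq_empty)
  have injq: "inj_on (\<lambda>w. mset (letters w)) (supp q)"
    by (rule inj_on_subset[OF assms(4) q(3)])
  have "\<exists>K. \<forall>n. \<exists>S. finite S \<and> card S \<le> (n + 1) ^ K \<and>
    (\<forall>xs. set xs \<subseteq> {0<..} \<longrightarrow> sum_list xs \<le> int n \<longrightarrow> word xs \<in> PM.span (J \<union> S))"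
    by (rule positive_growth[OF q(1) _ injq, of W]) (use q neq in auto)
  then obtain K1 where K1: "\<And>n. \<exists>S. finite S \<and> card S \<le> (n + 1) ^ K1 \<and>
    (\<forall>xs. set xs \<subseteq> {0<..} \<longrightarrow> sum_list xs \<le> int n \<longrightarrow> word xs \<in> PM.span (J \<union> S))" by auto
  have fq: "flip q \<in> ?J'" "flip q \<noteq> 0" using q(1,2) flip_flip[of q] by (auto simp: flip_zero)
  have nef: "\<exists>w. w \<in> supp (flip q)" using fq(2) by (metis ex_in_conv keys_eq_empty)
  have sumf: "sum_list (letters v) = - W" if v: "v \<in> supp (flip q)" for v
    using keys_flip[OF v] q(4) by (auto simp: sum_list_uminus)
  have injf: "inj_on (\<lambda>w. mset (letters w)) (supp (flip q))"
  proof (rule inj_onI)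
    fix u v assume "u \<in> supp (flip q)" "v \<in> supp (flip q)"
      and m: "mset (letters u) = mset (letters v)"
    then obtain u' v' where uv: "u' \<in> supp q" "v' \<in> supp q"
      "u = Free_Monoid (map uminus (letters u'))" "v = Free_Monoid (map uminus (letters v'))"
      using keys_flip by meson
    then have "image_mset uminus (mset (letters u')) = image_mset uminus (mset (letters v'))" using m by
        simp
    then have "image_mset uminus (image_mset uminus (mset (letters u'))) = image_mset uminus (image_mset
        uminus (mset (letters v')))"
      by simp
    then have "mset (letters u') = mset (letters v')" by (simp add: image_mset.compositionality
        comp_def)
    then show "u = v" using inj_onD[OF injq _ uv(1,2)] uv(3,4) by simp
  qed
  have "\<exists>K. \<forall>n. \<exists>S. finite S \<and> card S \<le> (n + 1) ^ K \<and>
    (\<forall>xs. set xs \<subseteq> {0<..} \<longrightarrow> sum_list xs \<le> int n \<longrightarrow> word xs \<in> PM.span (?J' \<union> S))"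
    by (rule neg.positive_growth[OF fq(1) _ injf, of "- W"]) (use sumf nef in auto)
  then obtain K2 where K2: "\<And>n. \<exists>S. finite S \<and> card S \<le> (n + 1) ^ K2 \<and>
    (\<forall>xs. set xs \<subseteq> {0<..} \<longrightarrow> sum_list xs \<le> int n \<longrightarrow> word xs \<in> PM.span (?J' \<union> S))" by auto
  have "\<exists>S. finite S \<and> card S \<le> (n + 1) ^ (K2 + 1 + K1) \<and>
    (\<forall>xs. set xs \<subseteq> UNIV \<longrightarrow> word_norm xs \<le> n \<longrightarrow> word xs \<in> PM.span (J \<union> S))" for n
  proof -
    obtain S1 where S1: "finite S1" "card S1 \<le> (n + 1) ^ K1"
      "\<And>xs. set xs \<subseteq> {0<..} \<Longrightarrow> sum_list xs \<le> int n \<Longrightarrow> word xs \<in> PM.span (J \<union> S1)"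
      using K1[of n] by blast
    obtain S2 where S2: "finite S2" "card S2 \<le> (n + 1) ^ K2"
      "\<And>xs. set xs \<subseteq> {0<..} \<Longrightarrow> sum_list xs \<le> int n \<Longrightarrow> word xs \<in> PM.span (?J' \<union> S2)"
      using K2[of n] by blast
    define f where "f = (\<lambda>(a, k, b). flip a * word (replicate k 0) * b :: 'k word_ring)"
    define S where "S = f ` (S2 \<times> {0..n} \<times> S1)"
    have fin: "finite (S2 \<times> {0..n} \<times> S1)" using S1(1) S2(1) by simp
    have "card S \<le> card (S2 \<times> {0..n} \<times> S1)" unfolding S_def by (rule card_image_le[OF fin])
    also have "\<dots> = card S2 * ((n + 1) * card S1)" by (simp add: card_cartesian_product)
    also have "\<dots> \<le> (n + 1) ^ K2 * ((n + 1) * (n + 1) ^ K1)"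
      using S1(2) S2(2) by (intro mult_mono) auto
    also have "\<dots> = (n + 1) ^ (K2 + 1 + K1)" by (simp only: power_add power_one_right mult.assoc)
    finally have card: "card S \<le> (n + 1) ^ (K2 + 1 + K1)" .
    have "word xs \<in> PM.span (J \<union> S)" if xs: "word_norm xs \<le> n" for xs
    proof -
      have sorted: "word zs \<in> PM.span (J \<union> S)" if zs: "sorted zs" "word_norm zs \<le> n" for zs
      proof -
        define a b k where "a = filter (\<lambda>i. i < 0) zs" and "b = filter (\<lambda>i. 0 < i) zs"
          and "k = count (mset zs) 0"
        have "mset zs = mset (a @ replicate k 0 @ b)"
        proof (rule multiset_eqI)
          fix i :: int
          have c: "count (mset (filter P zs)) i = (if P i then count (mset zs) i else 0)" for P by simp
          consider "i < 0" | "i = 0" | "0 < i" by linarith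
          then show "count (mset zs) i = count (mset (a @ replicate k 0 @ b)) i"
            by cases (simp_all add: a_def b_def k_def)
        qed
        moreover have "sorted (a @ replicate k 0 @ b)"
          using zs(1) by (auto simp: sorted_append a_def b_def sorted_filter[of id, simplified])
        ultimately have zs_eq: "zs = a @ replicate k 0 @ b" using zs(1) by (intro sorted_mset_unique)
        have norms: "word_norm a \<le> n" "word_norm b \<le> n" "k \<le> n"
        proof -
          have "k \<le> word_norm (replicate k 0)" by (induction k) auto
          moreover have "word_norm a + word_norm (replicate k 0) + word_norm b \<le> n"
            using zs(2) zs_eq by (metis word_norm_append add.assoc)
          ultimately show "word_norm a \<le> n" "word_norm b \<le> n" "k \<le> n" by linarith+
        qed
        have b: "word b \<in> PM.span (J \<union> S1)"
          using sum_list_le_word_norm[of b] norms(2) by (intro S1(3)) (auto simp: b_def)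
        have "word (map uminus a) \<in> PM.span (?J' \<union> S2)"
          using sum_list_le_word_norm[of a] norms(1)
          by (intro S2(3)) (auto simp: a_def sum_list_uminus)
        from flip_span[OF this] have "scale ((-1) ^ length a) (flip (word (map uminus a))) \<in> PM.span (J
            \<union> flip ` S2)"
          by (rule PM.span_scale)
        moreover have "scale ((-1) ^ length a) (flip (word (map uminus a))) = (word a :: 'k word_ring)"
          by (simp add: flip_word scale_scale comp_def map_ident flip: power_mult_distrib)
        ultimately have "word a \<in> PM.span (J \<union> flip ` S2)" by simp
        then have "word a * word (replicate k 0) * word b \<in> PM.span (J \<union> S)"
          using b
        proof (rule span_sandwich)
          fix x y assume "x \<in> flip ` S2" "y \<in> S1"
          then obtain x' where "x' \<in> S2" "x = flip x'" by blast
          then have "f (x', k, y) \<in> S" using \<open>y \<in> S1\<close> norms(3) unfolding S_def by (intro imageI) simp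
          then show "x * word (replicate k 0) * y \<in> S" by (simp add: f_def \<open>x = flip x'\<close>)
        qed
        then show ?thesis by (subst zs_eq) (simp add: word_append mult.assoc)
      qed
      have "word xs \<in> reducible_to {zs. sorted zs \<and> set zs \<subseteq> UNIV \<and> sum_list zs = sum_list xs \<and>
          word_norm zs \<le> word_norm xs}"
        by (rule red_sorted) simp
      moreover have "PM.span (J \<union> word ` {zs. sorted zs \<and> set zs \<subseteq> UNIV \<and> sum_list zs = sum_list xs \<and>
          word_norm zs \<le> word_norm xs})
          \<subseteq> PM.span (J \<union> S)"
        using sorted xs by (intro PM.span_minimal) (auto intro: PM.span_base)
      ultimately show ?thesis by (auto simp: reducible_to_def)
    qed
    then show ?thesis using card fin by (auto simp: S_def)
  qed
  then show ?thesis unfolding polynomially_spanned_def by blast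
qed


section \<open>Dimensions\<close>

text \<open>
  A subspace of a space with a finite generating set is itself finite-dimensional, because linearly
  independent sets are bounded in size and a maximal one is a basis.
\<close>

lemma (in vectorspace) subspace_of_span:
  assumes W: "submodule K W V" and T: "finite T" "T \<subseteq> carrier V" "W \<subseteq> span T"
  shows "vectorspace.fin_dim K (vs W)" "vectorspace.dim K (vs W) \<le> card T"
proof -
  have S: "submodule K (span T) V" by (rule span_is_submodule[OF T(2)])
  interpret W: vectorspace K "vs W"
    using W vectorspace_axioms by (intro subspace_is_vs) (simp add: subspace_def)
  interpret S: vectorspace K "vs (span T)"
    using S vectorspace_axioms by (intro subspace_is_vs) (simp add: subspace_def)
  have TS: "T \<subseteq> span T" by (rule in_own_span[OF T(2)])
  have genT: "S.gen_set T" using span_li_not_depend(1)[OF TS S] by simp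
  have fdS: "S.fin_dim" unfolding S.fin_dim_def using T(1) TS genT by auto
  have bound: "finite A \<and> card A \<le> card T" if A: "A \<subseteq> W \<and> W.lin_indpt A" for A
  proof -
    have AS: "A \<subseteq> span T" using A T(3) by blast
    have "W.lin_dep A = lin_dep A" by (rule span_li_not_depend(2)) (use A W in auto)
    moreover have "S.lin_dep A = lin_dep A" by (rule span_li_not_depend(2)[OF AS S])
    ultimately have li: "S.lin_indpt A" using A by simp
    have fin: "finite A" by (rule S.fin_dim_li_fin[OF fdS li]) (use AS in simp)
    show ?thesis using S.li_smaller_than_gen[OF fin T(1) _ _ li genT] AS TS fin by simp
  qed
  have "W.lin_indpt {}" unfolding W.lin_dep_def by auto
  then obtain A where A: "finite A" "maximal A (\<lambda>A. A \<subseteq> W \<and> W.lin_indpt A)"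
    using maximal_exists[of "\<lambda>A. A \<subseteq> W \<and> W.lin_indpt A" "card T" "{}"] bound by auto
  have basis: "W.basis A" by (rule W.max_li_is_basis) (use A(2) in simp)
  show "W.fin_dim" unfolding W.fin_dim_def using basis A(1) by (auto simp: W.basis_def)
  have "W.dim = card A" by (rule W.dim_basis[OF A(1) basis])
  then show "W.dim \<le> card T" using bound A(2) by (simp add: maximal_def)
qed

lemma subspace_keys: "PM.subspace {p :: 'x \<Rightarrow>\<^sub>0 'k::field. \<forall>w\<in>supp p. P w}"
proof (rule PM.subspaceI)
  show "p + q \<in> {p. \<forall>w\<in>supp p. P w}" if "p \<in> {p. \<forall>w\<in>supp p. P w}" "q \<in> {p. \<forall>w\<in>supp p. P w}" for p q ::
      "'x \<Rightarrow>\<^sub>0 'k::field"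
    using that keys_add[of p q] by auto
  show "scale c p \<in> {p. \<forall>w\<in>supp p. P w}" if "p \<in> {p. \<forall>w\<in>supp p. P w}" for c and p :: "'x \<Rightarrow>\<^sub>0 'k::field"
    using that keys_scale_subset[of c p] by auto
qed simp

lemma keys_times_words:
  fixes p q :: "('k::field) word_ring"
  assumes "v \<in> supp (p * q)"
  shows "\<exists>u\<in>supp p. \<exists>w\<in>supp q. letters v = letters u @ letters w"
proof -
  obtain u w where "u \<in> supp p" "w \<in> supp q" "v = u + w"
    using subsetD[OF keys_mult assms] by blast
  then show ?thesis by (intro bexI[of _ u] bexI[of _ w]) (simp_all add: plus_free_monoid_def)
qed

lemma words_span:
  fixes p :: "('k::field) word_ring"
  assumes "\<And>w. w \<in> supp p \<Longrightarrow> word (letters w) \<in> PM.span S"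
  shows "p \<in> PM.span S"
  by (subst expand_words) (intro PM.span_sum PM.span_scale assms)

text \<open>
  A homomorphism from the ring of words to an algebra that is given by a carrier; a word algebra is
  the image of the words with letters in \<open>D\<close>.
\<close>

locale word_hom = assoc_algebra "class_ring :: 'k::field_char_0 ring" A for A :: "('k::field_char_0, 'b)
    module" (structure) +
  fixes \<pi> :: "'k word_ring \<Rightarrow> 'b"
  assumes hom_closed: "\<pi> p \<in> carrier A"
    and hom_add: "\<pi> (p + q) = \<pi> p \<oplus> \<pi> q"
    and hom_scale: "\<pi> (scale a p) = a \<odot> \<pi> p"
    and hom_mult: "\<pi> (p * q) = \<pi> p \<otimes> \<pi> q"
    and hom_one: "\<pi> 1 = \<one>"

locale word_algebra = word_hom A \<pi> for A :: "('k::field_char_0, 'b) module" (structure) and \<pi> +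
  fixes D :: "int set"
  assumes hom_onto: "x \<in> carrier A \<Longrightarrow> \<exists>p. x = \<pi> p \<and> (\<forall>w\<in>supp p. set (letters w) \<subseteq> D)"
begin

definition ker :: "'k word_ring set" where
  "ker = {p. \<pi> p = \<zero>}"

lemma hom_zero: "\<pi> 0 = \<zero>"
proof -
  have "\<pi> 0 \<oplus> \<pi> 0 = \<pi> 0" by (simp flip: hom_add)
  then show ?thesis by (simp add: hom_closed)
qed

lemma hom_diff: "\<pi> (p - q) = \<pi> p \<ominus> \<pi> q"
proof -
  have "\<pi> (p - q) \<oplus> \<pi> q = \<pi> p" by (simp flip: hom_add)
  then show ?thesis by (metis M.minus_eq M.add.inv_solve_right hom_closed)
qed

lemma hom_sum: "finite S \<Longrightarrow> \<pi> (\<Sum>s\<in>S. f s) = (\<Oplus>s\<in>S. \<pi> (f s))"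
  by (induction S rule: finite_induct) (simp_all add: hom_zero hom_add hom_closed)

lemma submodule_image:
  assumes "PM.subspace F"
  shows "submodule class_ring (\<pi> ` F) A"
proof (rule submodule.intro)
  show "\<zero> \<in> \<pi> ` F" using PM.subspace_0[OF assms] hom_zero by (metis imageI)
  show "v \<oplus> u \<in> \<pi> ` F" if "v \<in> \<pi> ` F" "u \<in> \<pi> ` F" for v u
    using that PM.subspace_add[OF assms] by (auto simp flip: hom_add)
  show "c \<odot> v \<in> \<pi> ` F" if "v \<in> \<pi> ` F" for c v
    using that PM.subspace_scale[OF assms] by (auto simp flip: hom_scale)
qed (auto simp: hom_closed module_axioms)

lemma hom_span:
  assumes "p \<in> PM.span (ker \<union> S)"
  shows "\<pi> p \<in> span (\<pi> ` S)"
proof -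
  have sub: "submodule class_ring (span (\<pi> ` S)) A" by (rule span_is_submodule) (auto simp: hom_closed)
  have own: "\<pi> ` S \<subseteq> span (\<pi> ` S)" by (rule in_own_span) (auto simp: hom_closed)
  show ?thesis
    using assms
  proof (induction rule: PM.span_induct_alt)
    case base
    show ?case using submodule.zero_closed[OF sub] by (simp add: hom_zero)
  next
    case (step c x y)
    have "\<pi> x \<in> span (\<pi> ` S)"
      using step(1) own submodule.zero_closed[OF sub] by (auto simp: ker_def)
    then show ?case unfolding hom_add hom_scale
      using step(2) submodule.m_closed[OF sub] submodule.smult_closed[OF sub] by simp
  qed
qed

lemma subspace_power_image:
  assumes F: "\<And>n. PM.subspace (F n)" "1 \<in> F 0" "\<And>n p q. p \<in> F n \<Longrightarrow> q \<in> U \<Longrightarrow> p * q \<in> F (Suc n)"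
    and V: "V \<subseteq> \<pi> ` U"
  shows "subspace_power A V n \<subseteq> \<pi> ` F n"
proof (induction n)
  case 0
  have "\<one> \<in> \<pi> ` F 0" using F(2) by (auto simp flip: hom_one)
  then show ?case unfolding subspace_power.simps by (intro span_is_subset submodule_image F) simp
next
  case (Suc n)
  have "{x \<otimes> y |x y. x \<in> subspace_power A V n \<and> y \<in> V} \<subseteq> \<pi> ` F (Suc n)"
  proof clarify
    fix x y assume "x \<in> subspace_power A V n" "y \<in> V"
    then obtain p q where "p \<in> F n" "q \<in> U" "x = \<pi> p" "y = \<pi> q" using Suc V by blast
    then show "x \<otimes> y \<in> \<pi> ` F (Suc n)" using F(3) by (auto simp flip: hom_mult)
  qed
  then show ?case unfolding subspace_power.simps by (intro span_is_subset submodule_image F)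
qed

lemma subspace_power_submodule:
  assumes "V \<subseteq> carrier A"
  shows "submodule class_ring (subspace_power A V n) A"
proof (induction n)
  case 0
  show ?case unfolding subspace_power.simps by (rule span_is_submodule) simp
next
  case (Suc n)
  have "subspace_power A V n \<subseteq> carrier A" using submodule.subset[OF Suc] .
  then show ?case unfolding subspace_power.simps using assms by (intro span_is_submodule) auto
qed

definition bounded_words :: "nat \<Rightarrow> 'k word_ring set" where
  "bounded_words n = {p. \<forall>w\<in>supp p. set (letters w) \<subseteq> D \<and> word_norm (letters w) \<le> n}"

text \<open>
  A finite-dimensional subspace lies in the image of the words of norm at most \<open>m\<close> for some \<open>m\<close>, so its
  \<open>n\<close>-th power lies in the image of the words of norm at most \<open>m * n\<close>.
\<close>

lemma polynomial_growthI:
  assumes "polynomially_spanned ker D"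
  shows "polynomial_growth A"
proof -
  obtain K where K: "\<And>n. \<exists>S. finite S \<and> card S \<le> (n + 1) ^ K \<and>
    (\<forall>xs. set xs \<subseteq> D \<longrightarrow> word_norm xs \<le> n \<longrightarrow> word xs \<in> PM.span (ker \<union> S))"
    using assms unfolding polynomially_spanned_def by blast
  have "limsup (\<lambda>n. ereal (ln (real (vectorspace.dim class_ring (A\<lparr>carrier := subspace_power A V n\<rparr>))) /
      ln (real n)))
      \<le> ereal (2 * real K)"
    if V: "subspace class_ring V A" "vectorspace.fin_dim class_ring (A\<lparr>carrier := V\<rparr>)" for V
  proof -
    have subV: "submodule class_ring V A" using V(1) by simp
    have Vc: "V \<subseteq> carrier A" by (rule submodule.subset[OF subV])
    interpret V: vectorspace class_ring "vs V" by (rule subspace_is_vs[OF V(1)])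
    obtain B where B: "finite B" "B \<subseteq> V" "V.span B = V"
      using V(2) unfolding V.fin_dim_def by auto
    then have spanB: "span B = V" using span_li_not_depend(1)[OF B(2) subV] by simp
    have "\<exists>m. b \<in> \<pi> ` bounded_words m" if "b \<in> B" for b
    proof -
      have "b \<in> carrier A" using that B(2) Vc by auto
      then obtain p where p: "b = \<pi> p" "\<forall>w\<in>supp p. set (letters w) \<subseteq> D"
        using hom_onto[of b] by auto
      have "word_norm (letters w) \<le> (\<Sum>w\<in>supp p. word_norm (letters w))" if "w \<in> supp p" for w
        using that by (intro member_le_sum) auto
      then show ?thesis using p unfolding bounded_words_def by blast
    qed
    then obtain g where g: "\<And>b. b \<in> B \<Longrightarrow> b \<in> \<pi> ` bounded_words (g b)" by metis
    define m where "m = (\<Sum>b\<in>B. g b)"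
    have "B \<subseteq> \<pi> ` bounded_words m"
    proof
      fix b assume b: "b \<in> B"
      then have "g b \<le> m" unfolding m_def using B(1) by (intro member_le_sum) auto
      then have "bounded_words (g b) \<subseteq> bounded_words m" by (force simp: bounded_words_def)
      then show "b \<in> \<pi> ` bounded_words m" using g[OF b] by blast
    qed
    then have "span B \<subseteq> \<pi> ` bounded_words m"
      by (intro span_is_subset submodule_image) (simp_all add: bounded_words_def subspace_keys)
    then have Vm: "V \<subseteq> \<pi> ` bounded_words m" by (simp add: spanB)
    have "subspace_power A V n \<subseteq> \<pi> ` bounded_words (m * n)" for n
    proof (rule subspace_power_image[OF _ _ _ Vm])
      show "PM.subspace (bounded_words (m * n))" for n by (simp add: bounded_words_def subspace_keys)
      show "1 \<in> bounded_words (m * 0)" by (simp add: bounded_words_def zero_free_monoid_def)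
      show "p * q \<in> bounded_words (m * Suc n)" if pq: "p \<in> bounded_words (m * n)" "q \<in> bounded_words m"
          for n p q
        unfolding bounded_words_def
      proof (intro CollectI ballI)
        fix v assume "v \<in> supp (p * q)"
        then obtain u w where uw: "u \<in> supp p" "w \<in> supp q" "letters v = letters u @ letters w"
          using keys_times_words by blast
        have "set (letters u) \<subseteq> D \<and> word_norm (letters u) \<le> m * n" "set (letters w) \<subseteq> D \<and> word_norm
            (letters w) \<le> m"
          using pq uw by (auto simp: bounded_words_def)
        then show "set (letters v) \<subseteq> D \<and> word_norm (letters v) \<le> m * Suc n" unfolding uw(3) by simp
      qed
    qed
    then have dim: "vectorspace.dim class_ring (A\<lparr>carrier := subspace_power A V n\<rparr>) \<le> (m * n + 1) ^ K"
        for n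
    proof -
      obtain S where S: "finite S" "card S \<le> (m * n + 1) ^ K"
        "\<And>xs. set xs \<subseteq> D \<Longrightarrow> word_norm xs \<le> m * n \<Longrightarrow> word xs \<in> PM.span (ker \<union> S)" using K[of "m * n"] by
            blast
      have "\<pi> ` bounded_words (m * n) \<subseteq> span (\<pi> ` S)"
      proof (rule image_subsetI)
        fix p assume "p \<in> bounded_words (m * n)"
        then show "\<pi> p \<in> span (\<pi> ` S)"
          by (intro hom_span[OF words_span] S(3)) (simp_all add: bounded_words_def)
      qed
      then have "subspace_power A V n \<subseteq> span (\<pi> ` S)"
        using \<open>subspace_power A V n \<subseteq> \<pi> ` bounded_words (m * n)\<close> by (rule order_trans[rotated])
      then have "vectorspace.dim class_ring (A\<lparr>carrier := subspace_power A V n\<rparr>) \<le> card (\<pi> ` S)"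
        using S(1) by (intro subspace_of_span(2) subspace_power_submodule Vc) (auto simp: hom_closed)
      also have "\<dots> \<le> card S" by (rule card_image_le[OF S(1)])
      finally show ?thesis using S(2) by simp
    qed
    have "\<forall>\<^sub>F n in sequentially. ereal (ln (real (vectorspace.dim class_ring (A\<lparr>carrier :=
        subspace_power A V n\<rparr>))) / ln (real n))
      \<le> ereal (2 * real K)"
    proof (rule eventually_sequentiallyI)
      fix n assume n: "m + 2 \<le> n"
      define x where "x = vectorspace.dim class_ring (A\<lparr>carrier := subspace_power A V n\<rparr>)"
      have lnn: "0 < ln (real n)" using n by simp
      have "m * n + 1 \<le> (m + 1) * n" using n by simp
      also have "\<dots> \<le> n * n" using n by (intro mult_le_mono1) simp
      finally have "(m * n + 1) ^ K \<le> (n * n) ^ K" by (rule power_mono) simp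
      also have "\<dots> = n ^ (2 * K)" by (simp add: power_mult power2_eq_square)
      finally have "x \<le> n ^ (2 * K)" using dim[of n] by (simp add: x_def)
      then have xn: "real x \<le> real n ^ (2 * K)" by (metis of_nat_le_iff of_nat_power)
      have "ln (real x) \<le> real (2 * K) * ln (real n)"
      proof (cases "x = 0")
        case False
        then have "ln (real x) \<le> ln (real n ^ (2 * K))" using xn n by (subst ln_le_cancel_iff) auto
        also have "\<dots> = real (2 * K) * ln (real n)" using n by (simp add: ln_realpow)
        finally show ?thesis .
      qed (use lnn in simp)
      then show "ereal (ln (real (vectorspace.dim class_ring (A\<lparr>carrier := subspace_power A V n\<rparr>))) / ln
          (real n)) \<le> ereal (2 * real K)"
        using lnn by (simp add: x_def[symmetric] divide_le_eq)
    qed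
    then show ?thesis by (rule Limsup_bounded)
  qed
  then have "gk_dim A \<le> ereal (2 * real K)" unfolding gk_dim_def by (intro SUP_least) auto
  then show ?thesis unfolding polynomial_growth_def by (rule le_less_trans) simp
qed

text \<open>
  For the span \<open>V\<close> of the letters from 1 to \<open>r\<close> and the unit, \<open>V\<^sup>n\<close> contains the sorted words in which
  each of these letters occurs at most \<open>n div r\<close> times.  Their number exceeds \<open>(n / r)\<^sup>r\<close>, which is at
  least the power \<open>r / 2\<close> of \<open>n\<close> as soon as \<open>n \<ge> r\<^sup>2\<close>.
\<close>

lemma infinite_gkI:
  assumes indep: "\<And>p. (\<And>w. w \<in> supp p \<Longrightarrow> sorted (letters w) \<and> set (letters w) \<subseteq> {0<..}) \<Longrightarrow> \<pi> p = \<zero> \<Longrightarrow> p =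
      0"
  shows "gk_dim A = \<infinity>"
proof -
  have lower: "ereal (real r / 2) \<le> gk_dim A" if r: "1 \<le> r" for r :: nat
  proof -
    define G where "G = insert 1 ((\<lambda>i. word [i]) ` {1..int r} :: 'k word_ring set)"
    define V where "V = span (\<pi> ` G)"
    have G: "finite (\<pi> ` G)" "\<pi> ` G \<subseteq> carrier A" by (auto simp: G_def hom_closed)
    have subV: "submodule class_ring V A" unfolding V_def by (rule span_is_submodule[OF G(2)])
    have Vc: "V \<subseteq> carrier A" by (rule submodule.subset[OF subV])
    have GV: "\<pi> ` G \<subseteq> V" unfolding V_def by (rule in_own_span[OF G(2)])
    have oneV: "\<one> \<in> V" using GV hom_one by (auto simp: G_def)
    have letV: "\<pi> (word [x]) \<in> V" if "x \<in> {1..int r}" for x using GV that by (auto simp: G_def)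
    have fdV: "vectorspace.fin_dim class_ring (A\<lparr>carrier := V\<rparr>)"
      by (rule subspace_of_span(1)[OF subV G]) (simp add: V_def)
    have subspV: "subspace class_ring V A" using subV vectorspace_axioms by (simp add: subspace_def)
    let ?P = "subspace_power A V"
    have subP: "submodule class_ring (?P n) A" for n by (rule subspace_power_submodule[OF Vc])
    have Pc: "?P n \<subseteq> carrier A" for n by (rule submodule.subset[OF subP])
    have prod: "x \<otimes> y \<in> ?P (Suc n)" if "x \<in> ?P n" "y \<in> V" for x y n
    proof -
      have "{x \<otimes> y |x y. x \<in> ?P n \<and> y \<in> V} \<subseteq> carrier A" using Pc Vc by auto
      from in_own_span[OF this] show ?thesis using that by auto
    qed
    have wordP: "\<pi> (word xs) \<in> ?P n" if "set xs \<subseteq> {1..int r}" "length xs \<le> n" for xs n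
      using that
    proof (induction n arbitrary: xs)
      case 0
      then show ?case using in_own_span[of "{\<one>}"] by (auto simp: word_Nil hom_one)
    next
      case (Suc n)
      show ?case
      proof (cases xs rule: rev_cases)
        case Nil
        have "\<pi> (word []) \<otimes> \<one> \<in> ?P (Suc n)" by (rule prod[OF Suc.IH oneV]) auto
        then show ?thesis using Nil by (simp add: hom_closed)
      next
        case (snoc ys y)
        have "\<pi> (word ys) \<otimes> \<pi> (word [y]) \<in> ?P (Suc n)"
          by (rule prod[OF Suc.IH letV]) (use Suc.prems snoc in auto)
        then show ?thesis by (simp add: snoc word_append hom_mult)
      qed
    qed
    define F where "F n = {p :: 'k word_ring. \<forall>w\<in>supp p. set (letters w) \<subseteq> {1..int r} \<and> length (letters
        w) \<le> n}" for n
    have subF: "PM.subspace (F n)" for n unfolding F_def by (rule subspace_keys)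
    have "\<pi> ` G \<subseteq> \<pi> ` F 1"
      by (rule image_mono) (auto simp: G_def F_def keys_word zero_free_monoid_def)
    then have VF: "V \<subseteq> \<pi> ` F 1" unfolding V_def by (rule span_is_subset[OF _ submodule_image[OF subF]])
    have PF: "?P n \<subseteq> \<pi> ` F n" for n
    proof (rule subspace_power_image[OF subF _ _ VF])
      show "1 \<in> F 0" by (simp add: F_def zero_free_monoid_def)
      show "p * q \<in> F (Suc n)" if pq: "p \<in> F n" "q \<in> F 1" for p q n
        unfolding F_def
      proof (intro CollectI ballI)
        fix v assume "v \<in> supp (p * q)"
        then obtain u w where uw: "u \<in> supp p" "w \<in> supp q" "letters v = letters u @ letters w"
          using keys_times_words by blast
        have "set (letters u) \<subseteq> {1..int r} \<and> length (letters u) \<le> n" "set (letters w) \<subseteq> {1..int r} \<and>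
            length (letters w) \<le> 1"
          using pq uw by (auto simp: F_def)
        then show "set (letters v) \<subseteq> {1..int r} \<and> length (letters v) \<le> Suc n" unfolding uw(3) by simp
      qed
    qed
    have fdP: "vectorspace.fin_dim class_ring (A\<lparr>carrier := ?P n\<rparr>)" for n
    proof -
      let ?S = "word ` {xs. set xs \<subseteq> {1..int r} \<and> length xs \<le> n} :: 'k word_ring set"
      have "\<pi> ` F n \<subseteq> span (\<pi> ` ?S)"
      proof (rule image_subsetI)
        fix p assume "p \<in> F n"
        then show "\<pi> p \<in> span (\<pi> ` ?S)"
          by (intro hom_span[OF words_span] PM.span_base UnI2 imageI) (simp add: F_def)
      qed
      then have "?P n \<subseteq> span (\<pi> ` ?S)" using PF by (rule order_trans[rotated])
      moreover have "finite ?S" by (intro finite_imageI finite_lists_length_le) simp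
      ultimately show ?thesis by (intro subspace_of_span(1)[OF subP]) (auto simp: hom_closed)
    qed
    have dimP: "(q + 1) ^ r \<le> vectorspace.dim class_ring (A\<lparr>carrier := ?P n\<rparr>)" if rq: "r * q \<le> n" for n
        q
    proof -
      define f where "f a = sort (concat (map (\<lambda>i. replicate (a i) (int i)) [1..<Suc r]))" for a :: "nat
          \<Rightarrow> nat"
      define E where "E = ({1..r} \<rightarrow>\<^sub>E {0..q} :: (nat \<Rightarrow> nat) set)"
      have cnt: "count (mset (f a)) (int j) = a j" if "j \<in> {1..r}" for a j
      proof -
        have "count (mset (concat (map (\<lambda>i. replicate (a i) (int i)) js))) (int j) = (if j \<in> set js then
            a j else 0)"
          if "distinct js" for js
          using that by (induction js) auto
        from this[of "[1..<Suc r]"] show ?thesis using \<open>j \<in> {1..r}\<close> by (simp add: f_def del: upt_Suc)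
      qed
      have "inj_on f E"
      proof (rule inj_onI)
        fix a b assume ab: "a \<in> E" "b \<in> E" "f a = f b"
        have "a j = b j" if "j \<in> {1..r}" for j using cnt[OF that, of a] cnt[OF that, of b] ab(3) by simp
        then show "a = b" using ab(1,2) unfolding E_def by (rule PiE_ext[rotated 2])
      qed
      then have "card (f ` E) = card E" by (rule card_image)
      also have "\<dots> = (q + 1) ^ r" by (simp add: E_def card_PiE)
      finally have cardfE: "card (f ` E) = (q + 1) ^ r" .
      have finfE: "finite (f ` E)" unfolding E_def by (intro finite_imageI finite_PiE) auto
      have fE: "sorted xs \<and> set xs \<subseteq> {1..int r} \<and> length xs \<le> n" if xs: "xs \<in> f ` E" for xs
      proof -
        obtain a where a: "a \<in> E" "xs = f a" using xs by blast
        have "length xs = (\<Sum>i\<leftarrow>[1..<Suc r]. a i)" by (simp add: a f_def length_concat comp_def del: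
            upt_Suc)
        also have "\<dots> \<le> (\<Sum>i\<leftarrow>[1..<Suc r]. q)"
          using a(1) by (intro sum_list_mono) (auto simp: E_def PiE_def Pi_def)
        also have "\<dots> = r * q" by (simp add: sum_list_triv del: upt_Suc)
        finally show ?thesis using rq by (auto simp: a f_def simp del: upt_Suc)
      qed
      have injw: "inj_on (\<lambda>xs. \<pi> (word xs)) (f ` E)"
      proof (rule inj_onI)
        fix xs ys assume xy: "xs \<in> f ` E" "ys \<in> f ` E" "\<pi> (word xs) = \<pi> (word ys)"
        have "\<pi> (word xs - word ys) = \<zero>" by (simp add: hom_diff xy(3) M.minus_eq M.r_neg hom_closed)
        moreover have "sorted (letters w) \<and> set (letters w) \<subseteq> {0<..}" if "w \<in> supp (word xs - word ys ::
            'k word_ring)" for w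
        proof -
          have "w \<in> {Free_Monoid xs, Free_Monoid ys}"
            using subsetD[OF keys_diff that] by (auto simp: keys_word)
          then show ?thesis using fE[OF xy(1)] fE[OF xy(2)] by fastforce
        qed
        ultimately have "word xs - word ys = (0 :: 'k word_ring)" by (intro indep)
        then have "supp (word xs :: 'k word_ring) = supp (word ys :: 'k word_ring)" by simp
        then show "xs = ys" by (simp add: keys_word)
      qed
      let ?B = "(\<lambda>xs. \<pi> (word xs)) ` (f ` E)"
      have li: "lin_indpt ?B"
      proof (rule finite_lin_indpt2)
        show "finite ?B" using finfE by (rule finite_imageI)
        show "?B \<subseteq> carrier A" by (auto simp: hom_closed)
        fix a assume "a \<in> ?B \<rightarrow> carrier class_ring" and zero: "lincomb a ?B = \<zero>"
        define p where "p = (\<Sum>w\<in>Free_Monoid ` (f ` E). scale (a (\<pi> (word (letters w)))) (word (letters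
            w)))"
        have finM: "finite (Free_Monoid ` (f ` E))" using finfE by (rule finite_imageI)
        have "\<pi> p = (\<Oplus>w\<in>Free_Monoid ` (f ` E). a (\<pi> (word (letters w))) \<odot> \<pi> (word (letters w)))"
          unfolding p_def by (simp add: hom_sum[OF finM] hom_scale)
        also have "\<dots> = (\<Oplus>xs\<in>f ` E. a (\<pi> (word xs)) \<odot> \<pi> (word xs))"
          by (subst M.add.finprod_reindex) (auto simp: inj_on_def hom_closed)
        also have "\<dots> = lincomb a ?B"
          unfolding lincomb_def by (subst M.add.finprod_reindex[OF _ injw]) (auto simp: hom_closed)
        finally have "\<pi> p = \<zero>" using zero by simp
        have lp: "coeff_at p v = (if v \<in> Free_Monoid ` (f ` E) then a (\<pi> (word (letters v))) else 0)"
            for v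
          unfolding p_def by (rule lookup_word_sum[OF finM])
        have "p = 0"
        proof (rule indep)
          fix w assume "w \<in> supp p"
          then have "letters w \<in> f ` E" by (auto simp: in_keys_iff lp split: if_splits)
          from fE[OF this] show "sorted (letters w) \<and> set (letters w) \<subseteq> {0<..}" by auto
        qed fact
        then have "a (\<pi> (word xs)) = 0" if "xs \<in> f ` E" for xs
          using lp[of "Free_Monoid xs"] that by auto
        then show "\<forall>v\<in>?B. a v = \<zero>\<^bsub>class_ring\<^esub>" by auto
      qed
      interpret P: vectorspace class_ring "vs (?P n)"
        using subP vectorspace_axioms by (intro subspace_is_vs) (simp add: subspace_def)
      have BP: "?B \<subseteq> ?P n" using fE wordP by auto
      have "P.lin_dep ?B = lin_dep ?B" by (rule span_li_not_depend(2)[OF BP subP])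
      then have "card ?B \<le> P.dim"
        using P.li_le_dim(2)[OF fdP] BP li by simp
      then show ?thesis using card_image[OF injw] cardfE by simp
    qed
    have "\<forall>\<^sub>F n in sequentially. ereal (real r / 2) \<le> ereal (ln (real (vectorspace.dim class_ring
        (A\<lparr>carrier := ?P n\<rparr>))) / ln (real n))"
    proof (rule eventually_sequentiallyI)
      fix n assume n: "r\<^sup>2 + 2 \<le> n"
      define q where "q = n div r"
      define x where "x = vectorspace.dim class_ring (A\<lparr>carrier := ?P n\<rparr>)"
      have lnn: "0 < ln (real n)" using n by simp
      have x: "(q + 1) ^ r \<le> x" unfolding x_def by (rule dimP) (simp add: q_def)
      have "n \<le> (q + 1) * r"
        using r dividend_less_div_times[of r n] by (simp add: q_def)
      then have nn: "n * n \<le> ((q + 1) * r) * ((q + 1) * r)" by (intro mult_le_mono)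
      have "n * r\<^sup>2 \<le> n * n" using n by (intro mult_le_mono2) simp
      also note nn
      also have "((q + 1) * r) * ((q + 1) * r) = (q + 1)\<^sup>2 * r\<^sup>2" by (simp only: power2_eq_square
          ac_simps)
      finally have "n * r\<^sup>2 \<le> (q + 1)\<^sup>2 * r\<^sup>2" .
      then have "n \<le> (q + 1)\<^sup>2" using r by simp
      then have "n ^ r \<le> ((q + 1)\<^sup>2) ^ r" by (rule power_mono) simp
      also have "\<dots> = ((q + 1) ^ r)\<^sup>2" by (simp only: power_mult[symmetric] mult.commute)
      also have "\<dots> \<le> x\<^sup>2" using x by (rule power_mono) simp
      finally have "real n ^ r \<le> real x ^ 2" by (metis of_nat_le_iff of_nat_power)
      moreover have "0 < x" using x by (metis Suc_eq_plus1 gr0I le_zero_eq nat.simps(3) power_not_zero)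
      ultimately have "ln (real n ^ r) \<le> ln (real x ^ 2)" using n by (subst ln_le_cancel_iff) auto
      then have "real r * ln (real n) \<le> 2 * ln (real x)" using n \<open>0 < x\<close> by (simp add: ln_realpow)
      then show "ereal (real r / 2) \<le> ereal (ln (real (vectorspace.dim class_ring (A\<lparr>carrier := ?P n\<rparr>)))
          / ln (real n))"
        using lnn by (simp add: x_def[symmetric] le_divide_eq)
    qed
    then have "ereal (real r / 2) \<le> limsup (\<lambda>n. ereal (ln (real (vectorspace.dim class_ring (A\<lparr>carrier
        := ?P n\<rparr>))) / ln (real n)))"
      by (intro le_Limsup) simp_all
    also have "\<dots> \<le> gk_dim A"
      unfolding gk_dim_def using subspV fdV oneV by (intro SUP_upper) simp
    finally show ?thesis .
  qed
  show ?thesis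
  proof (rule ccontr)
    assume "gk_dim A \<noteq> \<infinity>"
    moreover have "ereal (real 1 / 2) \<le> gk_dim A" by (rule lower) simp
    ultimately obtain g where g: "gk_dim A = ereal g" by (cases "gk_dim A") auto
    obtain r :: nat where "2 * \<bar>g\<bar> + 2 < real r" using reals_Archimedean2 by blast
    then have r: "1 \<le> r" "2 * g < real r" by linarith+
    from lower[OF r(1)] g r(2) show False by simp
  qed
qed

end


section \<open>Quotients\<close>

lemma
  assumes "assoc_algebra K A" "ideal I A"
  shows quot_add: "x \<in> carrier A \<Longrightarrow> y \<in> carrier A \<Longrightarrow>
      (I +>\<^bsub>A\<^esub> x) \<oplus>\<^bsub>quot_algebra A I\<^esub> (I +>\<^bsub>A\<^esub> y) = I +>\<^bsub>A\<^esub> (x \<oplus>\<^bsub>A\<^esub> y)"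
    and quot_mult: "x \<in> carrier A \<Longrightarrow> y \<in> carrier A \<Longrightarrow>
      (I +>\<^bsub>A\<^esub> x) \<otimes>\<^bsub>quot_algebra A I\<^esub> (I +>\<^bsub>A\<^esub> y) = I +>\<^bsub>A\<^esub> (x \<otimes>\<^bsub>A\<^esub> y)"
    and quot_one: "\<one>\<^bsub>quot_algebra A I\<^esub> = I +>\<^bsub>A\<^esub> \<one>\<^bsub>A\<^esub>"
    and quot_zero: "\<zero>\<^bsub>quot_algebra A I\<^esub> = I"
    and quot_carrier: "X \<in> carrier (quot_algebra A I) \<longleftrightarrow> (\<exists>x\<in>carrier A. X = I +>\<^bsub>A\<^esub> x)"
    and coset_eq_ideal: "x \<in> carrier A \<Longrightarrow> I +>\<^bsub>A\<^esub> x = I \<longleftrightarrow> x \<in> I"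
proof -
  interpret assoc_algebra K A by fact
  interpret I: ideal I A by fact
  show "x \<in> carrier A \<Longrightarrow> y \<in> carrier A \<Longrightarrow>
      (I +>\<^bsub>A\<^esub> x) \<oplus>\<^bsub>quot_algebra A I\<^esub> (I +>\<^bsub>A\<^esub> y) = I +>\<^bsub>A\<^esub> (x \<oplus>\<^bsub>A\<^esub> y)"
    by (simp add: quot_algebra_def FactRing_def I.a_rcos_sum)
  show "x \<in> carrier A \<Longrightarrow> y \<in> carrier A \<Longrightarrow>
      (I +>\<^bsub>A\<^esub> x) \<otimes>\<^bsub>quot_algebra A I\<^esub> (I +>\<^bsub>A\<^esub> y) = I +>\<^bsub>A\<^esub> (x \<otimes>\<^bsub>A\<^esub> y)"
    by (simp add: quot_algebra_def FactRing_def I.rcoset_mult_add)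
  show "\<one>\<^bsub>quot_algebra A I\<^esub> = I +>\<^bsub>A\<^esub> \<one>\<^bsub>A\<^esub>" "\<zero>\<^bsub>quot_algebra A I\<^esub> = I"
    by (simp_all add: quot_algebra_def FactRing_def)
  show "X \<in> carrier (quot_algebra A I) \<longleftrightarrow> (\<exists>x\<in>carrier A. X = I +>\<^bsub>A\<^esub> x)"
    by (auto simp: quot_algebra_def FactRing_def A_RCOSETS_def')
  show "x \<in> carrier A \<Longrightarrow> I +>\<^bsub>A\<^esub> x = I \<longleftrightarrow> x \<in> I"
    using I.a_rcos_self[of x] I.a_rcos_const[of x] by auto
qed

text \<open>
  The corresponding fact about quotient rings carries over, since the two records differ only in
  the scalar multiplication.
\<close>

lemma ideal_quot_algebra:
  assumes "assoc_algebra K A" "ideal I A" "ideal J A"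
  shows "ideal ((+>\<^bsub>A\<^esub>) I ` J) (quot_algebra A I)"
proof -
  interpret A: assoc_algebra K A by fact
  interpret Q: assoc_algebra K "quot_algebra A I" by (rule assoc_algebra_quot_algebra(1)[OF assms(1,2)])
  interpret J: ideal "(+>\<^bsub>A\<^esub>) I ` J" "A Quot I" by (rule A.ring_ideal_imp_quot_ideal[OF assms(2,3)])
  show ?thesis
  proof (rule idealI)
    show "ring (quot_algebra A I)" by (rule Q.ring_axioms)
    show "subgroup ((+>\<^bsub>A\<^esub>) I ` J) (add_monoid (quot_algebra A I))"
      using J.a_subgroup unfolding subgroup_def m_inv_def by (simp add: quot_algebra_def)
  qed (use J.I_l_closed J.I_r_closed in \<open>simp_all add: quot_algebra_def\<close>)
qed

lemma (in word_hom) quotient_hom: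
  assumes "ideal I A"
  shows "word_hom (quot_algebra A I) (\<lambda>p. I +>\<^bsub>A\<^esub> \<pi> p)"
proof -
  note ax = assoc_algebra_axioms assms
  interpret Q: assoc_algebra class_ring "quot_algebra A I" by (rule assoc_algebra_quot_algebra(1)[OF
      ax])
  show ?thesis
  proof unfold_locales
    show "I +>\<^bsub>A\<^esub> \<pi> p \<in> carrier (quot_algebra A I)" for p
      using hom_closed by (auto simp: quot_carrier[OF ax])
    show "I +>\<^bsub>A\<^esub> \<pi> (scale a p) = a \<odot>\<^bsub>quot_algebra A I\<^esub> (I +>\<^bsub>A\<^esub> \<pi> p)" for a p
      by (simp add: assoc_algebra_quot_algebra(2)[OF ax] hom_closed hom_scale)
  qed (simp_all add: quot_add[OF ax] quot_mult[OF ax] quot_one[OF ax] hom_closed hom_add hom_mult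
      hom_one)
qed

context word_algebra
begin

lemma quotient_algebra:
  assumes "ideal I A"
  shows "word_algebra (quot_algebra A I) (\<lambda>p. I +>\<^bsub>A\<^esub> \<pi> p) D"
proof -
  interpret Q: word_hom "quot_algebra A I" "\<lambda>p. I +>\<^bsub>A\<^esub> \<pi> p" by (rule quotient_hom[OF assms])
  show ?thesis
  proof unfold_locales
    fix X assume "X \<in> carrier (quot_algebra A I)"
    then obtain x where "x \<in> carrier A" "X = I +>\<^bsub>A\<^esub> x"
      using quot_carrier[OF assoc_algebra_axioms assms] by blast
    then show "\<exists>p. X = I +>\<^bsub>A\<^esub> \<pi> p \<and> (\<forall>w\<in>supp p. set (letters w) \<subseteq> D)"
      using hom_onto by blast
  qed
qed

lemma vir_kernel_ker:
  assumes "\<And>i j. i \<in> D \<Longrightarrow> j \<in> D \<Longrightarrow> \<pi> (word [i] * word [j] - word [j] * word [i] - vir_bracket \<kappa> i j) = \<zero>"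
    and "D = UNIV \<or> D = {0<..}"
  shows "vir_kernel \<kappa> ker D"
proof unfold_locales
  show "PM.subspace ker"
    by (rule PM.subspaceI) (simp_all add: ker_def hom_zero hom_add hom_scale)
qed (use assms in \<open>auto simp: ker_def hom_mult hom_closed\<close>)

text \<open>
  A nonzero element of an ideal is the image of a nonzero combination \<open>s\<close> of sorted words, and \<open>s\<close> lies in
  the kernel of the map to the quotient.
\<close>

lemma just_infiniteI:
  assumes rel: "\<And>i j. i \<in> D \<Longrightarrow> j \<in> D \<Longrightarrow> \<pi> (word [i] * word [j] - word [j] * word [i] - vir_bracket \<kappa> i j)
      = \<zero>"
    and D: "D = UNIV \<or> D = {0<..}"
    and indep: "\<And>p. (\<And>w. w \<in> supp p \<Longrightarrow> sorted (letters w) \<and> set (letters w) \<subseteq> {0<..}) \<Longrightarrow> \<pi> p = \<zero> \<Longrightarrow> p = 0"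
  shows "just_infinite_gk_dim A"
  unfolding just_infinite_gk_dim_def
proof (intro conjI allI impI)
  show "gk_dim A = \<infinity>" using indep by (rule infinite_gkI)
  fix I assume I: "ideal I A \<and> I \<noteq> {\<zero>}"
  then have idl: "ideal I A" by simp
  interpret I: ideal I A by (rule idl)
  interpret K: vir_kernel \<kappa> ker D by (rule vir_kernel_ker[OF rel D])
  interpret Q: word_algebra "quot_algebra A I" "\<lambda>p. I +>\<^bsub>A\<^esub> \<pi> p" D by (rule quotient_algebra[OF idl])
  have kerQ: "p \<in> Q.ker \<longleftrightarrow> \<pi> p \<in> I" for p
    using quot_zero[OF assoc_algebra_axioms idl] coset_eq_ideal[OF assoc_algebra_axioms idl hom_closed]
    by (simp add: Q.ker_def)
  have kernel: "vir_kernel \<kappa> Q.ker D"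
  proof (rule Q.vir_kernel_ker[OF _ D])
    fix i j assume "i \<in> D" "j \<in> D"
    then have "\<pi> (word [i] * word [j] - word [j] * word [i] - vir_bracket \<kappa> i j) \<in> I"
      by (simp add: rel)
    then show "I +>\<^bsub>A\<^esub> \<pi> (word [i] * word [j] - word [j] * word [i] - vir_bracket \<kappa> i j) =
        \<zero>\<^bsub>quot_algebra A I\<^esub>"
      using kerQ by (simp add: Q.ker_def)
  qed
  obtain x where x: "x \<in> I" "x \<noteq> \<zero>" using I I.zero_closed by blast
  obtain p where p: "x = \<pi> p" "\<forall>w\<in>supp p. set (letters w) \<subseteq> D"
    using hom_onto[OF I.a_Hcarr[OF x(1)]] by auto
  let ?S = "{zs. sorted zs \<and> set zs \<subseteq> D}"
  have "p \<in> PM.span (ker \<union> word ` ?S)"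
  proof (rule words_span)
    fix w assume "w \<in> supp p"
    then have "word (letters w) \<in> K.reducible_to ?S"
      using K.red_sorted[of "letters w"] p(2) by (auto elim: K.red_mono)
    then show "word (letters w) \<in> PM.span (ker \<union> word ` ?S)" by (simp add: K.reducible_to_def)
  qed
  then obtain k s where ks: "p = k + s" "k \<in> PM.span ker" "s \<in> PM.span (word ` ?S)"
    unfolding PM.span_Un by blast
  have k: "k \<in> ker" using ks(2) K.subspace by (metis PM.span_eq_iff)
  have "PM.span (word ` ?S) \<subseteq> {p :: 'k word_ring. \<forall>w\<in>supp p. sorted (letters w) \<and> set (letters w) \<subseteq> D}"
    by (intro PM.span_minimal subspace_keys) (auto simp: keys_word)
  then have s: "\<forall>w\<in>supp s. sorted (letters w) \<and> set (letters w) \<subseteq> D" using ks(3) by blast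
  have "x = \<pi> s" using p(1) k by (simp add: ks(1) hom_add ker_def hom_closed)
  then have sJ: "s \<in> Q.ker" "s \<noteq> 0" using x kerQ hom_zero by auto
  have inj: "inj_on (\<lambda>w. mset (letters w)) (supp s)"
    using s by (intro inj_onI free_monoid.expand sorted_mset_unique) auto
  have "polynomially_spanned Q.ker D"
    using D
  proof
    assume D': "D = UNIV"
    show ?thesis unfolding D'
      by (rule full_polynomially_spanned[OF _ sJ inj]) (use kernel D' in simp)
  next
    assume D': "D = {0<..}"
    show ?thesis unfolding D'
      by (rule positive_polynomially_spanned[OF _ sJ _ inj]) (use kernel D' s in auto)
  qed
  then show "polynomial_growth (quot_algebra A I)" by (rule Q.polynomial_growthI)
qed

end

section \<open>Enveloping algebras\<close>

lemma free_gen_word: "free_gen x = word [x]"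
  by (simp add: free_gen_def word_def)

lemma free_algebra_simps:
  "carrier (free_algebra X) = {p. \<forall>w\<in>supp p. set (letters w) \<subseteq> X}"
  "mult (free_algebra X) = (*)" "one (free_algebra X) = 1" "zero (free_algebra X) = 0"
  "add (free_algebra X) = (+)" "smult (free_algebra X) = scale"
  by (simp_all add: free_algebra_def)

lemma free_algebra_carrier_scale: "p \<in> carrier (free_algebra X) \<Longrightarrow> scale a p \<in> carrier (free_algebra X)"
  using keys_scale_subset[of a p] unfolding free_algebra_simps by blast

lemma free_algebra_carrier_add:
  "p \<in> carrier (free_algebra X) \<Longrightarrow> q \<in> carrier (free_algebra X) \<Longrightarrow> p + q \<in> carrier (free_algebra X)"
  using keys_add[of p q] unfolding free_algebra_simps by blast

lemma free_algebra_carrier_word: "set xs \<subseteq> X \<Longrightarrow> word xs \<in> carrier (free_algebra X)"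
  by (simp add: free_algebra_simps keys_word)

lemma free_algebra_carrier_mult:
  assumes "p \<in> carrier (free_algebra X)" "q \<in> carrier (free_algebra X)"
  shows "p * q \<in> carrier (free_algebra X)"
proof -
  interpret F: assoc_algebra class_ring "free_algebra X :: ('b, 'a free_monoid \<Rightarrow>\<^sub>0 'b) module"
    by (rule assoc_algebra_free_algebra)
  show ?thesis using F.m_closed[OF assms] by (simp add: free_algebra_simps(2))
qed

lemma free_algebra_carrier_zero: "0 \<in> carrier (free_algebra X)"
  by (simp add: free_algebra_simps)

lemma free_algebra_carrier_lift:
  assumes "\<And>i. g i \<in> carrier (free_algebra X)"
  shows "free_hom g p \<in> carrier (free_algebra X)"
proof (induction p rule: word_induct)
  case (word xs)
  show ?case
  proof (induction xs)
    case Nil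
    then show ?case using free_algebra_carrier_word[of "[]" X] by (simp add: lift_one word_Nil)
  next
    case (Cons x xs)
    then show ?case using free_algebra_carrier_mult[OF assms[of x]] by (simp add: lift_word)
  qed
qed (simp_all add: free_hom_def lin_add lin_scale free_algebra_carrier_zero free_algebra_carrier_add
    free_algebra_carrier_scale)

lemma word_hom_lift:
  assumes "\<And>i. g i \<in> carrier (free_algebra X)"
  shows "word_hom (free_algebra X) (free_hom g)"
proof -
  interpret F: assoc_algebra class_ring "free_algebra X :: ('b, 'a free_monoid \<Rightarrow>\<^sub>0 'b) module"
    by (rule assoc_algebra_free_algebra)
  show ?thesis
    by unfold_locales
      (rule free_algebra_carrier_lift[OF assms], simp_all add: free_algebra_simps(2-6) lift_mult
          lift_one, simp_all add: free_hom_def lin_add lin_scale)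
qed

text \<open>
  The largest two-sided ideal in the kernel of the normal form.  By \<open>normal_form_relation\<close> it contains
  the Virasoro relations, and it meets the combinations of sorted words only in 0.
\<close>

definition null_ideal :: "'k::field_char_0 \<Rightarrow> 'k word_ring set" where
  "null_ideal \<kappa> = {p. \<forall>a b. normal_form \<kappa> (a * p * b) = 0}"

lemma null_ideal_zero: "0 \<in> null_ideal \<kappa>"
  by (simp add: null_ideal_def normal_form_def)

lemma null_ideal_add: "p \<in> null_ideal \<kappa> \<Longrightarrow> q \<in> null_ideal \<kappa> \<Longrightarrow> p + q \<in> null_ideal \<kappa>"
  by (simp add: null_ideal_def normal_form_def distrib_left distrib_right lin_add)

lemma null_ideal_scale: "p \<in> null_ideal \<kappa> \<Longrightarrow> scale c p \<in> null_ideal \<kappa>"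
  by (simp add: null_ideal_def normal_form_def scale_mult_left scale_mult_right lin_scale)

lemma null_ideal_mult: "p \<in> null_ideal \<kappa> \<Longrightarrow> a * p * b \<in> null_ideal \<kappa>"
  unfolding null_ideal_def
proof (intro CollectI allI)
  fix c d assume p: "p \<in> {p. \<forall>a b. normal_form \<kappa> (a * p * b) = 0}"
  have "c * (a * p * b) * d = (c * a) * p * (b * d)" by (simp only: mult.assoc)
  then show "normal_form \<kappa> (c * (a * p * b) * d) = 0" using p by simp
qed

lemma null_ideal_relation: "word [i] * word [j] - word [j] * word [i] - vir_bracket \<kappa> i j \<in> null_ideal
    \<kappa>"
  by (simp add: null_ideal_def normal_form_relation)

lemma null_ideal_sorted:
  assumes "p \<in> null_ideal \<kappa>" "\<And>w. w \<in> supp p \<Longrightarrow> sorted (letters w)"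
  shows "p = 0"
proof -
  have "normal_form \<kappa> (1 * p * 1) = 0" using assms(1) unfolding null_ideal_def by blast
  then show ?thesis using normal_form_sorted[of p \<kappa>] assms(2) by simp
qed

text \<open>
  A linear map \<open>\<rho>\<close> from \<open>L\<close> to words that respects brackets up to elements of \<open>null_ideal \<kappa>\<close> gives a
  map from the enveloping algebra to words modulo \<open>null_ideal \<kappa>\<close>; its kernel is an ideal of the free
  algebra.
\<close>

lemma
  fixes L :: "('k::field_char_0, 'l) lie_algebra"
  assumes L: "lie_algebra class_ring L"
    and add: "\<And>x y. x \<in> carrier L \<Longrightarrow> y \<in> carrier L \<Longrightarrow> \<rho> (x \<oplus>\<^bsub>L\<^esub> y) = \<rho> x + \<rho> y"
    and smult: "\<And>a x. x \<in> carrier L \<Longrightarrow> \<rho> (a \<odot>\<^bsub>L\<^esub> x) = scale a (\<rho> x)"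
    and bracket: "\<And>x y. x \<in> carrier L \<Longrightarrow> y \<in> carrier L \<Longrightarrow>
      \<rho> x * \<rho> y - \<rho> y * \<rho> x - \<rho> (lie_bracket L x y) \<in> null_ideal \<kappa>"
  defines "Q \<equiv> {q \<in> carrier (free_algebra (carrier L)). free_hom \<rho> q \<in> null_ideal \<kappa>}"
  shows ideal_null_preimage: "ideal Q (free_algebra (carrier L))"
    and uea_ideal_null: "uea_ideal L \<subseteq> Q"
proof -
  interpret L: lie_algebra class_ring L by (rule L)
  let ?F = "free_algebra (carrier L) :: ('k, 'l free_monoid \<Rightarrow>\<^sub>0 'k) module"
  interpret F: assoc_algebra class_ring ?F by (rule assoc_algebra_free_algebra)
  show idl: "ideal Q ?F"
  proof (rule idealI)
    show "ring ?F" by (rule F.ring_axioms)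
    have neg: "\<ominus>\<^bsub>?F\<^esub> p = - p" if "p \<in> carrier ?F" for p
      by (rule F.minus_equality) (use that free_algebra_carrier_scale[OF that, of "-1"] in \<open>auto simp:
          free_algebra_simps(4,5) scale_minus\<close>)
    show "subgroup Q (add_monoid ?F)"
    proof (rule F.add.subgroupI)
      show "Q \<subseteq> carrier ?F" by (auto simp: Q_def)
      show "Q \<noteq> {}" using free_algebra_carrier_zero null_ideal_zero by (force simp: Q_def free_hom_def)
      show "\<ominus>\<^bsub>?F\<^esub> p \<in> Q" if "p \<in> Q" for p
        using that free_algebra_carrier_scale[of p "carrier L" "-1"] null_ideal_scale[of "free_hom \<rho> p"
            \<kappa> "-1"]
        by (auto simp: Q_def neg scale_minus free_hom_def lin_minus)
      show "p \<oplus>\<^bsub>?F\<^esub> q \<in> Q" if "p \<in> Q" "q \<in> Q" for p q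
        using that by (auto simp: Q_def free_algebra_simps(5) free_hom_def lin_add intro: null_ideal_add
            free_algebra_carrier_add)
    qed
    show "x \<otimes>\<^bsub>?F\<^esub> a \<in> Q" "a \<otimes>\<^bsub>?F\<^esub> x \<in> Q" if "a \<in> Q" "x \<in> carrier ?F" for a x
      using that null_ideal_mult[of "free_hom \<rho> a" \<kappa> "free_hom \<rho> x" 1] null_ideal_mult[of "free_hom \<rho> a"
          \<kappa> 1 "free_hom \<rho> x"]
      by (auto simp: Q_def free_algebra_simps(2) lift_mult intro: free_algebra_carrier_mult)
  qed
  have gen: "free_gen x \<in> carrier ?F" if "x \<in> carrier L" for x
    using that by (simp add: free_gen_word free_algebra_carrier_word)
  have diff: "p - q \<in> carrier ?F" if "p \<in> carrier ?F" "q \<in> carrier ?F" for p q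
    using free_algebra_carrier_add[OF that(1) free_algebra_carrier_scale[OF that(2), of "-1"]] by (simp
        add: scale_minus)
  have lift_gen: "free_hom \<rho> (free_gen x) = \<rho> x" for x by (simp add: free_gen_word lift_word)
  have lift_diff: "free_hom \<rho> (p - q) = free_hom \<rho> p - free_hom \<rho> q" for p q by (simp add: free_hom_def
      lin_diff)
  have lift_scale: "free_hom \<rho> (scale a p) = scale a (free_hom \<rho> p)" for a p by (simp add: free_hom_def
      lin_scale)
  have "uea_relations L \<subseteq> Q"
    unfolding uea_relations_def Q_def
    using L.bracket_closed
    by (auto simp: lift_diff lift_gen lift_scale lift_mult add smult null_ideal_zero bracket
        intro!: diff gen free_algebra_carrier_mult free_algebra_carrier_scale)
  then show "uea_ideal L \<subseteq> Q" unfolding uea_ideal_def by (rule F.genideal_minimal[OF idl])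
qed


text \<open>
  Compatibility with the bracket only has to be checked on basis elements.
\<close>

lemma lin_bracket_null:
  fixes R :: "'b \<Rightarrow> ('k::field_char_0) word_ring"
  assumes "\<And>b c. R b * R c - R c * R b - linear_extension R (\<beta> b c) \<in> null_ideal \<kappa>"
  shows "linear_extension R x * linear_extension R y - linear_extension R y * linear_extension R x -
      linear_extension R (bilinear_extension \<beta> x y) \<in> null_ideal \<kappa>"
proof (induction x rule: poly_mapping_induct_basis)
  case (single i a)
  show ?case
  proof (induction y rule: poly_mapping_induct_basis)
    case (single j b)
    have "scale (a * b) (R i * R j - R j * R i - linear_extension R (\<beta> i j)) \<in> null_ideal \<kappa>"
      by (rule null_ideal_scale[OF assms])
    moreover have "scale (a * b) (R i * R j - R j * R i - linear_extension R (\<beta> i j)) =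
      scale a (R i) * scale b (R j) - scale b (R j) * scale a (R i) - scale (a * b) (linear_extension R
          (\<beta> i j))"
      by (simp only: PM.scale_right_diff_distrib scale_mult_left scale_mult_right scale_scale
          mult.commute[of b a])
    ultimately show ?case by (simp only: lin_single bilinear_extension_single lin_scale)
  next
    case (add p q)
    from null_ideal_add[OF add] show ?case
      by (simp add: lin_add bilinear_extension_add_right algebra_simps)
  qed (simp add: null_ideal_zero)
next
  case (add p q)
  from null_ideal_add[OF add] show ?case
    by (simp add: lin_add bilinear_extension_add_left algebra_simps)
qed (simp add: null_ideal_zero)

text \<open>
  The map from the ring of words to an enveloping algebra that sends a letter \<open>i \<in> D\<close> to \<open>\<epsilon> i\<close> and
  the other letters to 0.
\<close>

locale uea_letters =
  fixes L :: "('k::field_char_0, 'l) lie_algebra" and \<epsilon> :: "int \<Rightarrow> 'l" and D :: "int set"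
  assumes lie: "lie_algebra class_ring L" and letter_carrier: "i \<in> D \<Longrightarrow> \<epsilon> i \<in> carrier L"
begin

abbreviation F :: "('k, 'l free_monoid \<Rightarrow>\<^sub>0 'k) module" where "F \<equiv> free_algebra (carrier L)"

definition letter :: "int \<Rightarrow> ('l free_monoid \<Rightarrow>\<^sub>0 'k)" where
  "letter i = (if i \<in> D then word [\<epsilon> i] else 0)"

definition coset :: "('l free_monoid \<Rightarrow>\<^sub>0 'k) \<Rightarrow> ('l free_monoid \<Rightarrow>\<^sub>0 'k) set" where
  "coset q = uea_ideal L +>\<^bsub>F\<^esub> q"

abbreviation \<pi> :: "'k word_ring \<Rightarrow> ('l free_monoid \<Rightarrow>\<^sub>0 'k) set" where
  "\<pi> p \<equiv> coset (free_hom letter p)"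

lemmas idl = ideal_uea_ideal[OF lie]

sublocale FA: assoc_algebra class_ring F by (rule assoc_algebra_free_algebra)
sublocale I: ideal "uea_ideal L" F by (rule idl)
sublocale U: assoc_algebra class_ring "uea L" by (rule assoc_algebra_uea[OF lie])

lemma coset_add: "p \<in> carrier F \<Longrightarrow> q \<in> carrier F \<Longrightarrow> coset p \<oplus>\<^bsub>uea L\<^esub> coset q = coset (p + q)"
  unfolding coset_def uea_def by (simp add: quot_add[OF FA.assoc_algebra_axioms idl]
      free_algebra_simps(5))

lemma coset_mult: "p \<in> carrier F \<Longrightarrow> q \<in> carrier F \<Longrightarrow> coset p \<otimes>\<^bsub>uea L\<^esub> coset q = coset (p * q)"
  unfolding coset_def uea_def by (simp add: quot_mult[OF FA.assoc_algebra_axioms idl]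
      free_algebra_simps(2))

lemma coset_scale: "p \<in> carrier F \<Longrightarrow> a \<odot>\<^bsub>uea L\<^esub> coset p = coset (scale a p)"
  unfolding coset_def uea_def
  by (simp add: assoc_algebra_quot_algebra(2)[OF FA.assoc_algebra_axioms idl] free_algebra_simps(6))

lemma coset_closed: "p \<in> carrier F \<Longrightarrow> coset p \<in> carrier (uea L)"
  unfolding coset_def uea_def by (auto simp: quot_carrier[OF FA.assoc_algebra_axioms idl])

lemma coset_zero_iff: "p \<in> carrier F \<Longrightarrow> coset p = \<zero>\<^bsub>uea L\<^esub> \<longleftrightarrow> p \<in> uea_ideal L"
  unfolding coset_def uea_def
  by (simp add: quot_zero[OF FA.assoc_algebra_axioms idl] coset_eq_ideal[OF FA.assoc_algebra_axioms
      idl])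

lemma coset_eqI:
  assumes "p \<in> carrier F" "q \<in> carrier F" "p - q \<in> uea_ideal L"
  shows "coset p = coset q"
proof -
  have pq: "p - q \<in> carrier F" using I.a_Hcarr[OF assms(3)] .
  have "coset (p - q) \<oplus>\<^bsub>uea L\<^esub> coset q = coset p" using coset_add[OF pq assms(2)] by simp
  moreover have "coset (p - q) = \<zero>\<^bsub>uea L\<^esub>" using coset_zero_iff[OF pq] assms(3) by simp
  ultimately show ?thesis using coset_closed[OF assms(2)] by simp
qed

lemma letter_closed: "letter i \<in> carrier F"
  by (simp add: letter_def free_algebra_carrier_zero free_algebra_carrier_word letter_carrier)

lemma lift_closed: "free_hom letter p \<in> carrier F"
  by (rule free_algebra_carrier_lift[OF letter_closed])

lemma hom: "word_hom (uea L) \<pi>"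
proof -
  interpret H: word_hom F "free_hom letter" by (rule word_hom_lift[OF letter_closed])
  show ?thesis unfolding coset_def uea_def by (rule H.quotient_hom[OF idl])
qed

lemma relations: "uea_relations L \<subseteq> uea_ideal L"
proof -
  interpret L: lie_algebra class_ring L by (rule lie)
  have diff: "p - q \<in> carrier F" if "p \<in> carrier F" "q \<in> carrier F" for p q
    using free_algebra_carrier_add[OF that(1) free_algebra_carrier_scale[OF that(2), of "-1"]] by (simp
        add: scale_minus)
  have "uea_relations L \<subseteq> carrier F"
    unfolding uea_relations_def free_gen_word using L.bracket_closed
    by (auto intro!: diff free_algebra_carrier_word free_algebra_carrier_mult
        free_algebra_carrier_scale)
  then show ?thesis unfolding uea_ideal_def by (rule FA.genideal_self)
qed

lemma relation_add: "x \<in> carrier L \<Longrightarrow> y \<in> carrier L \<Longrightarrow> word [x \<oplus>\<^bsub>L\<^esub> y] - word [x] - word [y] \<in> uea_ideal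
    L"
  by (rule subsetD[OF relations], unfold uea_relations_def free_gen_word, rule UnI1, rule UnI1, rule
      CollectI)
    (rule exI[of _ x], rule exI[of _ y], simp)

lemma relation_smult: "x \<in> carrier L \<Longrightarrow> word [a \<odot>\<^bsub>L\<^esub> x] - scale a (word [x]) \<in> uea_ideal L"
  by (rule subsetD[OF relations], unfold uea_relations_def free_gen_word, rule UnI1, rule UnI2, rule
      CollectI)
    (rule exI[of _ a], rule exI[of _ x], simp)

lemma relation_bracket: "x \<in> carrier L \<Longrightarrow> y \<in> carrier L \<Longrightarrow>
    word [x] * word [y] - word [y] * word [x] - word [lie_bracket L x y] \<in> uea_ideal L"
  by (rule subsetD[OF relations], unfold uea_relations_def free_gen_word, rule UnI2, rule CollectI)
    (rule exI[of _ x], rule exI[of _ y], simp)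

lemma ideal_add: "p \<in> uea_ideal L \<Longrightarrow> q \<in> uea_ideal L \<Longrightarrow> p + q \<in> uea_ideal L"
  using I.a_closed[of p q] by (simp add: free_algebra_simps(5))

text \<open>
  The subalgebra generated by the letters in \<open>D\<close>, which has to be shown to be everything.
\<close>

definition reached :: "('l free_monoid \<Rightarrow>\<^sub>0 'k) set set" where
  "reached = {X. \<exists>p. X = \<pi> p \<and> (\<forall>w\<in>supp p. set (letters w) \<subseteq> D)}"

lemma reached_zero: "\<zero>\<^bsub>uea L\<^esub> \<in> reached"
proof -
  have "0 \<in> uea_ideal L" using I.zero_closed by (simp add: free_algebra_simps(4))
  then have "\<pi> 0 = \<zero>\<^bsub>uea L\<^esub>" using coset_zero_iff[OF free_algebra_carrier_zero] by (simp add: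
      free_hom_def)
  then show ?thesis unfolding reached_def by (intro CollectI exI[of _ 0]) simp
qed

lemma reached_add: "X \<in> reached \<Longrightarrow> Y \<in> reached \<Longrightarrow> X \<oplus>\<^bsub>uea L\<^esub> Y \<in> reached"
proof -
  interpret H: word_hom "uea L" \<pi> by (rule hom)
  assume "X \<in> reached" "Y \<in> reached"
  then obtain p q where pq: "X = \<pi> p" "Y = \<pi> q" "\<forall>w\<in>supp p. set (letters w) \<subseteq> D"
      "\<forall>w\<in>supp q. set (letters w) \<subseteq> D" unfolding reached_def by blast
  then have "\<forall>w\<in>supp (p + q). set (letters w) \<subseteq> D" using keys_add[of p q] by blast
  then show ?thesis unfolding reached_def using pq(1,2) H.hom_add by (intro CollectI exI[of _ "p + q"])
      simp
qed

lemma reached_smult: "X \<in> reached \<Longrightarrow> a \<odot>\<^bsub>uea L\<^esub> X \<in> reached"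
proof -
  interpret H: word_hom "uea L" \<pi> by (rule hom)
  assume "X \<in> reached"
  then obtain p where p: "X = \<pi> p" "\<forall>w\<in>supp p. set (letters w) \<subseteq> D" unfolding reached_def by blast
  then have "\<forall>w\<in>supp (scale a p). set (letters w) \<subseteq> D" using keys_scale_subset[of a p] by blast
  then show ?thesis unfolding reached_def using p(1) H.hom_scale by (intro CollectI exI[of _ "scale a
      p"]) simp
qed

lemma reached_mult: "X \<in> reached \<Longrightarrow> Y \<in> reached \<Longrightarrow> X \<otimes>\<^bsub>uea L\<^esub> Y \<in> reached"
proof -
  interpret H: word_hom "uea L" \<pi> by (rule hom)
  assume "X \<in> reached" "Y \<in> reached"
  then obtain p q where pq: "X = \<pi> p" "Y = \<pi> q" "\<forall>w\<in>supp p. set (letters w) \<subseteq> D"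
      "\<forall>w\<in>supp q. set (letters w) \<subseteq> D" unfolding reached_def by blast
  have "set (letters v) \<subseteq> D" if v: "v \<in> supp (p * q)" for v
  proof -
    obtain u w where uw: "u \<in> supp p" "w \<in> supp q" "letters v = letters u @ letters w"
      using keys_times_words[OF v] by blast
    then show ?thesis using pq(3)[rule_format, OF uw(1)] pq(4)[rule_format, OF uw(2)] by simp
  qed
  then show ?thesis unfolding reached_def using pq(1,2) H.hom_mult by (intro CollectI exI[of _ "p * q"])
      simp
qed

lemma reached_letter: "i \<in> D \<Longrightarrow> coset (word [\<epsilon> i]) \<in> reached"
  unfolding reached_def by (intro CollectI exI[of _ "word [i]"]) (simp add: lift_word letter_def
      keys_word)

lemma wordC: "x \<in> carrier L \<Longrightarrow> word [x] \<in> carrier F"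
  by (simp add: free_algebra_carrier_word)

lemma reached_gen_add:
  assumes "x \<in> carrier L" "y \<in> carrier L" "coset (word [x]) \<in> reached" "coset (word [y]) \<in> reached"
  shows "coset (word [x \<oplus>\<^bsub>L\<^esub> y]) \<in> reached"
proof -
  interpret L: lie_algebra class_ring L by (rule lie)
  have "word [x \<oplus>\<^bsub>L\<^esub> y] - (word [x] + word [y]) \<in> uea_ideal L"
    using relation_add[OF assms(1,2)] by (simp only: diff_diff_eq)
  moreover have "x \<oplus>\<^bsub>L\<^esub> y \<in> carrier L" using assms(1,2) by simp
  ultimately have "coset (word [x \<oplus>\<^bsub>L\<^esub> y]) = coset (word [x] + word [y])"
    by (intro coset_eqI wordC free_algebra_carrier_add assms(1,2))
  then show ?thesis using reached_add[OF assms(3,4)] assms(1,2) by (simp add: coset_add wordC)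
qed

lemma reached_gen_smult:
  assumes "x \<in> carrier L" "coset (word [x]) \<in> reached"
  shows "coset (word [a \<odot>\<^bsub>L\<^esub> x]) \<in> reached"
proof -
  interpret L: lie_algebra class_ring L by (rule lie)
  have "a \<odot>\<^bsub>L\<^esub> x \<in> carrier L" using assms(1) by simp
  then have "coset (word [a \<odot>\<^bsub>L\<^esub> x]) = coset (scale a (word [x]))"
    by (intro coset_eqI wordC free_algebra_carrier_scale assms(1) relation_smult)
  then show ?thesis using reached_smult[OF assms(2)] assms(1) by (simp add: coset_scale wordC)
qed

lemma reached_gen_bracket:
  assumes "x \<in> carrier L" "y \<in> carrier L" "coset (word [x]) \<in> reached" "coset (word [y]) \<in> reached"
  shows "coset (word [lie_bracket L x y]) \<in> reached"
proof -
  interpret L: lie_algebra class_ring L by (rule lie)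
  note C = free_algebra_carrier_mult[OF wordC wordC]
  have neg: "scale (- 1) p = - p" for p :: "'l free_monoid \<Rightarrow>\<^sub>0 'k" by (simp add: scale_minus)
  have "word [x] * word [y] + scale (- 1) (word [y] * word [x]) - word [lie_bracket L x y] \<in> uea_ideal
      L"
    using relation_bracket[OF assms(1,2)] by (simp only: neg add_uminus_conv_diff)
  then have "coset (word [lie_bracket L x y]) = coset (word [x] * word [y] + scale (- 1) (word [y] *
      word [x]))"
    by (intro coset_eqI[symmetric] wordC free_algebra_carrier_add free_algebra_carrier_scale C
        assms(1,2) L.bracket_closed)
  also have "\<dots> = coset (word [x]) \<otimes>\<^bsub>uea L\<^esub> coset (word [y]) \<oplus>\<^bsub>uea L\<^esub> (- 1) \<odot>\<^bsub>uea L\<^esub> (coset (word [y])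
      \<otimes>\<^bsub>uea L\<^esub> coset (word [x]))"
    by (simp only: coset_add coset_mult coset_scale wordC C free_algebra_carrier_scale assms(1,2))
  also have "\<dots> \<in> reached" by (intro reached_add reached_mult reached_smult assms)
  finally show ?thesis .
qed

lemma word_algebraI:
  assumes gen: "\<And>x. x \<in> carrier L \<Longrightarrow> coset (word [x]) \<in> reached"
  shows "word_algebra (uea L) \<pi> D"
proof -
  interpret H: word_hom "uea L" \<pi> by (rule hom)
  have words: "coset (word xs) \<in> reached" if "set xs \<subseteq> carrier L" for xs
    using that
  proof (induction xs)
    case Nil
    have "coset (word []) = \<pi> (word [])" by (simp add: lift_word word_Nil lift_one)
    then show ?case unfolding reached_def by (intro CollectI exI[of _ "word []"]) (simp add: keys_word)
  next
    case (Cons x xs)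
    then have "coset (word [x]) \<otimes>\<^bsub>uea L\<^esub> coset (word xs) \<in> reached" by (intro reached_mult gen) simp_all
    then show ?case using Cons.prems by (simp add: coset_mult free_algebra_carrier_word flip:
        word_append)
  qed
  show ?thesis
  proof unfold_locales
    fix X assume "X \<in> carrier (uea L)"
    then obtain q where q: "q \<in> carrier F" "X = coset q"
      unfolding uea_def coset_def by (auto simp: quot_carrier[OF FA.assoc_algebra_axioms idl])
    have "(\<Sum>w\<in>S. scale (coeff_at q w) (word (letters w))) \<in> carrier F \<and>
        coset (\<Sum>w\<in>S. scale (coeff_at q w) (word (letters w))) \<in> reached"
      if "finite S" "S \<subseteq> supp q" for S
      using that
    proof (induction S rule: finite_induct)
      case empty
      then show ?case using reached_zero I.zero_closed coset_zero_iff[OF free_algebra_carrier_zero]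
        by (simp add: free_algebra_carrier_zero free_algebra_simps(4))
    next
      case (insert w S)
      have w: "set (letters w) \<subseteq> carrier L" using insert.prems q(1) by (auto simp: free_algebra_simps)
      then have C: "scale (coeff_at q w) (word (letters w)) \<in> carrier F"
        by (intro free_algebra_carrier_scale free_algebra_carrier_word)
      have "coset (scale (coeff_at q w) (word (letters w))) \<in> reached"
        using reached_smult[OF words[OF w]] coset_scale[OF free_algebra_carrier_word[OF w]] by metis
      then show ?case
        using insert C by (auto simp: free_algebra_carrier_add coset_add[symmetric] intro: reached_add)
    qed
    from this[of "supp q"] have "coset q \<in> reached" by (simp flip: expand_words)
    then show "\<exists>p. X = \<pi> p \<and> (\<forall>w\<in>supp p. set (letters w) \<subseteq> D)"
      using q(2) unfolding reached_def by blast
  qed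
qed

lemma lift_lift:
  assumes "\<And>i. i \<in> D \<Longrightarrow> \<rho> (\<epsilon> i) = word [i]" "\<And>w. w \<in> supp p \<Longrightarrow> set (letters w) \<subseteq> D"
  shows "free_hom \<rho> (free_hom letter p) = (p :: 'k word_ring)"
proof -
  have w: "free_hom \<rho> (free_hom letter (word xs)) = (word xs :: 'k word_ring)" if "set xs \<subseteq> D" for xs
    using that
  proof (induction xs)
    case (Cons x xs)
    have "free_hom \<rho> (free_hom letter (word ([x] @ xs))) = free_hom \<rho> (free_hom letter (word [x])) *
        free_hom \<rho> (free_hom letter (word xs))"
      by (simp only: word_append lift_mult)
    also have "free_hom \<rho> (free_hom letter (word [x])) = word [x]"
      using Cons.prems by (simp add: lift_word letter_def assms(1))
    also have "free_hom \<rho> (free_hom letter (word xs)) = word xs" using Cons by simp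
    finally show ?case by (simp flip: word_append)
  qed (simp add: word_Nil lift_one)
  have "free_hom \<rho> (free_hom letter p) = (\<Sum>w\<in>supp p. scale (coeff_at p w) (free_hom \<rho> (free_hom letter
      (word (letters w)))))"
    by (subst (1) expand_words) (simp add: free_hom_def lin_sum lin_scale)
  also have "\<dots> = (\<Sum>w\<in>supp p. scale (coeff_at p w) (word (letters w)))"
    by (intro sum.cong refl) (simp only: w assms(2))
  also have "\<dots> = p" by (rule expand_words[symmetric])
  finally show ?thesis .
qed

end

text \<open>
  The linear relations of the enveloping algebra reduce generation to basis elements.
\<close>

lemma gen_on_basis:
  fixes L :: "('k::field_char_0, 'b \<Rightarrow>\<^sub>0 'k) lie_algebra"
  assumes "uea_letters L \<epsilon> D"
    and L: "carrier L = {x. supp x \<subseteq> B}" "add L = (+)" "smult L = scale"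
    and basis: "\<And>b. b \<in> B \<Longrightarrow> uea_letters.coset L (word [mono_at b 1]) \<in> uea_letters.reached L \<epsilon> D"
    and x: "x \<in> carrier L"
  shows "uea_letters.coset L (word [x]) \<in> uea_letters.reached L \<epsilon> D"
proof -
  interpret uea_letters L \<epsilon> D by fact
  have single: "coset (word [mono_at b a]) \<in> reached" if "b \<in> B" for a b
    using reached_gen_smult[OF _ basis[OF that], of a] that by (simp add: L)
  have sums: "(\<Sum>b\<in>S. mono_at b (coeff_at x b)) \<in> carrier L \<and>
      coset (word [\<Sum>b\<in>S. mono_at b (coeff_at x b)]) \<in> reached"
    if "finite S" "S \<subseteq> B" for S
    using that
  proof (induction S rule: finite_induct)
    case empty
    have zero: "0 \<in> carrier L" by (simp add: L)
    have "word [0] \<in> uea_ideal L" using relation_smult[OF zero, of 0] by (simp add: L)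
    then have "coset (word [0]) = \<zero>\<^bsub>uea L\<^esub>" using coset_zero_iff[OF wordC[OF zero]] by simp
    then show ?case using zero reached_zero by simp
  next
    case (insert b S)
    have b: "mono_at b (coeff_at x b) \<in> carrier L"
      using insert.prems by (auto simp: L)
    have S: "(\<Sum>b\<in>S. mono_at b (coeff_at x b)) \<in> carrier L"
        "coset (word [\<Sum>b\<in>S. mono_at b (coeff_at x b)]) \<in> reached"
      using insert by auto
    have "p + q \<in> carrier L" if "p \<in> carrier L" "q \<in> carrier L" for p q
      using that keys_add[of p q] by (auto simp: L)
    then show ?case
      using reached_gen_add[OF b S(1) single S(2)] insert b S by (simp add: L(2))
  qed
  have e: "x = (\<Sum>b\<in>supp x. mono_at b (coeff_at x b))"
    by (rule poly_mapping_eqI) (simp add: lookup_sum lookup_single when_def in_keys_iff)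
  have "supp x \<subseteq> B" using x L(1) by simp
  from sums[OF finite_keys this, folded e] show ?thesis by simp
qed

section \<open>The Witt algebras\<close>

text \<open>
  A homomorphism back to the words modulo \<open>null_ideal 0\<close> shows that the sorted words are independent;
  both the full and the positive Witt algebra are covered.
\<close>

lemma just_infinite_witt_type:
  fixes L :: "('k::field_char_0, int \<Rightarrow>\<^sub>0 'k) lie_algebra"
  assumes lie: "lie_algebra class_ring L"
    and L: "carrier L = {x. supp x \<subseteq> D}" "add L = (+)" "smult L = scale"
      "lie_bracket L = bilinear_extension witt_bracket"
    and D: "D = UNIV \<or> D = {0<..}"
  shows "just_infinite_gk_dim (uea L)"
proof -
  define \<epsilon> :: "int \<Rightarrow> (int \<Rightarrow>\<^sub>0 'k)" where "\<epsilon> i = mono_at i 1" for i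
  interpret uea_letters L \<epsilon> D
    by (rule uea_letters.intro[OF lie]) (simp add: L(1) \<epsilon>_def)
  interpret W: word_algebra "uea L" \<pi> D
    by (rule word_algebraI, rule gen_on_basis[OF uea_letters_axioms L(1-3)]) (use reached_letter in
        \<open>simp_all add: \<epsilon>_def\<close>)
  define \<rho> :: "(int \<Rightarrow>\<^sub>0 'k) \<Rightarrow> 'k word_ring" where "\<rho> = linear_extension (\<lambda>i. word [i])"
  have coc: "vir_cocycle (0::'k) i j = 0" for i j by (simp add: vir_cocycle_def)
  have br: "\<rho> x * \<rho> y - \<rho> y * \<rho> x - \<rho> (lie_bracket L x y) \<in> null_ideal 0" for x y
    unfolding \<rho>_def L(4)
  proof (rule lin_bracket_null)
    fix i j :: int
    have "linear_extension (\<lambda>i. word [i]) (witt_bracket i j) = (vir_bracket 0 i j :: 'k word_ring)"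
      by (simp add: witt_bracket_def lin_single vir_bracket_def coc)
    then show "word [i] * word [j] - word [j] * word [i] - linear_extension (\<lambda>i. word [i]) (witt_bracket
        i j) \<in> null_ideal (0::'k)"
      using null_ideal_relation by metis
  qed
  have null: "uea_ideal L \<subseteq> {q \<in> carrier F. free_hom \<rho> q \<in> null_ideal 0}"
    by (rule uea_ideal_null[OF lie _ _ br]) (simp_all add: L \<rho>_def lin_add lin_scale)
  show ?thesis
  proof (rule W.just_infiniteI[OF _ D])
    fix i j assume ij: "i \<in> D" "j \<in> D"
    then have ijD: "i + j \<in> D" using D by auto
    let ?e = "\<lambda>i. word [\<epsilon> i] :: (int \<Rightarrow>\<^sub>0 'k) free_monoid \<Rightarrow>\<^sub>0 'k"
    have bracket: "lie_bracket L (\<epsilon> i) (\<epsilon> j) = of_int (j - i) \<odot>\<^bsub>L\<^esub> \<epsilon> (i + j)"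
      by (simp add: L \<epsilon>_def bilinear_extension_single witt_bracket_def)
    have "?e i * ?e j - ?e j * ?e i - word [lie_bracket L (\<epsilon> i) (\<epsilon> j)]
        + (word [lie_bracket L (\<epsilon> i) (\<epsilon> j)] - scale (of_int (j - i)) (?e (i + j))) \<in> uea_ideal L"
      unfolding bracket using ij ijD
      by (intro ideal_add relation_smult letter_carrier relation_bracket[of "\<epsilon> i" "\<epsilon> j", unfolded
          bracket])
    moreover have "free_hom letter (word [i] * word [j] - word [j] * word [i] - vir_bracket 0 i j)
        = ?e i * ?e j - ?e j * ?e i - scale (of_int (j - i)) (?e (i + j))"
      unfolding vir_bracket_def coc using ij ijD
      by (simp add: free_hom_def lin_diff lin_add lin_scale del: of_int_diff)
        (simp add: lift_mult lift_word letter_def flip: free_hom_def del: of_int_diff)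
    ultimately have "free_hom letter (word [i] * word [j] - word [j] * word [i] - vir_bracket 0 i j) \<in>
        uea_ideal L" by simp
    then show "\<pi> (word [i] * word [j] - word [j] * word [i] - vir_bracket 0 i j) = \<zero>\<^bsub>uea L\<^esub>"
      using coset_zero_iff[OF lift_closed] by blast
  next
    fix p :: "'k word_ring"
    assume p: "\<And>w. w \<in> supp p \<Longrightarrow> sorted (letters w) \<and> set (letters w) \<subseteq> {0<..}"
      and zero: "\<pi> p = \<zero>\<^bsub>uea L\<^esub>"
    then have "free_hom \<rho> (free_hom letter p) \<in> null_ideal 0"
      using coset_zero_iff[OF lift_closed, of p] null by blast
    moreover have "free_hom \<rho> (free_hom letter p) = p"
      by (rule lift_lift) (use p D in \<open>auto simp: \<rho>_def \<epsilon>_def lin_single\<close>)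
    ultimately show "p = 0" using null_ideal_sorted p by metis
  qed
qed

section \<open>The central quotients of the Virasoro algebra\<close>

text \<open>
  The central element need not be listed among the generators, because
  \<open>c = 2 [e\<^sub>2, e\<^sub>-\<^sub>2] + 8 e\<^sub>0\<close>.  Sending \<open>c\<close> to \<open>\<kappa>\<close> defines the homomorphism back to the words modulo
  \<open>null_ideal \<kappa>\<close>.
\<close>

lemma just_infinite_virasoro_level: "just_infinite_gk_dim (uea_virasoro_level (\<kappa> :: 'k::field_char_0))"
proof -
  let ?V = "virasoro :: ('k, virasoro_basis \<Rightarrow>\<^sub>0 'k) lie_algebra"
  define \<epsilon> :: "int \<Rightarrow> (virasoro_basis \<Rightarrow>\<^sub>0 'k)" where "\<epsilon> i = mono_at (Vir_e i) 1" for i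
  have L: "carrier ?V = UNIV" "add ?V = (+)" "smult ?V = scale" "lie_bracket ?V = bilinear_extension
      virasoro_bracket"
    by (simp_all add: virasoro_def lie_algebra_on_basis_def)
  interpret uea_letters ?V \<epsilon> UNIV
    by (rule uea_letters.intro[OF lie_algebra_virasoro]) (simp add: L(1))
  define \<gamma> :: "int \<Rightarrow> int \<Rightarrow> 'k" where "\<gamma> i j = (if i + j = 0 then of_int (i ^ 3 - i) / 12 else 0)" for i
      j
  let ?c = "virasoro_c :: virasoro_basis \<Rightarrow>\<^sub>0 'k"
  have bracket: "lie_bracket ?V (\<epsilon> i) (\<epsilon> j) = (of_int (j - i) \<odot>\<^bsub>?V\<^esub> \<epsilon> (i + j)) \<oplus>\<^bsub>?V\<^esub> (\<gamma> i j \<odot>\<^bsub>?V\<^esub> ?c)"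
      for i j
    by (simp add: L \<epsilon>_def bilinear_extension_single virasoro_c_def \<gamma>_def)
  have cIm: "coset (word [?c]) \<in> reached"
  proof -
    have "2 \<odot>\<^bsub>?V\<^esub> lie_bracket ?V (\<epsilon> 2) (\<epsilon> (- 2)) \<oplus>\<^bsub>?V\<^esub> 8 \<odot>\<^bsub>?V\<^esub> \<epsilon> 0 = ?c"
      unfolding bracket
      by (rule poly_mapping_eqI) (simp add: L \<epsilon>_def \<gamma>_def virasoro_c_def lookup_add lookup_single
          when_def)
    moreover have "coset (word [2 \<odot>\<^bsub>?V\<^esub> lie_bracket ?V (\<epsilon> 2) (\<epsilon> (- 2)) \<oplus>\<^bsub>?V\<^esub> 8 \<odot>\<^bsub>?V\<^esub> \<epsilon> 0]) \<in> reached"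
      by (intro reached_gen_add reached_gen_smult reached_gen_bracket reached_letter) (simp_all add:
          L(1))
    ultimately show ?thesis by simp
  qed
  have basis: "coset (word [mono_at b 1]) \<in> reached" for b
    using reached_letter cIm by (cases b) (simp_all add: \<epsilon>_def virasoro_c_def)
  interpret W: word_algebra "uea ?V" \<pi> UNIV
    by (rule word_algebraI, rule gen_on_basis[OF uea_letters_axioms, of UNIV]) (use basis in \<open>simp_all
        add: L\<close>)
  define t where "t = uea_embed ?V virasoro_c \<ominus>\<^bsub>uea ?V\<^esub> (\<kappa> \<odot>\<^bsub>uea ?V\<^esub> \<one>\<^bsub>uea ?V\<^esub>)"
  define K where "K = genideal (uea ?V) {t}"
  have cC: "word [?c] \<in> carrier F" and oneC: "1 \<in> carrier F"
    using wordC[of ?c] free_algebra_carrier_word[of "[]" "carrier ?V"] by (simp_all add: L word_Nil)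
  have dC: "word [?c] - scale \<kappa> 1 \<in> carrier F"
    using free_algebra_carrier_add[OF cC free_algebra_carrier_scale[OF oneC, of "- \<kappa>"]] by (simp add:
        scale_minus)
  have t: "t = coset (word [?c] - scale \<kappa> 1)"
  proof -
    have one: "\<one>\<^bsub>uea ?V\<^esub> = coset 1" using W.hom_one by (simp add: lift_one)
    have c: "uea_embed ?V virasoro_c = coset (word [?c])" by (simp add: uea_embed_def coset_def
        free_gen_word)
    have "coset (word [?c] - scale \<kappa> 1) \<oplus>\<^bsub>uea ?V\<^esub> coset (scale \<kappa> 1) = coset (word [?c])"
      using coset_add[OF dC free_algebra_carrier_scale[OF oneC]] by simp
    then show ?thesis
      unfolding t_def one c coset_scale[OF oneC] U.minus_eq
      using coset_closed[OF dC] coset_closed[OF free_algebra_carrier_scale[OF oneC, of \<kappa>]]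
      by (metis U.add.inv_solve_right coset_closed[OF cC])
  qed
  have tC: "t \<in> carrier (uea ?V)" unfolding t by (rule coset_closed[OF dC])
  have Kidl: "ideal K (uea ?V)" unfolding K_def by (rule U.genideal_ideal) (use tC in simp)
  interpret K: ideal K "uea ?V" by (rule Kidl)
  have tK: "t \<in> K" unfolding K_def using U.genideal_self[of "{t}"] tC by simp
  interpret Q: word_algebra "quot_algebra (uea ?V) K" "\<lambda>p. K +>\<^bsub>uea ?V\<^esub> \<pi> p" UNIV
    by (rule W.quotient_algebra[OF Kidl])
  have zeroQ: "K +>\<^bsub>uea ?V\<^esub> \<pi> p = \<zero>\<^bsub>quot_algebra (uea ?V) K\<^esub> \<longleftrightarrow> \<pi> p \<in> K" for p
    using quot_zero[OF U.assoc_algebra_axioms Kidl] coset_eq_ideal[OF U.assoc_algebra_axioms Kidl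
        W.hom_closed] by simp
  define R :: "virasoro_basis \<Rightarrow> 'k word_ring"
    where "R b = (case b of Vir_e i \<Rightarrow> word [i] | Vir_c \<Rightarrow> scale \<kappa> 1)" for b
  define \<rho> where "\<rho> = linear_extension R"
  have br: "\<rho> x * \<rho> y - \<rho> y * \<rho> x - \<rho> (lie_bracket ?V x y) \<in> null_ideal \<kappa>" for x y
    unfolding \<rho>_def L(4)
  proof (rule lin_bracket_null)
    fix b c
    show "R b * R c - R c * R b - linear_extension R (virasoro_bracket b c) \<in> null_ideal \<kappa>"
    proof (cases "\<exists>i j. b = Vir_e i \<and> c = Vir_e j")
      case True
      then obtain i j where bc: "b = Vir_e i" "c = Vir_e j" by blast
      have "linear_extension R (virasoro_bracket b c) = vir_bracket \<kappa> i j"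
        unfolding bc by (simp add: lin_add lin_single R_def vir_bracket_def vir_cocycle_def scale_scale
            mult.commute)
      then show ?thesis using null_ideal_relation[of i j \<kappa>] by (simp add: bc R_def)
    next
      case False
      then have "R b * R c = R c * R b" "virasoro_bracket b c = (0 :: virasoro_basis \<Rightarrow>\<^sub>0 'k)"
        by (cases b; cases c; simp add: R_def scale_mult_left scale_mult_right)+
      then show ?thesis by (simp add: null_ideal_zero)
    qed
  qed
  have \<rho>_add: "\<rho> (x \<oplus>\<^bsub>?V\<^esub> y) = \<rho> x + \<rho> y" and \<rho>_smult: "\<rho> (a \<odot>\<^bsub>?V\<^esub> x) = scale a (\<rho> x)" for x y a
    by (simp_all add: L \<rho>_def lin_add lin_scale)
  define N where "N = {q \<in> carrier F. free_hom \<rho> q \<in> null_ideal \<kappa>}"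
  have null: "uea_ideal ?V \<subseteq> N"
    unfolding N_def by (rule uea_ideal_null[OF lie \<rho>_add \<rho>_smult br])
  have "ideal N F"
    unfolding N_def by (rule ideal_null_preimage[OF lie \<rho>_add \<rho>_smult br])
  then have idlN: "ideal (coset ` N) (uea ?V)"
    using ideal_quot_algebra[OF FA.assoc_algebra_axioms idl] unfolding uea_def coset_def by blast
  have "free_hom \<rho> (word [?c] - scale \<kappa> 1) = 0"
  proof -
    have "free_hom \<rho> (word [?c] - scale \<kappa> 1) = free_hom \<rho> (word [?c]) - scale \<kappa> (free_hom \<rho> 1)"
      by (simp add: free_hom_def lin_diff lin_scale)
    then show ?thesis by (simp add: lift_word lift_one \<rho>_def virasoro_c_def lin_single R_def)
  qed
  then have "t \<in> coset ` N" unfolding t N_def using dC null_ideal_zero by (intro imageI) simp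
  then have KN: "K \<subseteq> coset ` N" unfolding K_def by (intro U.genideal_minimal[OF idlN]) simp
  have "just_infinite_gk_dim (quot_algebra (uea ?V) K)"
  proof (rule Q.just_infiniteI)
    fix i j :: int
    let ?e = "\<lambda>i. word [\<epsilon> i] :: (virasoro_basis \<Rightarrow>\<^sub>0 'k) free_monoid \<Rightarrow>\<^sub>0 'k"
    let ?b = "lie_bracket ?V (\<epsilon> i) (\<epsilon> j)"
    let ?r = "free_hom letter (word [i] * word [j] - word [j] * word [i] - vir_bracket \<kappa> i j)"
    let ?s = "scale (\<gamma> i j) (word [?c] - scale \<kappa> 1)"
    have coc: "vir_cocycle \<kappa> i j = \<gamma> i j * \<kappa>" by (simp add: vir_cocycle_def \<gamma>_def)
    have r: "?r = ?e i * ?e j - ?e j * ?e i - (scale (of_int (j - i)) (?e (i + j)) + scale (\<gamma> i j * \<kappa>)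
        1)"
      unfolding vir_bracket_def coc
      by (simp add: free_hom_def lin_diff lin_add lin_scale del: of_int_diff)
        (simp add: lift_mult lift_word lift_one letter_def flip: free_hom_def del: of_int_diff)
    have "(?e i * ?e j - ?e j * ?e i - word [?b])
        + (word [?b] - word [of_int (j - i) \<odot>\<^bsub>?V\<^esub> \<epsilon> (i + j)] - word [\<gamma> i j \<odot>\<^bsub>?V\<^esub> ?c])
        + (word [of_int (j - i) \<odot>\<^bsub>?V\<^esub> \<epsilon> (i + j)] - scale (of_int (j - i)) (?e (i + j)))
        + (word [\<gamma> i j \<odot>\<^bsub>?V\<^esub> ?c] - scale (\<gamma> i j) (word [?c])) \<in> uea_ideal ?V"
      by (intro ideal_add relation_smult relation_bracket relation_add[of "of_int (j - i) \<odot>\<^bsub>?V\<^esub> \<epsilon> (i +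
          j)" "\<gamma> i j \<odot>\<^bsub>?V\<^esub> ?c", folded bracket])
        (simp_all add: L(1))
    then have "?r - ?s \<in> uea_ideal ?V"
      unfolding r by (simp add: PM.scale_right_diff_distrib scale_scale algebra_simps del: of_int_diff)
    then have "coset ?r = coset ?s"
      by (intro coset_eqI lift_closed free_algebra_carrier_scale dC)
    also have "\<dots> = \<gamma> i j \<odot>\<^bsub>uea ?V\<^esub> t" unfolding t by (rule coset_scale[OF dC, symmetric])
    also have "\<dots> = (\<gamma> i j \<odot>\<^bsub>uea ?V\<^esub> \<one>\<^bsub>uea ?V\<^esub>) \<otimes>\<^bsub>uea ?V\<^esub> t"
      using U.smult_mult_left[of "\<gamma> i j" "\<one>\<^bsub>uea ?V\<^esub>" t] tC by simp
    also have "\<dots> \<in> K" by (intro K.I_l_closed tK U.smult_closed) simp_all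
    finally show "K +>\<^bsub>uea ?V\<^esub> coset ?r = \<zero>\<^bsub>quot_algebra (uea ?V) K\<^esub>" using zeroQ by blast
  next
    fix p :: "'k word_ring"
    assume p: "\<And>w. w \<in> supp p \<Longrightarrow> sorted (letters w) \<and> set (letters w) \<subseteq> {0<..}"
      and zero: "K +>\<^bsub>uea ?V\<^esub> \<pi> p = \<zero>\<^bsub>quot_algebra (uea ?V) K\<^esub>"
    then obtain q where q: "q \<in> N" "\<pi> p = coset q" using zeroQ KN by blast
    have "free_hom letter p \<in> \<pi> p" unfolding coset_def by (rule I.a_rcos_self[OF lift_closed])
    then have "free_hom letter p \<in> coset q" by (simp only: q(2))
    then obtain h where h: "h \<in> uea_ideal ?V" "free_hom letter p = h + q"
      unfolding coset_def a_r_coset_def' by (auto simp: free_algebra_simps(5))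
    have "free_hom \<rho> (free_hom letter p) = free_hom \<rho> h + free_hom \<rho> q" unfolding h(2) by (simp add:
        free_hom_def lin_add)
    also have "\<dots> \<in> null_ideal \<kappa>" using h(1) q(1) null by (intro null_ideal_add) (auto simp: N_def)
    finally have "free_hom \<rho> (free_hom letter p) \<in> null_ideal \<kappa>" .
    moreover have "free_hom \<rho> (free_hom letter p) = p"
      by (rule lift_lift) (simp_all add: \<rho>_def \<epsilon>_def lin_single R_def)
    ultimately show "p = 0" using null_ideal_sorted p by metis
  qed simp
  then show ?thesis by (simp add: uea_virasoro_level_def K_def t_def)
qed

theorem theorem1p2:
  fixes \<kappa> :: "'k::field_char_0"
  shows "just_infinite_gk_dim (uea (witt_plus :: ('k, int \<Rightarrow>\<^sub>0 'k) lie_algebra))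
    \<and> just_infinite_gk_dim (uea (witt :: ('k, int \<Rightarrow>\<^sub>0 'k) lie_algebra))
    \<and> just_infinite_gk_dim (uea_virasoro_level \<kappa>)
    \<and> (\<forall>I. ideal I (uea (witt_plus :: ('k, int \<Rightarrow>\<^sub>0 'k) lie_algebra))
             \<and> I \<noteq> {\<zero>\<^bsub>uea (witt_plus :: ('k, int \<Rightarrow>\<^sub>0 'k) lie_algebra)\<^esub>}
           \<longrightarrow> polynomial_growth
                 (quot_algebra (uea (witt_plus :: ('k, int \<Rightarrow>\<^sub>0 'k) lie_algebra)) I))"
proof -
  have plus: "just_infinite_gk_dim (uea (witt_plus :: ('k, int \<Rightarrow>\<^sub>0 'k) lie_algebra))"
  proof (rule just_infinite_witt_type[OF lie_algebra_witt_plus])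
    show "carrier witt_plus = {x :: int \<Rightarrow>\<^sub>0 'k. supp x \<subseteq> {0<..}}"
      unfolding carrier_witt_plus by (simp add: greaterThan_def atLeast_def int_one_le_iff_zero_less)
  qed (simp_all add: witt_plus_def witt_def lie_algebra_on_basis_def)
  have full: "just_infinite_gk_dim (uea (witt :: ('k, int \<Rightarrow>\<^sub>0 'k) lie_algebra))"
    by (rule just_infinite_witt_type[OF lie_algebra_witt, of UNIV]) (simp_all add: witt_def
        lie_algebra_on_basis_def)
  show ?thesis
    using plus full just_infinite_virasoro_level by (auto simp: just_infinite_gk_dim_def)
qed


end
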